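(* Let $0\le k\le\mu$ be integers and $m\ge0$ an integer. If $0\le m\le\mu$, the operator $E_{\mu,k}$ acts on $\widetilde{\mathcal{H}_{2m}}$ as multiplication by the constant $$\frac{(-1)^k\binom{\mu}{k}(\mu!)^2\,{}_3F_2(-k,-m-\mu-1,m-\mu;-\mu,-\mu;1)}{(\mu-m)!\,(\mu+m+1)!}.$$ If $m>\mu$, $E_{\mu,k}$ acts as $0$ on $\widetilde{\mathcal{H}_{2m}}$.
   Context: $d\iota(s)=\frac{dA(s)}{\pi(1+|s|^2)^2}$ ($dA$ Lebesgue measure) is the $SU(2)$-invariant probability measure on $\mathbb{CP}^1=\mathbb{C}\cup\{\infty\}$, where $SU(2)$ acts by Möbius transformations $\begin{pmatrix}a&b\\c&d\end{pmatrix}\cdot z=\frac{az+b}{cz+d}$, and on functions by $(g\cdot f)(z)=f(g^{-1}\cdot z)$. Under this action $L^2(\mathbb{CP}^1,d\iota)=\bigoplus_{m\ge0}\widetilde{\mathcal{H}_{2m}}$ (multiplicity free), where $\widetilde{\mathcal{H}_{2m}}\subseteq C^\infty(\mathbb{CP}^1)$ is the unique irreducible invariant subspace of dimension $2m+1$. The Berezin transform is $B_\tau(f)(z)=\int_{\mathbb{C}}\frac{|1+z\overline s|^{2\tau}}{(1+|z|^2)^\tau(1+|s|^2)^\tau}f(s)\,d\iota(s)$, and $E_{\mu,k}(f):=\binom{\mu}{k}\sum_{l=0}^k(-1)^{k-l}\binom kl B_{\mu-l}(f)$. Here ${}_3F_2(a_1,a_2,a_3;b_1,b_2;1)=\sum_{l\ge0}\frac{(a_1)_l(a_2)_l(a_3)_l}{(b_1)_l(b_2)_l\,l!}$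 with rising Pochhammer symbols $(a)_l=a(a+1)\cdots(a+l-1)$; with $a_1=-k$ the sum terminates at $l=k\le\mu$. *)

theory Defs
  imports "HOL-Analysis.Analysis" "HOL-Library.Function_Algebras"
begin

text \<open>The Riemann sphere CP^1 = C \<union> {\<infinity>} is modelled as complex option,
  with None the point at infinity.\<close>

definition mobius :: "complex \<Rightarrow> complex \<Rightarrow> complex \<Rightarrow> complex \<Rightarrow> complex option \<Rightarrow> complex option" where
  "mobius a b c d p = (case p of
       Some z \<Rightarrow> (if c * z + d = 0 then None else Some ((a * z + b) / (c * z + d)))
     | None \<Rightarrow> (if c = 0 then None else Some (a / c)))"

text \<open>An element of SU(2) is the matrix [[a, b], [-cnj b, cnj a]] with |a|^2+|b|^2 = 1;
  its inverse is [[cnj a, -b], [cnj b, a]].  Action on functions: (g.f)(z) = f(g^-1 . z).\<close>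

definition su2_act :: "complex \<Rightarrow> complex \<Rightarrow> (complex option \<Rightarrow> complex) \<Rightarrow> (complex option \<Rightarrow> complex)" where
  "su2_act a b f = (\<lambda>p. f (mobius (cnj a) (- b) (cnj b) a p))"

definition cp1_continuous :: "(complex option \<Rightarrow> complex) \<Rightarrow> bool" where
  "cp1_continuous f \<longleftrightarrow> continuous_on UNIV (\<lambda>z. f (Some z)) \<and>
     ((\<lambda>z. f (Some z)) \<longlongrightarrow> f None) at_infinity"

definition fscale :: "complex \<Rightarrow> (complex option \<Rightarrow> complex) \<Rightarrow> (complex option \<Rightarrow> complex)" where
  "fscale c f = (\<lambda>p. c * f p)"

definition su2_invariant_subspace :: "(complex option \<Rightarrow> complex) set \<Rightarrow> bool" where
  "su2_invariant_subspace V \<longleftrightarrow>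
     V \<subseteq> {f. cp1_continuous f} \<and> module.subspace fscale V \<and>
     (\<forall>a b. cmod a ^ 2 + cmod b ^ 2 = 1 \<longrightarrow> (\<forall>f\<in>V. su2_act a b f \<in> V))"

definition su2_irreducible :: "(complex option \<Rightarrow> complex) set \<Rightarrow> bool" where
  "su2_irreducible V \<longleftrightarrow> su2_invariant_subspace V \<and> V \<noteq> {0} \<and>
     (\<forall>W. su2_invariant_subspace W \<and> W \<subseteq> V \<longrightarrow> W = {0} \<or> W = V)"

definition Htilde :: "nat \<Rightarrow> (complex option \<Rightarrow> complex) set" where
  "Htilde m = (THE V. su2_irreducible V \<and> vector_space.dim fscale V = 2 * m + 1)"

text \<open>The SU(2)-invariant probability measure d iota = dA / (pi (1+|s|^2)^2) on C.\<close>

definition iota :: "complex measure" where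
  "iota = density lborel (\<lambda>s. ennreal (1 / (pi * (1 + (cmod s)\<^sup>2)\<^sup>2)))"

definition berezin :: "nat \<Rightarrow> (complex option \<Rightarrow> complex) \<Rightarrow> complex \<Rightarrow> complex" where
  "berezin \<tau> f z = (\<integral>s. complex_of_real ((cmod (1 + z * cnj s)) ^ (2 * \<tau>) /
        ((1 + (cmod z)\<^sup>2) ^ \<tau> * (1 + (cmod s)\<^sup>2) ^ \<tau>)) * f (Some s) \<partial>iota)"

definition E_op :: "nat \<Rightarrow> nat \<Rightarrow> (complex option \<Rightarrow> complex) \<Rightarrow> complex \<Rightarrow> complex" where
  "E_op \<mu> k f z = of_nat (\<mu> choose k) *
     (\<Sum>l\<le>k. (-1) ^ (k - l) * of_nat (k choose l) * berezin (\<mu> - l) f z)"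

text \<open>Terminating hypergeometric series 3F2(-k, a2, a3; b1, b2; 1) (terminates at l = k).\<close>

definition hyp3F2_term :: "nat \<Rightarrow> real \<Rightarrow> real \<Rightarrow> real \<Rightarrow> real \<Rightarrow> real" where
  "hyp3F2_term k a2 a3 b1 b2 = (\<Sum>l\<le>k.
      pochhammer (- real k) l * pochhammer a2 l * pochhammer a3 l /
      (pochhammer b1 l * pochhammer b2 l * fact l))"

end

theory Submission
  imports Defs "HOL-Real_Asymp.Real_Asymp"
begin

text \<open>
  The Berezin transform commutes with SU(2), so it is determined on an irreducible space by its value
  on one vector. On the highest weight vector \<open>(z / (1 + |z|\<^sup>2)) ^ m\<close> it is a beta integral, with
  eigenvalue \<open>\<tau>!\<^sup>2 / ((\<tau> - m)! (\<tau> + m + 1)!)\<close>, and zero if \<open>m > \<tau>\<close>. The alternating sum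
  of these eigenvalues over \<open>\<tau> = \<mu> - l\<close> is, term by term, the hypergeometric series.

  It remains to see that there is exactly one irreducible space of dimension \<open>2 m + 1\<close>, and that it
  contains this vector. The image of \<open>B\<^sub>\<tau>\<close> consists of bihomogeneous polynomials of
  bidegree \<open>(\<tau>, \<tau>)\<close>, where the raising operator shows that each nonzero invariant subspace contains a
  highest weight vector. If \<open>V\<close> is any irreducible space of dimension \<open>2 m + 1\<close>, then \<open>B\<^sub>\<tau>\<close>
  is zero or injective on \<open>V\<close>, so by dimension it maps \<open>V\<close> into the space generated by the highest
  weight vector of weight \<open>m\<close>; since \<open>(\<tau> + 1) B\<^sub>\<tau> f\<close> tends to \<open>f\<close>, the space \<open>V\<close> is
  contained in the latter.
\<close>

subsection \<open>The invariant measure\<close>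

text \<open>Members of an irreducible space are a priori only continuous, so Lie algebra operators
  cannot be applied to them directly. The transform \<open>Bz \<tau>\<close> removes this obstacle:
  its values are polynomials, on which difference quotients along one-parameter subgroups converge
  inside a finite-dimensional space. The number 2m + 1 also has to be proved. For m > 0 the upper
  bound compares degrees: \<open>Bz (m - 1)\<close> kills the space generated by \<open>hw m\<close>
  but is injective in degree m - 1, and passing from degree m - 1 to m adds 2m + 1 monomials. The
  lower bound splits one translate of \<open>hw m\<close> into weight components. Different m are
  told apart by the eigenvalues, since \<open>lam \<tau> m\<close> vanishes exactly for \<tau> < m.
  The moments behind the eigenvalues follow from invariance and the total mass alone.\<close>

text \<open>Elimination: substituting u = a x + b y leaves c x + d y = (c/a) u + (D/a) y with D = a
  d - b c, so two scalar substitutions give the factor J(a) J(D/a) = J(D). The Jacobian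
  \<open>J\<close> is abstract so that one proof covers R^2, with J(c) = |c|, and C^2, with J(c) =
  |c|^2.\<close>

lemma nn_integral_linear_2x2:
  fixes J :: "'a::{euclidean_space, real_normed_field} \<Rightarrow> ennreal"
  assumes affine: "\<And>f c t. f \<in> borel_measurable borel \<Longrightarrow> c \<noteq> 0 \<Longrightarrow>
      (\<integral>\<^sup>+x. f x \<partial>lborel) = J c * (\<integral>\<^sup>+x. f (t + c * x) \<partial>lborel)"
    and mult: "\<And>x y. J (x * y) = J x * J y" and minus: "\<And>x. J (- x) = J x"
    and G [measurable]: "G \<in> borel_measurable (borel \<Otimes>\<^sub>M borel)"
    and det: "a * d - b * c \<noteq> 0"
  shows "(\<integral>\<^sup>+x. \<integral>\<^sup>+y. G (x, y) \<partial>lborel \<partial>lborel)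
       = J (a * d - b * c) * (\<integral>\<^sup>+x. \<integral>\<^sup>+y. G (a * x + b * y, c * x + d * y) \<partial>lborel \<partial>lborel)"
proof (cases "a = 0")
  case False
  let ?D = "a * d - b * c"
  have swap1: "(\<integral>\<^sup>+x. \<integral>\<^sup>+y. G (a * x + b * y, c * x + d * y) \<partial>lborel \<partial>lborel)
      = (\<integral>\<^sup>+y. \<integral>\<^sup>+x. G (a * x + b * y, c * x + d * y) \<partial>lborel \<partial>lborel)"
    by (intro lborel_pair.Fubini') measurable
  have inner: "J a * (\<integral>\<^sup>+x. G (a * x + b * y, c * x + d * y) \<partial>lborel)
      = (\<integral>\<^sup>+u. G (u, c / a * u + ?D / a * y) \<partial>lborel)" for y
  proof -
    have "c / a * (b * y + a * x) + ?D / a * y = c * x + d * y" for x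
      using False by (simp add: field_simps)
    then show ?thesis
      using affine[of "\<lambda>u. G (u, c / a * u + ?D / a * y)" a "b * y"] False
      by (simp add: add.commute)
  qed
  have inner2: "J (?D / a) * (\<integral>\<^sup>+y. G (u, c / a * u + ?D / a * y) \<partial>lborel)
      = (\<integral>\<^sup>+y. G (u, y) \<partial>lborel)" for u
    using affine[of "\<lambda>v. G (u, v)" "?D / a" "c / a * u"] False det by simp
  have "J ?D = J (?D / a) * J a"
    using False by (simp flip: mult)
  then have "J ?D * (\<integral>\<^sup>+x. \<integral>\<^sup>+y. G (a * x + b * y, c * x + d * y) \<partial>lborel \<partial>lborel)
      = J (?D / a) * (\<integral>\<^sup>+y. \<integral>\<^sup>+u. G (u, c / a * u + ?D / a * y) \<partial>lborel \<partial>lborel)"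
    by (simp only: swap1 mult.assoc nn_integral_cmult[symmetric] inner[symmetric]) (subst nn_integral_cmult, measurable)
  also have "(\<integral>\<^sup>+y. \<integral>\<^sup>+u. G (u, c / a * u + ?D / a * y) \<partial>lborel \<partial>lborel)
      = (\<integral>\<^sup>+u. \<integral>\<^sup>+y. G (u, c / a * u + ?D / a * y) \<partial>lborel \<partial>lborel)"
    by (intro lborel_pair.Fubini') measurable
  also have "J (?D / a) * \<dots> = (\<integral>\<^sup>+u. \<integral>\<^sup>+y. G (u, y) \<partial>lborel \<partial>lborel)"
    by (simp add: nn_integral_cmult flip: inner2)
  finally show ?thesis ..
next
  \<comment> \<open>Here the determinant is -(b c): the order of integration is exchanged, and
    evenness of \<open>J\<close> absorbs the sign.\<close>
  case True
  then have b: "b \<noteq> 0" and c: "c \<noteq> 0" using det by auto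
  have "(\<integral>\<^sup>+x. \<integral>\<^sup>+y. G (a * x + b * y, c * x + d * y) \<partial>lborel \<partial>lborel)
      = (\<integral>\<^sup>+y. \<integral>\<^sup>+x. G (b * y, d * y + c * x) \<partial>lborel \<partial>lborel)"
    using True by (subst lborel_pair.Fubini') (simp_all add: add.commute)
  moreover have "J c * (\<integral>\<^sup>+x. G (b * y, d * y + c * x) \<partial>lborel) = (\<integral>\<^sup>+v. G (b * y, v) \<partial>lborel)" for y
    using affine[of "\<lambda>v. G (b * y, v)" c "d * y"] c by simp
  moreover have "J b * (\<integral>\<^sup>+y. \<integral>\<^sup>+v. G (b * y, v) \<partial>lborel \<partial>lborel)
      = (\<integral>\<^sup>+u. \<integral>\<^sup>+v. G (u, v) \<partial>lborel \<partial>lborel)"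
    using affine[of "\<lambda>u. \<integral>\<^sup>+v. G (u, v) \<partial>lborel" b 0] b by simp
  moreover have "J (a * d - b * c) = J b * J c"
    using True by (simp add: minus mult)
  ultimately show ?thesis
    by (simp add: mult.assoc flip: nn_integral_cmult)
qed

lemma lborel_complex_eq: "(lborel :: complex measure) = distr (lborel \<Otimes>\<^sub>M lborel) borel (\<lambda>(x, y). Complex x y)"
proof (rule lborel_eqI)
  fix l u :: complex
  assume le: "\<And>b. b \<in> Basis \<Longrightarrow> l \<bullet> b \<le> u \<bullet> b"
  have [measurable]: "(\<lambda>(x, y). Complex x y) \<in> borel_measurable (lborel \<Otimes>\<^sub>M lborel)"
    unfolding Complex_eq by measurable
  have "emeasure (distr (lborel \<Otimes>\<^sub>M lborel) borel (\<lambda>(x, y). Complex x y)) (box l u)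
     = emeasure (lborel \<Otimes>\<^sub>M lborel) ({Re l<..<Re u} \<times> {Im l<..<Im u})"
    by (subst emeasure_distr) (auto simp: in_box_complex_iff space_pair_measure intro!: arg_cong[where f="emeasure _"])
  also have "\<dots> = emeasure lborel {Re l<..<Re u} * emeasure lborel {Im l<..<Im u}"
    by (rule lborel.emeasure_pair_measure_Times) auto
  also have "\<dots> = ennreal (\<Prod>b\<in>Basis. (u - l) \<bullet> b)"
    using le[of 1] le[of \<i>] by (simp add: Basis_complex_def ennreal_mult)
  finally show "emeasure (distr (lborel \<Otimes>\<^sub>M lborel) borel (\<lambda>(x, y). Complex x y)) (box l u)
     = ennreal (\<Prod>b\<in>Basis. (u - l) \<bullet> b)" .
qed simp

lemma nn_integral_lborel_complex:
  assumes [measurable]: "f \<in> borel_measurable borel"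
  shows "(\<integral>\<^sup>+z. f z \<partial>lborel) = (\<integral>\<^sup>+x. \<integral>\<^sup>+y. f (Complex x y) \<partial>lborel \<partial>lborel)"
proof -
  have [measurable]: "(\<lambda>(x, y). Complex x y) \<in> borel_measurable (lborel \<Otimes>\<^sub>M lborel)"
    unfolding Complex_eq by measurable
  show ?thesis
    by (subst lborel_complex_eq, subst nn_integral_distr)
       (auto simp: lborel.nn_integral_fst[symmetric] case_prod_beta)
qed

text \<open>Multiplication by \<open>c\<close> is a real 2x2 matrix of determinant |c|^2, so the
  elimination lemma over the reals applies. The result is the scalar Jacobian for the same lemma
  over the complex numbers.\<close>

lemma nn_integral_complex_affine:
  fixes c t :: complex
  assumes f [measurable]: "f \<in> borel_measurable borel" and c: "c \<noteq> 0"
  shows "(\<integral>\<^sup>+z. f z \<partial>lborel) = ennreal ((cmod c)\<^sup>2) * (\<integral>\<^sup>+z. f (t + c * z) \<partial>lborel)"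
proof -
  have det: "Re c * Re c - (- Im c) * Im c = (cmod c)\<^sup>2"
    unfolding cmod_power2 by (simp add: power2_eq_square)
  have lin: "(\<integral>\<^sup>+z. g z \<partial>lborel) = ennreal ((cmod c)\<^sup>2) * (\<integral>\<^sup>+z. g (c * z) \<partial>lborel)"
    if [measurable]: "g \<in> borel_measurable borel" for g
  proof -
    have [measurable]: "(\<lambda>(x, y). g (Complex x y)) \<in> borel_measurable (borel \<Otimes>\<^sub>M borel)"
      unfolding Complex_eq by measurable
    have "(\<integral>\<^sup>+x. \<integral>\<^sup>+y. (\<lambda>(x, y). g (Complex x y)) (x, y) \<partial>lborel \<partial>lborel)
      = ennreal \<bar>Re c * Re c - (- Im c) * Im c\<bar> *
        (\<integral>\<^sup>+x. \<integral>\<^sup>+y. (\<lambda>(x, y). g (Complex x y)) (Re c * x + (- Im c) * y, Im c * x + Re c * y) \<partial>lborel \<partial>lborel)"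
      by (rule nn_integral_linear_2x2[where J="\<lambda>c. ennreal \<bar>c\<bar>"])
         (use c det in \<open>simp_all add: nn_integral_real_affine abs_mult ennreal_mult\<close>)
    also have "\<bar>Re c * Re c - (- Im c) * Im c\<bar> = (cmod c)\<^sup>2"
      unfolding det by simp
    also have "(\<integral>\<^sup>+x. \<integral>\<^sup>+y. (\<lambda>(x, y). g (Complex x y)) (Re c * x + (- Im c) * y, Im c * x + Re c * y) \<partial>lborel \<partial>lborel)
       = (\<integral>\<^sup>+x. \<integral>\<^sup>+y. g (c * Complex x y) \<partial>lborel \<partial>lborel)"
      by (intro nn_integral_cong) (auto simp: complex_eq_iff intro!: arg_cong[where f=g])
    finally show ?thesis
      by (simp add: nn_integral_lborel_complex)
  qed
  have "(\<integral>\<^sup>+z. f z \<partial>lborel) = (\<integral>\<^sup>+z. f (t + z) \<partial>lborel)"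
    by (subst lborel_distr_plus[of t, symmetric], subst nn_integral_distr) auto
  also have "\<dots> = ennreal ((cmod c)\<^sup>2) * (\<integral>\<^sup>+z. f (t + c * z) \<partial>lborel)"
    by (rule lin) measurable
  finally show ?thesis .
qed

text \<open>The determinant is |a|^2 + |b|^2 = 1, so the complex Jacobian is 1.\<close>

lemma nn_integral_su2:
  fixes a b :: complex
  assumes [measurable]: "G \<in> borel_measurable (borel \<Otimes>\<^sub>M borel)" and ab: "(cmod a)\<^sup>2 + (cmod b)\<^sup>2 = 1"
  shows "(\<integral>\<^sup>+x. \<integral>\<^sup>+y. G (a * x + b * y, - cnj b * x + cnj a * y) \<partial>lborel \<partial>lborel)
       = (\<integral>\<^sup>+x. \<integral>\<^sup>+y. G (x, y) \<partial>lborel \<partial>lborel)"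
proof -
  have det: "a * cnj a - b * (- cnj b) = 1"
    using arg_cong[OF ab, of complex_of_real] by (simp only: of_real_add complex_norm_square) simp
  show ?thesis
    using nn_integral_linear_2x2[where J="\<lambda>c. ennreal ((cmod c)\<^sup>2)" and a=a and b=b
          and c="- cnj b" and d="cnj a" and G=G, unfolded det]
    by (simp add: nn_integral_complex_affine norm_mult power_mult_distrib ennreal_mult)
qed

section \<open>Projection of the unit ball of C^2 to the projective line\<close>

text \<open>The fibre integral left over when Lebesgue measure on the unit ball is projected to the
  line. It is cancelled from the invariance identity, for which it must be neither 0 nor
  infinite.\<close>

definition disc_moment :: ennreal where
  "disc_moment = (\<integral>\<^sup>+w. ennreal ((cmod w)\<^sup>2) * indicator {w. (cmod w)\<^sup>2 \<le> 1} w \<partial>lborel)"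

lemma disc_moment_finite_pos: "0 < disc_moment" "disc_moment < \<infinity>"
proof -
  have "disc_moment \<le> (\<integral>\<^sup>+w. indicator (cball (0::complex) 1) w \<partial>lborel)"
    unfolding disc_moment_def
    by (intro nn_integral_mono) (auto simp: indicator_def power_le_one_iff ennreal_le_1 abs_square_le_1)
  also have "\<dots> = emeasure lborel (cball (0::complex) 1)"
    by simp
  also have "\<dots> < \<infinity>"
    by (simp add: emeasure_cball)
  finally show "disc_moment < \<infinity>" .
  \<comment> \<open>This ball lies in the annulus 1/2 \<le> |w| \<le> 1, where the integrand is at
    least 1/4.\<close>
  have "0 < ennreal (1/4) * emeasure lborel (ball (3/4 :: complex) (1/4))"
    by (simp add: emeasure_ball ennreal_zero_less_mult_iff)
  also have "\<dots> = (\<integral>\<^sup>+w. ennreal (1/4) * indicator (ball (3/4 :: complex) (1/4)) w \<partial>lborel)"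
    by (subst nn_integral_cmult_indicator) simp_all
  also have "\<dots> \<le> disc_moment"
    unfolding disc_moment_def
  proof (intro nn_integral_mono)
    fix w :: complex
    show "ennreal (1/4) * indicator (ball (3/4) (1/4)) w \<le> ennreal ((cmod w)\<^sup>2) * indicator {w. (cmod w)\<^sup>2 \<le> 1} w"
    proof (cases "w \<in> ball (3/4) (1/4)")
      case True
      then have "cmod (3/4 - w) < 1/4" by (simp add: dist_norm)
      moreover have "cmod (3/4) \<le> cmod (3/4 - w) + cmod w"
        using norm_triangle_sub[of "3/4 :: complex" w] by simp
      moreover have "cmod w \<le> cmod (3/4) + cmod (3/4 - w)"
        using norm_triangle_sub[of w "3/4 :: complex"] by (simp add: norm_minus_commute)
      ultimately have w: "1/2 \<le> cmod w" "cmod w \<le> 1" by simp_all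
      have "(1/2)\<^sup>2 \<le> (cmod w)\<^sup>2" using w by (intro power_mono) auto
      moreover have "(cmod w)\<^sup>2 \<le> 1" using w by (simp add: power_le_one)
      ultimately show ?thesis using True
        by (simp add: power2_eq_square ennreal_leI)
    qed simp
  qed
  finally show "0 < disc_moment" .
qed

lemma sets_unit_ball2 [measurable]:
  "{(x :: complex, y :: complex). (cmod x)\<^sup>2 + (cmod y)\<^sup>2 \<le> 1} \<in> sets (borel \<Otimes>\<^sub>M borel)"
proof -
  have "{p \<in> space (borel \<Otimes>\<^sub>M borel). (cmod (fst p))\<^sup>2 + (cmod (snd p))\<^sup>2 \<le> 1} \<in> sets (borel \<Otimes>\<^sub>M borel)"
    by measurable
  then show ?thesis by (simp add: space_pair_measure case_prod_beta')
qed

text \<open>Up to a constant, \<open>iota\<close> is the image of Lebesgue measure on the unit ball of C^2 under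
  the projection to the projective line; its invariance is therefore that of Lebesgue measure.\<close>

lemma nn_integral_ball_quotient:
  assumes [measurable]: "F \<in> borel_measurable borel"
  shows "(\<integral>\<^sup>+x. \<integral>\<^sup>+y. F (x / y) * indicator {(x, y). (cmod x)\<^sup>2 + (cmod y)\<^sup>2 \<le> 1} (x, y) \<partial>lborel \<partial>lborel)
       = (ennreal pi * disc_moment) * (\<integral>\<^sup>+s. F s \<partial>iota)"
proof -
  let ?I = "\<lambda>x y :: complex. indicator {(x, y). (cmod x)\<^sup>2 + (cmod y)\<^sup>2 \<le> 1} (x, y) :: ennreal"
  have "(\<integral>\<^sup>+x. \<integral>\<^sup>+y. F (x / y) * ?I x y \<partial>lborel \<partial>lborel) = (\<integral>\<^sup>+y. \<integral>\<^sup>+x. F (x / y) * ?I x y \<partial>lborel \<partial>lborel)"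
    by (intro lborel_pair.Fubini') measurable
  \<comment> \<open>For fixed y \<noteq> 0 the substitution x = y s, with Jacobian |y|^2, makes the
    quotient the integration variable.\<close>
  also have "\<dots> = (\<integral>\<^sup>+y. \<integral>\<^sup>+s. F s * (ennreal ((cmod y)\<^sup>2) * ?I (y * s) y) \<partial>lborel \<partial>lborel)"
  proof (rule nn_integral_cong_AE)
    have "AE y :: complex in lborel. y \<noteq> 0"
      by (rule AE_lborel_singleton)
    then show "AE y in lborel. (\<integral>\<^sup>+x. F (x / y) * ?I x y \<partial>lborel) = (\<integral>\<^sup>+s. F s * (ennreal ((cmod y)\<^sup>2) * ?I (y * s) y) \<partial>lborel)"
    proof eventually_elim
      case (elim y)
      have "(\<integral>\<^sup>+x. F (x / y) * ?I x y \<partial>lborel) = ennreal ((cmod y)\<^sup>2) * (\<integral>\<^sup>+s. F s * ?I (y * s) y \<partial>lborel)"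
        using elim by (subst nn_integral_complex_affine[of _ y 0]) auto
      also have "\<dots> = (\<integral>\<^sup>+s. F s * (ennreal ((cmod y)\<^sup>2) * ?I (y * s) y) \<partial>lborel)"
        by (subst nn_integral_cmult[symmetric]) (auto simp: mult_ac)
      finally show ?case .
    qed
  qed
  also have "\<dots> = (\<integral>\<^sup>+s. \<integral>\<^sup>+y. F s * (ennreal ((cmod y)\<^sup>2) * ?I (y * s) y) \<partial>lborel \<partial>lborel)"
    by (intro lborel_pair.Fubini') measurable
  also have "\<dots> = (\<integral>\<^sup>+s. (ennreal pi * disc_moment) * (ennreal (1 / (pi * (1 + (cmod s)\<^sup>2)\<^sup>2)) * F s) \<partial>lborel)"
  proof (intro nn_integral_cong)
    fix s :: complex
    \<comment> \<open>Rescaling y = r w turns |y s|^2 + |y|^2 \<le> 1 into |w|^2 \<le> 1. One factor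
      r^2 comes from the Jacobian, one from the integrand |y|^2; together they are 1 / (1 +
      |s|^2)^2, the density up to the factor pi.\<close>
    define r where "r = 1 / sqrt (1 + (cmod s)\<^sup>2)"
    have p: "1 + (cmod s)\<^sup>2 > 0" by (simp add: add_pos_nonneg)
    have r: "r > 0" "r\<^sup>2 = 1 / (1 + (cmod s)\<^sup>2)"
      using p by (auto simp: r_def power_divide)
    have I: "?I (complex_of_real r * (w * s)) (complex_of_real r * w) = indicator {w. (cmod w)\<^sup>2 \<le> 1} w" for w
    proof -
      have "(cmod (complex_of_real r * (w * s)))\<^sup>2 + (cmod (complex_of_real r * w))\<^sup>2 = r\<^sup>2 * (1 + (cmod s)\<^sup>2) * (cmod w)\<^sup>2"
        by (simp add: norm_mult power_mult_distrib algebra_simps)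
      also have "\<dots> = (cmod w)\<^sup>2" using r p by simp
      finally show ?thesis by (simp add: indicator_def)
    qed
    have "(\<integral>\<^sup>+y. ennreal ((cmod y)\<^sup>2) * ?I (y * s) y \<partial>lborel)
        = ennreal (r\<^sup>2) * (\<integral>\<^sup>+w. ennreal (r\<^sup>2) * (ennreal ((cmod w)\<^sup>2) * indicator {w. (cmod w)\<^sup>2 \<le> 1} w) \<partial>lborel)"
      using r(1) by (subst nn_integral_complex_affine[of _ "complex_of_real r" 0])
        (auto simp: I norm_mult power_mult_distrib ennreal_mult mult.assoc)
    also have "\<dots> = ennreal (r\<^sup>2 * r\<^sup>2) * disc_moment"
      by (simp only: nn_integral_cmult disc_moment_def ennreal_mult zero_le_power2 mult.assoc)
         (subst nn_integral_cmult, measurable)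
    also have "r\<^sup>2 * r\<^sup>2 = pi * (1 / (pi * (1 + (cmod s)\<^sup>2)\<^sup>2))"
      using r by (simp add: power2_eq_square)
    finally have *: "(\<integral>\<^sup>+y. ennreal ((cmod y)\<^sup>2) * ?I (y * s) y \<partial>lborel)
      = ennreal pi * ennreal (1 / (pi * (1 + (cmod s)\<^sup>2)\<^sup>2)) * disc_moment"
      by (simp only: ennreal_mult pi_ge_zero zero_le_divide_iff zero_le_mult_iff zero_le_power2 zero_le_one simp_thms)
    have "(\<integral>\<^sup>+y. F s * (ennreal ((cmod y)\<^sup>2) * ?I (y * s) y) \<partial>lborel)
        = F s * (\<integral>\<^sup>+y. ennreal ((cmod y)\<^sup>2) * ?I (y * s) y \<partial>lborel)"
      by (intro nn_integral_cmult) measurable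
    then show "(\<integral>\<^sup>+y. F s * (ennreal ((cmod y)\<^sup>2) * ?I (y * s) y) \<partial>lborel) =
        (ennreal pi * disc_moment) * (ennreal (1 / (pi * (1 + (cmod s)\<^sup>2)\<^sup>2)) * F s)"
      unfolding * by (simp add: mult_ac)
  qed
  also have "\<dots> = (ennreal pi * disc_moment) * (\<integral>\<^sup>+s. F s \<partial>iota)"
    unfolding iota_def by (subst nn_integral_cmult, measurable) (simp add: nn_integral_density)
  finally show ?thesis .
qed

lemma sets_iota [simp, measurable_cong]: "sets iota = sets borel"
  by (simp add: iota_def)

lemma space_iota [simp]: "space iota = UNIV"
  by (simp add: iota_def)

lemma su2_norm:
  assumes "(cmod a)\<^sup>2 + (cmod b)\<^sup>2 = 1"
  shows "(cmod (a * x + b * y))\<^sup>2 + (cmod (- cnj b * x + cnj a * y))\<^sup>2 = (cmod x)\<^sup>2 + (cmod y)\<^sup>2"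
proof -
  have "complex_of_real ((cmod (a * x + b * y))\<^sup>2 + (cmod (- cnj b * x + cnj a * y))\<^sup>2)
    = complex_of_real (((cmod a)\<^sup>2 + (cmod b)\<^sup>2) * ((cmod x)\<^sup>2 + (cmod y)\<^sup>2))"
    by (simp only: of_real_add of_real_mult complex_norm_square) (simp add: algebra_simps)
  then show ?thesis unfolding of_real_eq_iff assms by simp
qed

lemma nn_integral_iota_su2:
  assumes [measurable]: "F \<in> borel_measurable borel" and ab: "(cmod a)\<^sup>2 + (cmod b)\<^sup>2 = 1"
  shows "(\<integral>\<^sup>+s. F ((a * s + b) / (- cnj b * s + cnj a)) \<partial>iota) = (\<integral>\<^sup>+s. F s \<partial>iota)"
proof -
  let ?B = "{(x :: complex, y :: complex). (cmod x)\<^sup>2 + (cmod y)\<^sup>2 \<le> 1}"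
  let ?T = "\<lambda>s. (a * s + b) / (- cnj b * s + cnj a)"
  have "(\<integral>\<^sup>+x. \<integral>\<^sup>+y. (F \<circ> ?T) (x / y) * indicator ?B (x, y) \<partial>lborel \<partial>lborel)
      = (\<integral>\<^sup>+x. \<integral>\<^sup>+y. (\<lambda>(x, y). F (x / y) * indicator ?B (x, y)) (a * x + b * y, - cnj b * x + cnj a * y) \<partial>lborel \<partial>lborel)"
  proof (rule nn_integral_cong, rule nn_integral_cong_AE)
    fix x :: complex
    have "AE y :: complex in lborel. y \<noteq> 0"
      by (rule AE_lborel_singleton)
    then show "AE y in lborel. (F \<circ> ?T) (x / y) * indicator ?B (x, y)
       = (\<lambda>(x, y). F (x / y) * indicator ?B (x, y)) (a * x + b * y, - cnj b * x + cnj a * y)"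
    proof eventually_elim
      case (elim y)
      \<comment> \<open>If the lower coordinate vanishes, both quotients are 0 by the convention for
        division by zero, so y = 0 is the only value to exclude.\<close>
      have "?T (x / y) = ((a * x + b * y) / y) / ((- cnj b * x + cnj a * y) / y)"
      proof -
        have "a * (x / y) + b = (a * x + b * y) / y" "- cnj b * (x / y) + cnj a = (- cnj b * x + cnj a * y) / y"
          using elim by (simp_all add: field_simps)
        then show ?thesis by simp
      qed
      also have "\<dots> = (a * x + b * y) / (- cnj b * x + cnj a * y)"
        using elim by simp
      finally show ?case
        by (simp add: indicator_def su2_norm[OF ab, simplified])
    qed
  qed
  also have "\<dots> = (\<integral>\<^sup>+x. \<integral>\<^sup>+y. (\<lambda>(x, y). F (x / y) * indicator ?B (x, y)) (x, y) \<partial>lborel \<partial>lborel)"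
    by (rule nn_integral_su2[OF _ ab]) measurable
  finally have "(ennreal pi * disc_moment) * (\<integral>\<^sup>+s. (F \<circ> ?T) s \<partial>iota) = (ennreal pi * disc_moment) * (\<integral>\<^sup>+s. F s \<partial>iota)"
    by (subst (asm) (1) nn_integral_ball_quotient) (simp_all add: nn_integral_ball_quotient o_def)
  then show ?thesis
    using disc_moment_finite_pos
    by (subst (asm) ennreal_mult_cancel_left) (auto simp: ennreal_mult_eq_top_iff o_def)
qed

text \<open>Layer cake: 1 / (1 + |s|^2)^2 is the integral of 2 / (1 + t)^3 over t \<ge> |s|^2. After
  exchanging the integrals, the inner one is the area pi t of a disc of radius sqrt t, and what
  remains has the antiderivative t^2 / (1 + t)^2.\<close>

lemma emeasure_iota_UNIV: "emeasure iota UNIV = 1"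
proof -
  have tail: "(\<integral>\<^sup>+t. ennreal (2 / (1 + t)^3) * indicator {r..} t \<partial>lborel) = ennreal (1 / (1 + r)\<^sup>2)"
    if "r \<ge> 0" for r :: real
  proof -
    have deriv: "((\<lambda>t. - (1 / (1 + t)\<^sup>2)) has_real_derivative 2 / (1 + t)^3) (at t)" if "t \<ge> 0" for t :: real
    proof -
      have "1 + t \<noteq> 0" using that by simp
      then show ?thesis
        by (auto intro!: derivative_eq_intros simp: power2_eq_square power3_eq_cube divide_simps)
    qed
    have "((\<lambda>t::real. - (1 / (1 + t)\<^sup>2)) \<longlongrightarrow> 0) at_top"
      by real_asymp
    then have "(\<integral>\<^sup>+t. ennreal (2 / (1 + t)^3) * indicator {r..} t \<partial>lborel) = ennreal (0 - (- (1 / (1 + r)\<^sup>2)))"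
      using that by (intro nn_integral_FTC_atLeast[where F="\<lambda>t. - (1 / (1 + t)\<^sup>2)"])
        (auto intro!: deriv)
    then show ?thesis by simp
  qed
  have area: "(\<integral>\<^sup>+s. indicator {(cmod s)\<^sup>2..} t \<partial>lborel) = ennreal (pi * t)" if "t \<ge> 0" for t
  proof -
    have "(\<integral>\<^sup>+s. indicator {(cmod s)\<^sup>2..} t \<partial>lborel) = (\<integral>\<^sup>+s. indicator (cball (0::complex) (sqrt t)) s \<partial>lborel)"
      using that by (intro nn_integral_cong) (auto simp: indicator_def real_le_rsqrt intro: sqrt_ge_absD)
    also have "\<dots> = ennreal (pi * t)"
      using that by (simp add: emeasure_cball unit_ball_vol_2)
    finally show ?thesis .
  qed
  have "emeasure iota UNIV = (\<integral>\<^sup>+s. ennreal (1 / pi) * ennreal (1 / (1 + (cmod s)\<^sup>2)\<^sup>2) \<partial>lborel)"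
    unfolding iota_def by (subst emeasure_density) (auto simp flip: ennreal_mult)
  also have "\<dots> = ennreal (1 / pi) * (\<integral>\<^sup>+s. \<integral>\<^sup>+t. ennreal (2 / (1 + t)^3) * indicator {(cmod s)\<^sup>2..} t \<partial>lborel \<partial>lborel)"
    by (subst nn_integral_cmult) (simp_all add: tail)
  also have "(\<integral>\<^sup>+s. \<integral>\<^sup>+t. ennreal (2 / (1 + t)^3) * indicator {(cmod s)\<^sup>2..} t \<partial>lborel \<partial>lborel)
     = (\<integral>\<^sup>+t. \<integral>\<^sup>+s. ennreal (2 / (1 + t)^3) * indicator {(cmod s)\<^sup>2..} t \<partial>lborel \<partial>lborel)"
    by (intro lborel_pair.Fubini') (auto simp: indicator_def)
  also have "\<dots> = (\<integral>\<^sup>+t. ennreal pi * (ennreal (2 * t / (1 + t)^3) * indicator {0..} t) \<partial>lborel)"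
  proof (intro nn_integral_cong)
    fix t :: real
    have "(\<integral>\<^sup>+s. ennreal (2 / (1 + t)^3) * indicator {(cmod s)\<^sup>2..} t \<partial>lborel)
       = ennreal (2 / (1 + t)^3) * (\<integral>\<^sup>+s. indicator {(cmod s)\<^sup>2..} t \<partial>lborel)"
      by (intro nn_integral_cmult) (simp add: indicator_def)
    moreover have "(\<integral>\<^sup>+s. indicator {(cmod s)\<^sup>2..} t \<partial>lborel) = 0" if "t < 0"
    proof -
      have "indicator {(cmod s)\<^sup>2..} t = (0 :: ennreal)" for s
        using that order_trans[OF zero_le_power2[of "cmod s"], of t] by (auto simp: indicator_def)
      then show ?thesis by simp
    qed
    ultimately show "(\<integral>\<^sup>+s. ennreal (2 / (1 + t)^3) * indicator {(cmod s)\<^sup>2..} t \<partial>lborel)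
       = ennreal pi * (ennreal (2 * t / (1 + t)^3) * indicator {0..} t)"
      by (cases "t \<ge> 0") (auto simp: area mult_ac simp flip: ennreal_mult')
  qed
  also have "\<dots> = ennreal pi * ennreal (1 - 0\<^sup>2 / (1 + 0)\<^sup>2)"
  proof -
    have deriv: "((\<lambda>t. t\<^sup>2 / (1 + t)\<^sup>2) has_real_derivative 2 * t / (1 + t)^3) (at t)" if "t \<ge> 0" for t :: real
    proof -
      have "1 + t \<noteq> 0" using that by simp
      then show ?thesis
        by (auto intro!: derivative_eq_intros simp: power2_eq_square power3_eq_cube divide_simps)
           (simp add: algebra_simps)
    qed
    have "((\<lambda>t::real. t\<^sup>2 / (1 + t)\<^sup>2) \<longlongrightarrow> 1) at_top"
      by real_asymp
    then have "(\<integral>\<^sup>+t. ennreal (2 * t / (1 + t)^3) * indicator {0..} t \<partial>lborel) = ennreal (1 - 0\<^sup>2 / (1 + 0)\<^sup>2)"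
      by (intro nn_integral_FTC_atLeast[where F="\<lambda>t. t\<^sup>2 / (1 + t)\<^sup>2"])
        (auto intro!: deriv)
    then show ?thesis by (simp add: nn_integral_cmult)
  qed
  finally show ?thesis
    by (simp flip: ennreal_mult')
qed

interpretation iota: finite_measure iota
  by (rule finite_measureI) (simp add: emeasure_iota_UNIV)

subsection \<open>Homogeneous coordinates and continuous functions\<close>

text \<open>\<open>hx\<close> and \<open>hy\<close> choose a nonzero representative in C^2 of each
  point of the line. There Moebius maps are linear, and infinity needs no separate
  treatment.\<close>

definition hx :: "complex option \<Rightarrow> complex" where
  "hx p = (case p of None \<Rightarrow> 1 | Some z \<Rightarrow> z)"

definition hy :: "complex option \<Rightarrow> complex" where
  "hy p = (case p of None \<Rightarrow> 0 | Some z \<Rightarrow> 1)"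

text \<open>The projection from C^2. It is total and sends (0, 0) to \<open>None\<close>, which is
  why facts about it assume a nonzero vector.\<close>

definition pt :: "complex \<Rightarrow> complex \<Rightarrow> complex option" where
  "pt v w = (if w = 0 then None else Some (v / w))"

lemma hxy_simps [simp]: "hx (Some z) = z" "hy (Some z) = 1" "hx None = 1" "hy None = 0"
  by (simp_all add: hx_def hy_def)

lemma pt_hxy [simp]: "pt (hx p) (hy p) = p"
  by (cases p) (auto simp: pt_def)

lemma hxy_nonzero: "hx p \<noteq> 0 \<or> hy p \<noteq> 0"
  by (cases p) auto

lemma pt_one [simp]: "pt z 1 = Some z"
  by (simp add: pt_def)

lemma hxy_pt:
  assumes "v \<noteq> 0 \<or> w \<noteq> 0"
  obtains c where "c \<noteq> 0" "hx (pt v w) = c * v" "hy (pt v w) = c * w"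
proof (cases "w = 0")
  case True
  then show ?thesis using assms that[of "1 / v"] by (simp add: pt_def)
next
  case False
  then show ?thesis using assms that[of "1 / w"] by (simp add: pt_def)
qed

lemma sum_norm_squares_pos:
  fixes v w :: complex
  shows "v \<noteq> 0 \<or> w \<noteq> 0 \<Longrightarrow> (cmod v)\<^sup>2 + (cmod w)\<^sup>2 > 0"
  by (auto simp: sum_power2_gt_zero_iff)

lemma mobius_pt:
  assumes "v \<noteq> 0 \<or> w \<noteq> 0"
  shows "mobius a b c d (pt v w) = pt (a * v + b * w) (c * v + d * w)"
proof (cases "w = 0")
  case True
  then show ?thesis using assms by (simp add: pt_def mobius_def)
next
  case False
  then have eq: "c * (v / w) + d = (c * v + d * w) / w" "a * (v / w) + b = (a * v + b * w) / w"
    by (simp_all add: field_simps)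
  have "mobius a b c d (pt v w)
      = (if c * (v / w) + d = 0 then None else Some ((a * (v / w) + b) / (c * (v / w) + d)))"
    using False by (simp add: pt_def mobius_def)
  also have "\<dots> = pt (a * v + b * w) (c * v + d * w)"
    unfolding eq using False by (simp add: pt_def)
  finally show ?thesis .
qed

lemma su2_nonzero:
  assumes "(cmod a)\<^sup>2 + (cmod b)\<^sup>2 = 1" "v \<noteq> 0 \<or> w \<noteq> 0"
  shows "a * v + b * w \<noteq> 0 \<or> - cnj b * v + cnj a * w \<noteq> 0"
proof (rule ccontr)
  assume "\<not> ?thesis"
  then have "(cmod v)\<^sup>2 + (cmod w)\<^sup>2 = 0"
    using su2_norm[OF assms(1), of v w] by simp
  then show False using assms(2) by (simp add: sum_power2_eq_zero_iff)
qed

section \<open>Continuity on the sphere\<close>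

text \<open>Replaces the two conditions on the finite part and at infinity by one condition on C^2
  minus the origin. Continuity of a translate is then composition with an invertible linear
  map.\<close>

lemma cp1_continuous_iff_homogeneous:
  "cp1_continuous f \<longleftrightarrow> continuous_on (- {(0, 0)}) (\<lambda>(v, w). f (pt v w))"
proof
  assume f: "cp1_continuous f"
  have fin: "continuous_on UNIV (\<lambda>z. f (Some z))" and lim: "((\<lambda>z. f (Some z)) \<longlongrightarrow> f None) at_infinity"
    using f by (auto simp: cp1_continuous_def)
  have "isCont (\<lambda>(v, w). f (pt v w)) (v, w)" if ne: "(v, w) \<noteq> (0, 0)" for v w
  proof (cases "w = 0")
    case False
    have "open {p :: complex \<times> complex. snd p \<noteq> 0}"
      by (intro open_Collect_neq continuous_intros)
    moreover have "continuous_on {p :: complex \<times> complex. snd p \<noteq> 0} (\<lambda>p. f (Some (fst p / snd p)))"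
      by (intro continuous_on_compose2[OF fin] continuous_intros) auto
    then have "continuous_on {p. snd p \<noteq> 0} (\<lambda>(v, w). f (pt v w))"
      by (rule continuous_on_eq) (auto simp: pt_def)
    ultimately show ?thesis
      using False by (auto simp: continuous_on_eq_continuous_at)
  next
    case True
    then have v: "v \<noteq> 0" using ne by auto
    have "((\<lambda>(v, w). f (pt v w)) \<longlongrightarrow> f None) (at (v, w))"
    proof (rule tendstoI)
      fix e :: real assume "e > 0"
      then obtain R where R: "\<And>z. R \<le> norm z \<Longrightarrow> dist (f (Some z)) (f None) < e"
        using tendstoD[OF lim] by (auto simp: eventually_at_infinity)
      \<comment> \<open>The condition |y| R < |x| is open and holds at (v, 0). Under it either y =
        0, with value \<open>f None\<close>, or |x / y| \<ge> R, where f is already close to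
        \<open>f None\<close>.\<close>
      have "((\<lambda>p. norm (snd p) * R - norm (fst p)) \<longlongrightarrow> norm (snd (v, w)) * R - norm (fst (v, w))) (at (v, w))"
        by (intro tendsto_intros)
      then have "eventually (\<lambda>p. norm (snd p) * R - norm (fst p) < 0) (at (v, w))"
        using v True by (intro order_tendstoD(2)) auto
      then show "eventually (\<lambda>p. dist (case p of (v, w) \<Rightarrow> f (pt v w)) (f None) < e) (at (v, w))"
      proof eventually_elim
        case (elim p)
        obtain x y where p: "p = (x, y)" by (cases p)
        show ?case
        proof (cases "y = 0")
          case True then show ?thesis using \<open>e > 0\<close> by (simp add: p pt_def)
        next
          case False
          then have "R \<le> norm (x / y)" using elim by (simp add: p norm_divide field_simps)
          then show ?thesis using R[of "x / y"] False by (simp add: p pt_def)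
        qed
      qed
    qed
    then show ?thesis using True by (simp add: isCont_def pt_def)
  qed
  then show "continuous_on (- {(0, 0)}) (\<lambda>(v, w). f (pt v w))"
    by (intro continuous_at_imp_continuous_on) auto
next
  assume c: "continuous_on (- {(0, 0)}) (\<lambda>(v, w). f (pt v w))"
  have "continuous_on UNIV (\<lambda>z. (\<lambda>(v, w). f (pt v w)) (z, 1))"
    by (intro continuous_on_compose2[OF c] continuous_intros) auto
  then have fin: "continuous_on UNIV (\<lambda>z. f (Some z))" by simp
  \<comment> \<open>Infinity is approached in the other chart: z is the image of (1, 1/z), which
    tends to (1, 0).\<close>
  have "isCont (\<lambda>(v, w). f (pt v w)) (1, 0)"
    using c by (subst (asm) continuous_on_eq_continuous_at) (auto simp: open_Compl)
  moreover have "((\<lambda>z. (1, inverse z)) \<longlongrightarrow> (1, 0 :: complex)) at_infinity"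
    by (intro tendsto_intros tendsto_inverse_0)
  ultimately have "((\<lambda>z. (\<lambda>(v, w). f (pt v w)) (1, inverse z)) \<longlongrightarrow> (\<lambda>(v, w). f (pt v w)) (1, 0)) at_infinity"
    by (rule isCont_tendsto_compose)
  then have "((\<lambda>z. f (pt 1 (inverse z))) \<longlongrightarrow> f None) at_infinity"
    by (simp add: pt_def)
  moreover have "eventually (\<lambda>z. f (pt 1 (inverse z)) = f (Some z)) at_infinity"
    unfolding eventually_at_infinity
    by (rule exI[of _ 1]) (auto simp: pt_def divide_simps)
  ultimately have "((\<lambda>z. f (Some z)) \<longlongrightarrow> f None) at_infinity"
    by (blast intro: Lim_transform_eventually)
  with fin show "cp1_continuous f" by (simp add: cp1_continuous_def)
qed

lemma cp1_continuous_const [intro]: "cp1_continuous (\<lambda>_. c)"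
  and cp1_continuous_add [intro]: "cp1_continuous f \<Longrightarrow> cp1_continuous g \<Longrightarrow> cp1_continuous (\<lambda>p. f p + g p)"
  and cp1_continuous_diff [intro]: "cp1_continuous f \<Longrightarrow> cp1_continuous g \<Longrightarrow> cp1_continuous (\<lambda>p. f p - g p)"
  and cp1_continuous_mult [intro]: "cp1_continuous f \<Longrightarrow> cp1_continuous g \<Longrightarrow> cp1_continuous (\<lambda>p. f p * g p)"
  and cp1_continuous_cnj [intro]: "cp1_continuous f \<Longrightarrow> cp1_continuous (\<lambda>p. cnj (f p))"
  by (auto simp: cp1_continuous_def intro!: continuous_intros tendsto_intros)

lemma cp1_continuous_sum [intro]:
  "(\<And>i. i \<in> A \<Longrightarrow> cp1_continuous (f i)) \<Longrightarrow> cp1_continuous (\<lambda>p. \<Sum>i\<in>A. f i p)"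
  by (induction A rule: infinite_finite_induct) auto

text \<open>The value at infinity is the limit of the finite values, so identities between
  continuous functions are checked at \<open>Some z\<close> only.\<close>

lemma cp1_continuous_eqI:
  assumes "cp1_continuous f" "cp1_continuous g" "\<And>z. f (Some z) = g (Some z)"
  shows "f = g"
proof
  fix p
  have "f None = g None"
    using assms trivial_limit_at_infinity[where 'a=complex]
    by (auto simp: cp1_continuous_def trivial_limit_def intro!: tendsto_unique[of "at_infinity :: complex filter" "\<lambda>z. f (Some z)"])
  then show "f p = g p" using assms(3) by (cases p) auto
qed

lemma cp1_continuous_su2_act:
  assumes f: "cp1_continuous f" and ab: "(cmod a)\<^sup>2 + (cmod b)\<^sup>2 = 1"
  shows "cp1_continuous (su2_act a b f)"
proof -
  have ab': "(cmod (cnj a))\<^sup>2 + (cmod (- b))\<^sup>2 = 1" using ab by simp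
  have nz: "cnj a * v - b * w \<noteq> 0 \<or> cnj b * v + a * w \<noteq> 0" if "v \<noteq> 0 \<or> w \<noteq> 0" for v w
    using su2_nonzero[OF ab' that] by simp
  have "continuous_on (- {(0, 0)})
      (\<lambda>p. (\<lambda>(v, w). f (pt v w)) (cnj a * fst p - b * snd p, cnj b * fst p + a * snd p))"
    by (intro continuous_on_compose2[OF f[unfolded cp1_continuous_iff_homogeneous]] continuous_intros)
       (use nz in force)
  then show ?thesis
    unfolding cp1_continuous_iff_homogeneous
    by (rule continuous_on_eq) (clarsimp simp: su2_act_def, metis diff_conv_add_uminus minus_mult_left mobius_pt)
qed

lemma cp1_continuous_bounded:
  assumes "cp1_continuous f"
  obtains M where "M > 0" "\<And>z. cmod (f (Some z)) \<le> M"
proof -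
  have fin: "continuous_on UNIV (\<lambda>z. f (Some z))" and lim: "((\<lambda>z. f (Some z)) \<longlongrightarrow> f None) at_infinity"
    using assms by (auto simp: cp1_continuous_def)
  from tendstoD[OF lim, of 1] obtain R where R: "\<And>z. R \<le> norm z \<Longrightarrow> dist (f (Some z)) (f None) < 1"
    by (auto simp: eventually_at_infinity)
  have "compact ((\<lambda>z. f (Some z)) ` cball 0 R)"
    by (intro compact_continuous_image continuous_on_subset[OF fin]) auto
  then obtain M where M: "\<And>z. cmod z \<le> R \<Longrightarrow> cmod (f (Some z)) \<le> M"
    by (fastforce simp: bounded_iff dest!: compact_imp_bounded)
  have "cmod (f (Some z)) \<le> \<bar>M\<bar> + cmod (f None) + 1" for z
  proof (cases "cmod z \<le> R")
    case True then show ?thesis using M[of z] norm_ge_zero[of "f None"] by linarith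
  next
    case False
    then have "cmod (f (Some z) - f None) < 1" using R[of z] by (simp add: dist_norm)
    then show ?thesis using norm_triangle_sub[of "f (Some z)" "f None"] by linarith
  qed
  moreover have "\<bar>M\<bar> + cmod (f None) + 1 > 0"
    using norm_ge_zero[of "f None"] by linarith
  ultimately show ?thesis by (rule that[rotated])
qed

section \<open>Integrals of continuous functions and their invariance\<close>

lemma cp1_continuous_measurable:
  "cp1_continuous f \<Longrightarrow> (\<lambda>s. f (Some s)) \<in> borel_measurable borel"
  by (auto simp: cp1_continuous_def intro: borel_measurable_continuous_onI)

lemma integrable_cp1_continuous:
  assumes "cp1_continuous f"
  shows "integrable iota (\<lambda>s. f (Some s))"
proof -
  obtain M where "\<And>z. cmod (f (Some z)) \<le> M"
    using cp1_continuous_bounded[OF assms] by blast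
  then show ?thesis
    using cp1_continuous_measurable[OF assms]
    by (intro iota.integrable_const_bound[where B=M]) auto
qed

lemma AE_iota_not_singleton: "AE s in iota. s \<noteq> c"
  unfolding iota_def by (subst AE_density) (use AE_lborel_singleton[of c] in auto)

lemma integral_iota_mobius:
  assumes h: "cp1_continuous h" and ab: "(cmod a)\<^sup>2 + (cmod b)\<^sup>2 = 1"
  shows "(\<integral>s. h (mobius a b (- cnj b) (cnj a) (Some s)) \<partial>iota) = (\<integral>s. h (Some s) \<partial>iota)"
proof -
  let ?T = "\<lambda>s. (a * s + b) / (- cnj b * s + cnj a)"
  have T [measurable]: "?T \<in> borel_measurable borel" by measurable
  have distr: "distr iota borel ?T = iota"
  proof (rule measure_eqI)
    fix A assume "A \<in> sets (distr iota borel ?T)"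
    then have A [measurable]: "A \<in> sets borel" by simp
    have "emeasure (distr iota borel ?T) A = (\<integral>\<^sup>+s. indicator A s \<partial>distr iota borel ?T)"
      by simp
    also have "\<dots> = (\<integral>\<^sup>+s. indicator A (?T s) \<partial>iota)"
      by (rule nn_integral_distr) measurable
    also have "\<dots> = (\<integral>\<^sup>+s. indicator A s \<partial>iota)"
      by (rule nn_integral_iota_su2[OF _ ab]) measurable
    finally show "emeasure (distr iota borel ?T) A = emeasure iota A" by simp
  qed simp
  \<comment> \<open>At the pole \<open>mobius\<close> returns \<open>None\<close> whereas the
    quotient is 0; the pole is at most one point, hence null.\<close>
  have "AE s in iota. - cnj b * s + cnj a \<noteq> 0"
  proof (cases "b = 0")
    case True then show ?thesis using ab by auto
  next
    case False
    then show ?thesis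
      by (intro AE_mp[OF AE_iota_not_singleton[of "cnj a / cnj b"] AE_I2]) (auto simp: field_simps)
  qed
  then have ae: "AE s in iota. h (mobius a b (- cnj b) (cnj a) (Some s)) = h (Some (?T s))"
    by eventually_elim (simp add: mobius_def)
  have h' [measurable]: "(\<lambda>s. h (Some s)) \<in> borel_measurable borel"
    by (rule cp1_continuous_measurable[OF h])
  have "cp1_continuous (su2_act (cnj a) (- b) h)"
    by (rule cp1_continuous_su2_act[OF h]) (use ab in simp)
  then have [measurable]: "(\<lambda>s. h (mobius a b (- cnj b) (cnj a) (Some s))) \<in> borel_measurable borel"
    using cp1_continuous_measurable[of "su2_act (cnj a) (- b) h"] by (simp add: su2_act_def)
  have "(\<integral>s. h (mobius a b (- cnj b) (cnj a) (Some s)) \<partial>iota) = (\<integral>s. h (Some (?T s)) \<partial>iota)"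
    by (rule integral_cong_AE[OF _ _ ae]) measurable
  also have "\<dots> = (\<integral>s. h (Some s) \<partial>distr iota borel ?T)"
    by (rule integral_distr[symmetric]) measurable
  finally show ?thesis unfolding distr .
qed

text \<open>The restriction to the sphere of the bihomogeneous monomial of bidegree \<open>(\<tau>, \<tau>)\<close>.\<close>

definition sph :: "nat \<Rightarrow> nat \<Rightarrow> nat \<Rightarrow> complex option \<Rightarrow> complex" where
  "sph \<tau> i j p = hx p ^ i * hy p ^ (\<tau> - i) * cnj (hx p ^ j * hy p ^ (\<tau> - j)) /
     complex_of_real (((cmod (hx p))\<^sup>2 + (cmod (hy p))\<^sup>2) ^ \<tau>)"

text \<open>Numerator and denominator both scale by \<open>c ^ \<tau> * cnj (c ^ \<tau>)\<close>, so
  the representative of the point is immaterial.\<close>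

lemma sph_pt:
  assumes "i \<le> \<tau>" "j \<le> \<tau>" "v \<noteq> 0 \<or> w \<noteq> 0"
  shows "sph \<tau> i j (pt v w) = v ^ i * w ^ (\<tau> - i) * cnj (v ^ j * w ^ (\<tau> - j)) /
     complex_of_real (((cmod v)\<^sup>2 + (cmod w)\<^sup>2) ^ \<tau>)"
proof -
  obtain c where c: "c \<noteq> 0" "hx (pt v w) = c * v" "hy (pt v w) = c * w"
    using hxy_pt[OF assms(3)] by blast
  have "hx (pt v w) ^ i * hy (pt v w) ^ (\<tau> - i) = c ^ \<tau> * (v ^ i * w ^ (\<tau> - i))"
    using assms(1) by (simp add: c power_mult_distrib flip: power_add)
  moreover have "hx (pt v w) ^ j * hy (pt v w) ^ (\<tau> - j) = c ^ \<tau> * (v ^ j * w ^ (\<tau> - j))"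
    using assms(2) by (simp add: c power_mult_distrib flip: power_add)
  moreover have "complex_of_real (((cmod (hx (pt v w)))\<^sup>2 + (cmod (hy (pt v w)))\<^sup>2) ^ \<tau>)
      = c ^ \<tau> * cnj (c ^ \<tau>) * complex_of_real (((cmod v)\<^sup>2 + (cmod w)\<^sup>2) ^ \<tau>)"
  proof -
    have "((cmod (hx (pt v w)))\<^sup>2 + (cmod (hy (pt v w)))\<^sup>2) ^ \<tau>
       = ((cmod c)\<^sup>2 * ((cmod v)\<^sup>2 + (cmod w)\<^sup>2)) ^ \<tau>"
      by (simp add: c norm_mult power_mult_distrib algebra_simps)
    also have "\<dots> = ((cmod c)\<^sup>2) ^ \<tau> * ((cmod v)\<^sup>2 + (cmod w)\<^sup>2) ^ \<tau>"
      by (rule power_mult_distrib)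
    also have "((cmod c)\<^sup>2) ^ \<tau> = (cmod (c ^ \<tau>))\<^sup>2"
      by (simp add: norm_power power_mult[symmetric] mult.commute)
    finally show ?thesis
      by (simp only: of_real_mult complex_norm_square)
  qed
  ultimately show ?thesis using c(1) by (simp add: sph_def)
qed

lemma sph_Some: "sph \<tau> i j (Some z) = z ^ i * cnj z ^ j / complex_of_real ((1 + (cmod z)\<^sup>2) ^ \<tau>)"
  by (simp add: sph_def add.commute)

lemma cp1_continuous_sph [intro]:
  assumes "i \<le> \<tau>" "j \<le> \<tau>"
  shows "cp1_continuous (sph \<tau> i j)"
proof -
  have "complex_of_real (((cmod (fst p))\<^sup>2 + (cmod (snd p))\<^sup>2) ^ \<tau>) \<noteq> 0" if "p \<in> - {(0, 0)}" for p
  proof -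
    have "(cmod (fst p))\<^sup>2 + (cmod (snd p))\<^sup>2 > 0"
      using that by (intro sum_norm_squares_pos) (auto simp: prod_eq_iff)
    then show ?thesis by (metis of_real_eq_0_iff power_not_zero less_irrefl)
  qed
  then have "continuous_on (- {(0, 0)}) (\<lambda>(v, w). v ^ i * w ^ (\<tau> - i) * cnj (v ^ j * w ^ (\<tau> - j)) /
     complex_of_real (((cmod v)\<^sup>2 + (cmod w)\<^sup>2) ^ \<tau>))"
    unfolding case_prod_beta
    by (intro continuous_intros) blast
  then show ?thesis
    unfolding cp1_continuous_iff_homogeneous
  proof (rule continuous_on_eq)
    fix p :: "complex \<times> complex" assume "p \<in> - {(0, 0)}"
    then obtain v w where "p = (v, w)" "v \<noteq> 0 \<or> w \<noteq> 0" by (cases p) auto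
    then show "(case p of (v, w) \<Rightarrow> v ^ i * w ^ (\<tau> - i) * cnj (v ^ j * w ^ (\<tau> - j)) /
        complex_of_real (((cmod v)\<^sup>2 + (cmod w)\<^sup>2) ^ \<tau>)) = (case p of (v, w) \<Rightarrow> sph \<tau> i j (pt v w))"
      using sph_pt[OF assms] by simp
  qed
qed

lemma cnj_sph: "cnj (sph \<tau> i j p) = sph \<tau> j i p"
  by (simp add: sph_def mult_ac)

lemma sph_mult_Some: "sph \<tau> i j (Some z) * sph \<tau>' i' j' (Some z) = sph (\<tau> + \<tau>') (i + i') (j + j') (Some z)"
  by (simp add: sph_Some power_add)

subsection \<open>Moments\<close>

definition moment :: "nat \<Rightarrow> nat \<Rightarrow> nat \<Rightarrow> complex" where
  "moment \<tau> i j = (\<integral>s. sph \<tau> i j (Some s) \<partial>iota)"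

lemma integral_iota_sum2:
  assumes "\<And>i j. i \<in> A \<Longrightarrow> j \<in> B \<Longrightarrow> cp1_continuous (g i j)"
  shows "(\<integral>s. (\<Sum>i\<in>A. \<Sum>j\<in>B. c i j * g i j (Some s)) \<partial>iota)
       = (\<Sum>i\<in>A. \<Sum>j\<in>B. c i j * (\<integral>s. g i j (Some s) \<partial>iota))"
proof -
  have int: "integrable iota (\<lambda>s. c i j * g i j (Some s))" if "i \<in> A" "j \<in> B" for i j
    using assms[OF that] by (intro integrable_mult_right integrable_cp1_continuous)
  have "(\<integral>s. (\<Sum>i\<in>A. \<Sum>j\<in>B. c i j * g i j (Some s)) \<partial>iota)
      = (\<Sum>i\<in>A. \<integral>s. (\<Sum>j\<in>B. c i j * g i j (Some s)) \<partial>iota)"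
    by (intro Bochner_Integration.integral_sum Bochner_Integration.integrable_sum int)
  also have "\<dots> = (\<Sum>i\<in>A. \<Sum>j\<in>B. \<integral>s. c i j * g i j (Some s) \<partial>iota)"
    by (intro sum.cong refl Bochner_Integration.integral_sum int)
  finally show ?thesis by simp
qed

lemma sph_rotation:
  assumes "cmod c = 1" "i \<le> \<tau>" "j \<le> \<tau>"
  shows "sph \<tau> i j (mobius c 0 0 (cnj c) p) = (c ^ i * cnj c ^ (\<tau> - i) * cnj c ^ j * c ^ (\<tau> - j)) * sph \<tau> i j p"
proof -
  have "sph \<tau> i j (mobius c 0 0 (cnj c) (pt (hx p) (hy p))) = sph \<tau> i j (pt (c * hx p) (cnj c * hy p))"
    by (subst mobius_pt[OF hxy_nonzero]) simp
  also have "\<dots> = (c * hx p) ^ i * (cnj c * hy p) ^ (\<tau> - i) * cnj ((c * hx p) ^ j * (cnj c * hy p) ^ (\<tau> - j)) /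
     complex_of_real (((cmod (c * hx p))\<^sup>2 + (cmod (cnj c * hy p))\<^sup>2) ^ \<tau>)"
    using assms hxy_nonzero[of p] by (intro sph_pt) auto
  also have "\<dots> = (c ^ i * cnj c ^ (\<tau> - i) * cnj c ^ j * c ^ (\<tau> - j)) * sph \<tau> i j p"
    using assms(1) by (simp add: sph_def norm_mult power_mult_distrib)
  finally show ?thesis by simp
qed

lemma moment_off_diagonal:
  assumes "i \<le> \<tau>" "j \<le> \<tau>" "i \<noteq> j"
  shows "moment \<tau> i j = 0"
proof -
  \<comment> \<open>The rotation by c = cis t multiplies the monomial by cis (2 (i - j) t). This t
    makes the factor -1, so the moment equals its own negative.\<close>
  define t where "t = pi / (2 * (real i - real j))"
  define c where "c = cis t"
  have c: "cmod c = 1" by (simp add: c_def)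
  have "c ^ i * cnj c ^ (\<tau> - i) * cnj c ^ j * c ^ (\<tau> - j)
      = cis (real i * t + real (\<tau> - i) * (- t) + real j * (- t) + real (\<tau> - j) * t)"
    unfolding c_def cis_cnj Complex.DeMoivre cis_mult ..
  also have "real i * t + real (\<tau> - i) * (- t) + real j * (- t) + real (\<tau> - j) * t = 2 * (real i - real j) * t"
    using assms by (simp add: of_nat_diff algebra_simps)
  also have "\<dots> = pi" using assms by (simp add: t_def)
  also have "cis pi = -1" by simp
  finally have e: "c ^ i * cnj c ^ (\<tau> - i) * cnj c ^ j * c ^ (\<tau> - j) = -1" .
  have "moment \<tau> i j = (\<integral>s. sph \<tau> i j (mobius c 0 (- cnj 0) (cnj c) (Some s)) \<partial>iota)"
    unfolding moment_def using assms c by (intro integral_iota_mobius[symmetric]) auto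
  also have "\<dots> = - moment \<tau> i j"
    using c assms by (simp add: moment_def sph_rotation e)
  finally show ?thesis by simp
qed

text \<open>Invariance of the integral of \<open>|a z\<^sub>1 + b z\<^sub>2|\<close> to the power \<open>2 \<tau>\<close> determines all diagonal moments
  up to a common factor, which is fixed by the total mass.\<close>

lemma moment_proportional:
  assumes "i \<le> \<tau>"
  shows "of_nat (\<tau> choose i) * moment \<tau> i i = moment \<tau> \<tau> \<tau>"
proof -
  have eq: "(\<Sum>i\<le>\<tau>. of_nat (\<tau> choose i)^2 * moment \<tau> i i * complex_of_real x ^ i)
       = (\<Sum>i\<le>\<tau>. moment \<tau> \<tau> \<tau> * of_nat (\<tau> choose i) * complex_of_real x ^ i)" if x: "x > 0" for x
  proof -
    \<comment> \<open>The squares of a and b add up to 1 and have ratio x. After clearing (1 +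
      x)^\<tau>, invariance becomes a polynomial identity in x.\<close>
    define a where "a = sqrt (x / (1 + x))"
    define b where "b = sqrt (1 / (1 + x))"
    have a2: "a\<^sup>2 = x / (1 + x)" and b2: "b\<^sup>2 = 1 / (1 + x)"
      using x by (simp_all add: a_def b_def)
    have ab: "(cmod (complex_of_real a))\<^sup>2 + (cmod (complex_of_real b))\<^sup>2 = 1"
      using x by (simp add: a2 b2 add_divide_distrib[symmetric])
    let ?a = "complex_of_real a" and ?b = "complex_of_real b"
    have exp: "sph \<tau> \<tau> \<tau> (mobius ?a ?b (- cnj ?b) (cnj ?a) p)
      = (\<Sum>i\<le>\<tau>. \<Sum>j\<le>\<tau>. (of_nat (\<tau> choose i) * of_nat (\<tau> choose j) * ?a ^ i * ?b ^ (\<tau> - i) * ?a ^ j * ?b ^ (\<tau> - j)) * sph \<tau> i j p)" for p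
    proof -
      let ?v = "hx p" and ?w = "hy p"
      let ?N = "complex_of_real (((cmod ?v)\<^sup>2 + (cmod ?w)\<^sup>2) ^ \<tau>)"
      have "sph \<tau> \<tau> \<tau> (mobius ?a ?b (- cnj ?b) (cnj ?a) (pt ?v ?w))
         = (?a * ?v + ?b * ?w) ^ \<tau> * cnj ((?a * ?v + ?b * ?w) ^ \<tau>) /
           complex_of_real (((cmod (?a * ?v + ?b * ?w))\<^sup>2 + (cmod (- cnj ?b * ?v + cnj ?a * ?w))\<^sup>2) ^ \<tau>)"
        using su2_nonzero[OF ab hxy_nonzero] by (subst mobius_pt[OF hxy_nonzero], subst sph_pt) auto
      also have "\<dots> = (?a * ?v + ?b * ?w) ^ \<tau> * (?a * cnj ?v + ?b * cnj ?w) ^ \<tau> / ?N"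
        unfolding su2_norm[OF ab] by simp
      also have "\<dots> = (\<Sum>i\<le>\<tau>. \<Sum>j\<le>\<tau>. (of_nat (\<tau> choose i) * (?a * ?v) ^ i * (?b * ?w) ^ (\<tau> - i)) *
          (of_nat (\<tau> choose j) * (?a * cnj ?v) ^ j * (?b * cnj ?w) ^ (\<tau> - j)) / ?N)"
        unfolding binomial_ring by (simp add: sum_product sum_divide_distrib)
      also have "\<dots> = (\<Sum>i\<le>\<tau>. \<Sum>j\<le>\<tau>. (of_nat (\<tau> choose i) * of_nat (\<tau> choose j) * ?a ^ i * ?b ^ (\<tau> - i) * ?a ^ j * ?b ^ (\<tau> - j)) * sph \<tau> i j p)"
        by (intro sum.cong refl) (simp add: sph_def power_mult_distrib mult_ac)
      finally show ?thesis by simp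
    qed
    have "moment \<tau> \<tau> \<tau> = (\<integral>s. sph \<tau> \<tau> \<tau> (mobius ?a ?b (- cnj ?b) (cnj ?a) (Some s)) \<partial>iota)"
      unfolding moment_def by (rule integral_iota_mobius[symmetric, OF _ ab]) auto
    also have "\<dots> = (\<Sum>i\<le>\<tau>. \<Sum>j\<le>\<tau>. (of_nat (\<tau> choose i) * of_nat (\<tau> choose j) * ?a ^ i * ?b ^ (\<tau> - i) * ?a ^ j * ?b ^ (\<tau> - j)) * moment \<tau> i j)"
      unfolding exp moment_def
      by (rule integral_iota_sum2) auto
    also have "\<dots> = (\<Sum>i\<le>\<tau>. (of_nat (\<tau> choose i) * of_nat (\<tau> choose i) * ?a ^ i * ?b ^ (\<tau> - i) * ?a ^ i * ?b ^ (\<tau> - i)) * moment \<tau> i i)"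
    proof (intro sum.cong refl)
      fix i assume i: "i \<in> {..\<tau>}"
      show "(\<Sum>j\<le>\<tau>. (of_nat (\<tau> choose i) * of_nat (\<tau> choose j) * ?a ^ i * ?b ^ (\<tau> - i) * ?a ^ j * ?b ^ (\<tau> - j)) * moment \<tau> i j)
         = (of_nat (\<tau> choose i) * of_nat (\<tau> choose i) * ?a ^ i * ?b ^ (\<tau> - i) * ?a ^ i * ?b ^ (\<tau> - i)) * moment \<tau> i i"
        using i by (subst sum.remove[of _ i]) (auto simp: moment_off_diagonal intro!: sum.neutral)
    qed
    also have "\<dots> = (\<Sum>i\<le>\<tau>. of_nat (\<tau> choose i)^2 * moment \<tau> i i * complex_of_real (x ^ i / (1 + x) ^ \<tau>))"
    proof (intro sum.cong refl)
      fix i assume i: "i \<in> {..\<tau>}"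
      have "?a ^ i * ?b ^ (\<tau> - i) * ?a ^ i * ?b ^ (\<tau> - i) = complex_of_real ((a\<^sup>2) ^ i * (b\<^sup>2) ^ (\<tau> - i))"
        by (simp add: power2_eq_square power_mult_distrib)
      also have "(a\<^sup>2) ^ i * (b\<^sup>2) ^ (\<tau> - i) = x ^ i / ((1 + x) ^ i * (1 + x) ^ (\<tau> - i))"
        by (simp add: a2 b2 power_divide)
      also have "(1 + x) ^ i * (1 + x) ^ (\<tau> - i) = (1 + x) ^ \<tau>"
        using i by (simp flip: power_add)
      finally have E: "?a ^ i * ?b ^ (\<tau> - i) * ?a ^ i * ?b ^ (\<tau> - i) = complex_of_real (x ^ i / (1 + x) ^ \<tau>)" .
      show "(of_nat (\<tau> choose i) * of_nat (\<tau> choose i) * ?a ^ i * ?b ^ (\<tau> - i) * ?a ^ i * ?b ^ (\<tau> - i)) * moment \<tau> i i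
          = of_nat (\<tau> choose i)^2 * moment \<tau> i i * complex_of_real (x ^ i / (1 + x) ^ \<tau>)"
        unfolding E[symmetric] by (simp add: power2_eq_square)
    qed
    also have "\<dots> = (\<Sum>i\<le>\<tau>. of_nat (\<tau> choose i)^2 * moment \<tau> i i * complex_of_real x ^ i) / complex_of_real ((1 + x) ^ \<tau>)"
      by (simp add: sum_divide_distrib)
    finally have "(\<Sum>i\<le>\<tau>. of_nat (\<tau> choose i)^2 * moment \<tau> i i * complex_of_real x ^ i)
       = moment \<tau> \<tau> \<tau> * complex_of_real ((1 + x) ^ \<tau>)"
      using x by (simp add: field_simps del: of_real_power of_real_add)
    also have "complex_of_real ((1 + x) ^ \<tau>) = (\<Sum>i\<le>\<tau>. of_nat (\<tau> choose i) * complex_of_real x ^ i)"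
      using binomial_ring[of "complex_of_real x" 1 \<tau>] by (simp add: add.commute)
    finally show ?thesis by (simp add: sum_distrib_left mult.assoc)
  qed
  \<comment> \<open>The coefficients of the difference of the two polynomials; infinitely many
    positive zeros force all of them to vanish.\<close>
  define cf where "cf i = of_nat (\<tau> choose i)^2 * moment \<tau> i i - moment \<tau> \<tau> \<tau> * of_nat (\<tau> choose i)" for i
  have "complex_of_real ` {0<..} \<subseteq> {z. (\<Sum>i\<le>\<tau>. cf i * z ^ i) = 0}"
    using eq by (auto simp: cf_def left_diff_distrib sum_subtractf)
  moreover have "infinite (complex_of_real ` {0<..})"
    by (subst finite_image_iff) (auto simp: inj_on_def infinite_Ioi)
  ultimately have "infinite {z. (\<Sum>i\<le>\<tau>. cf i * z ^ i) = 0}"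
    using finite_subset by blast
  then have "cf i = 0"
    using assms polyfun_finite_roots[of cf \<tau>] by blast
  then have "of_nat (\<tau> choose i) * (of_nat (\<tau> choose i) * moment \<tau> i i - moment \<tau> \<tau> \<tau>) = 0"
    by (simp add: cf_def algebra_simps power2_eq_square)
  then show ?thesis using assms by simp
qed

text \<open>The binomially weighted diagonal monomials sum to (|s|^2 + 1)^\<tau> / (1 +
  |s|^2)^\<tau> = 1. Integrated, the \<tau> + 1 summands are equal by
  \<open>moment_proportional\<close> and add up to the total mass 1.\<close>

lemma moment_diagonal:
  assumes "i \<le> \<tau>"
  shows "moment \<tau> i i = 1 / (of_nat (\<tau> + 1) * of_nat (\<tau> choose i))"
proof -
  have one: "(\<Sum>i\<le>\<tau>. of_nat (\<tau> choose i) * sph \<tau> i i (Some s)) = 1" for s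
  proof -
    have "(\<Sum>i\<le>\<tau>. of_nat (\<tau> choose i) * sph \<tau> i i (Some s))
       = (\<Sum>i\<le>\<tau>. of_nat (\<tau> choose i) * (s * cnj s) ^ i * 1 ^ (\<tau> - i)) / complex_of_real ((1 + (cmod s)\<^sup>2) ^ \<tau>)"
      by (simp add: sph_Some sum_divide_distrib power_mult_distrib mult.assoc)
    also have "\<dots> = (s * cnj s + 1) ^ \<tau> / complex_of_real ((1 + (cmod s)\<^sup>2) ^ \<tau>)"
      by (simp only: binomial_ring)
    also have "s * cnj s + 1 = complex_of_real (1 + (cmod s)\<^sup>2)"
      by (simp only: of_real_add complex_norm_square) simp
    also have "complex_of_real (1 + (cmod s)\<^sup>2) ^ \<tau> / complex_of_real ((1 + (cmod s)\<^sup>2) ^ \<tau>) = 1"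
      using sum_norm_squares_pos[of 1 s]
      by (metis norm_one one_neq_zero of_real_eq_0_iff of_real_power power_not_zero less_irrefl power_one divide_self)
    finally show ?thesis .
  qed
  have "(\<Sum>i\<le>\<tau>. of_nat (\<tau> choose i) * moment \<tau> i i) = (\<integral>s. (\<Sum>i\<le>\<tau>. of_nat (\<tau> choose i) * sph \<tau> i i (Some s)) \<partial>iota)"
    unfolding moment_def
    by (subst Bochner_Integration.integral_sum) (auto intro!: integrable_mult_right integrable_cp1_continuous)
  also have "\<dots> = 1"
    unfolding one by (simp add: measure_def emeasure_iota_UNIV)
  finally have "(\<Sum>i\<le>\<tau>. of_nat (\<tau> choose i) * moment \<tau> i i) = 1" .
  moreover have "(\<Sum>i\<le>\<tau>. of_nat (\<tau> choose i) * moment \<tau> i i) = of_nat (\<tau> + 1) * moment \<tau> \<tau> \<tau>"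
    by (simp add: moment_proportional)
  ultimately have "of_nat (\<tau> + 1) * (of_nat (\<tau> choose i) * moment \<tau> i i) = 1"
    using assms by (simp add: moment_proportional)
  moreover have "of_nat (\<tau> + 1) * of_nat (\<tau> choose i) \<noteq> (0 :: complex)"
    using assms by (simp del: of_nat_add of_nat_Suc)
  ultimately show ?thesis
    by (simp add: eq_divide_eq mult_ac)
qed

subsection \<open>The Berezin transform on the sphere\<close>

text \<open>The power \<tau> of |<p, q>|^2 / (|p|^2 |q|^2), the transition probability between two
  lines in C^2; unitary invariance is visible in this form.\<close>

definition bker :: "nat \<Rightarrow> complex option \<Rightarrow> complex option \<Rightarrow> complex" where
  "bker \<tau> p q = complex_of_real (cmod (hx p * cnj (hx q) + hy p * cnj (hy q)) ^ (2 * \<tau>) /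
     (((cmod (hx p))\<^sup>2 + (cmod (hy p))\<^sup>2) ^ \<tau> * ((cmod (hx q))\<^sup>2 + (cmod (hy q))\<^sup>2) ^ \<tau>))"

text \<open>The Berezin transform, extended to the point at infinity.\<close>

definition Bz :: "nat \<Rightarrow> (complex option \<Rightarrow> complex) \<Rightarrow> complex option \<Rightarrow> complex" where
  "Bz \<tau> f p = (\<integral>s. bker \<tau> p (Some s) * f (Some s) \<partial>iota)"

lemma berezin_eq_Bz: "berezin \<tau> f z = Bz \<tau> f (Some z)"
  by (simp add: berezin_def Bz_def bker_def add.commute)

lemma bker_pt:
  assumes "v \<noteq> 0 \<or> w \<noteq> 0" "v' \<noteq> 0 \<or> w' \<noteq> 0"
  shows "bker \<tau> (pt v w) (pt v' w') = complex_of_real (cmod (v * cnj v' + w * cnj w') ^ (2 * \<tau>) /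
     (((cmod v)\<^sup>2 + (cmod w)\<^sup>2) ^ \<tau> * ((cmod v')\<^sup>2 + (cmod w')\<^sup>2) ^ \<tau>))"
proof -
  obtain c where c: "c \<noteq> 0" "hx (pt v w) = c * v" "hy (pt v w) = c * w"
    using hxy_pt[OF assms(1)] by blast
  obtain d where d: "d \<noteq> 0" "hx (pt v' w') = d * v'" "hy (pt v' w') = d * w'"
    using hxy_pt[OF assms(2)] by blast
  have 1: "cmod (c * v * cnj (d * v') + c * w * cnj (d * w')) ^ (2 * \<tau>)
     = (((cmod c)\<^sup>2) ^ \<tau> * ((cmod d)\<^sup>2) ^ \<tau>) * cmod (v * cnj v' + w * cnj w') ^ (2 * \<tau>)"
  proof -
    have "c * v * cnj (d * v') + c * w * cnj (d * w') = c * cnj d * (v * cnj v' + w * cnj w')"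
      by (simp add: algebra_simps)
    then show ?thesis by (simp add: norm_mult power_mult_distrib power_mult)
  qed
  have 2: "((cmod (e * x))\<^sup>2 + (cmod (e * y))\<^sup>2) ^ \<tau> = ((cmod e)\<^sup>2) ^ \<tau> * ((cmod x)\<^sup>2 + (cmod y)\<^sup>2) ^ \<tau>" for e x y
    by (simp add: norm_mult power_mult_distrib flip: distrib_left)
  show ?thesis
    unfolding bker_def c d 1 2 using c(1) d(1) by simp
qed

lemma bker_mobius:
  assumes ab: "(cmod a)\<^sup>2 + (cmod b)\<^sup>2 = 1"
  shows "bker \<tau> (mobius a b (- cnj b) (cnj a) p) (mobius a b (- cnj b) (cnj a) q) = bker \<tau> p q"
proof -
  let ?g = "mobius a b (- cnj b) (cnj a)"
  have inner: "(a * x + b * y) * cnj (a * x' + b * y') + (- cnj b * x + cnj a * y) * cnj (- cnj b * x' + cnj a * y')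
      = x * cnj x' + y * cnj y'" for x y x' y'
  proof -
    have "(a * x + b * y) * cnj (a * x' + b * y') + (- cnj b * x + cnj a * y) * cnj (- cnj b * x' + cnj a * y')
      = (a * cnj a + b * cnj b) * (x * cnj x' + y * cnj y')"
      by (simp add: algebra_simps)
    also have "a * cnj a + b * cnj b = complex_of_real ((cmod a)\<^sup>2 + (cmod b)\<^sup>2)"
      by (simp only: of_real_add complex_norm_square)
    finally show ?thesis by (simp add: ab)
  qed
  have "bker \<tau> (?g (pt (hx p) (hy p))) (?g (pt (hx q) (hy q))) = bker \<tau> p q"
    unfolding mobius_pt[OF hxy_nonzero]
    by (subst bker_pt) (use su2_nonzero[OF ab hxy_nonzero] in \<open>auto simp only: inner su2_norm[OF ab] bker_def\<close>)
  then show ?thesis by simp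
qed

text \<open>Expanding the Hermitian product and its conjugate binomially separates the two points.
  The kernel therefore has finite rank, and its second factor is the conjugate of
  \<open>sph \<tau> i j q\<close>, which makes the transform positive.\<close>

lemma bker_expand:
  "bker \<tau> p q = (\<Sum>i\<le>\<tau>. \<Sum>j\<le>\<tau>. of_nat (\<tau> choose i) * of_nat (\<tau> choose j) * (sph \<tau> i j p * sph \<tau> j i q))"
proof -
  let ?A = "hx p * cnj (hx q) + hy p * cnj (hy q)"
  let ?N = "complex_of_real (((cmod (hx p))\<^sup>2 + (cmod (hy p))\<^sup>2) ^ \<tau>)"
  let ?M = "complex_of_real (((cmod (hx q))\<^sup>2 + (cmod (hy q))\<^sup>2) ^ \<tau>)"
  have A: "complex_of_real (cmod ?A ^ (2 * \<tau>)) = ?A ^ \<tau> * cnj ?A ^ \<tau>"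
    unfolding power_mult of_real_power[of "(cmod ?A)\<^sup>2"] complex_norm_square power_mult_distrib ..
  have "bker \<tau> p q = (hx p * cnj (hx q) + hy p * cnj (hy q)) ^ \<tau> * (cnj (hx p) * hx q + cnj (hy p) * hy q) ^ \<tau> / (?N * ?M)"
    unfolding bker_def of_real_divide A of_real_mult by simp
  also have "\<dots> = (\<Sum>i\<le>\<tau>. \<Sum>j\<le>\<tau>. of_nat (\<tau> choose i) * (hx p * cnj (hx q)) ^ i * (hy p * cnj (hy q)) ^ (\<tau> - i) *
      (of_nat (\<tau> choose j) * (cnj (hx p) * hx q) ^ j * (cnj (hy p) * hy q) ^ (\<tau> - j)) / (?N * ?M))"
    unfolding binomial_ring by (simp add: sum_product sum_divide_distrib)
  also have "\<dots> = (\<Sum>i\<le>\<tau>. \<Sum>j\<le>\<tau>. of_nat (\<tau> choose i) * of_nat (\<tau> choose j) * (sph \<tau> i j p * sph \<tau> j i q))"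
    by (intro sum.cong refl) (simp add: sph_def power_mult_distrib mult_ac)
  finally show ?thesis .
qed

lemma cp1_continuous_bker: "cp1_continuous (\<lambda>q. bker \<tau> p q)"
  unfolding bker_expand by (intro cp1_continuous_sum cp1_continuous_mult cp1_continuous_const cp1_continuous_sph) auto

lemma Bz_expand:
  assumes "cp1_continuous f"
  shows "Bz \<tau> f p = (\<Sum>i\<le>\<tau>. \<Sum>j\<le>\<tau>.
    of_nat (\<tau> choose i) * of_nat (\<tau> choose j) * (\<integral>s. sph \<tau> j i (Some s) * f (Some s) \<partial>iota) * sph \<tau> i j p)"
proof -
  have "Bz \<tau> f p = (\<integral>s. (\<Sum>i\<le>\<tau>. \<Sum>j\<le>\<tau>. (of_nat (\<tau> choose i) * of_nat (\<tau> choose j) * sph \<tau> i j p) *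
      (sph \<tau> j i (Some s) * f (Some s))) \<partial>iota)"
    unfolding Bz_def bker_expand by (simp add: sum_distrib_right mult.assoc)
  also have "\<dots> = (\<Sum>i\<le>\<tau>. \<Sum>j\<le>\<tau>. (of_nat (\<tau> choose i) * of_nat (\<tau> choose j) * sph \<tau> i j p) *
      (\<integral>s. sph \<tau> j i (Some s) * f (Some s) \<partial>iota))"
    by (rule integral_iota_sum2[where g="\<lambda>i j p. sph \<tau> j i p * f p"]) (use assms in auto)
  finally show ?thesis by (simp add: mult_ac)
qed

lemma cp1_continuous_Bz:
  assumes "cp1_continuous f"
  shows "cp1_continuous (Bz \<tau> f)"
  unfolding Bz_expand[OF assms, abs_def]
  by (intro cp1_continuous_sum cp1_continuous_mult cp1_continuous_const cp1_continuous_sph) auto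

text \<open>Moving the integration variable by the group element changes neither the measure nor the
  kernel, provided both points of the kernel are moved together.\<close>

lemma Bz_su2_act:
  assumes f: "cp1_continuous f" and ab: "(cmod a)\<^sup>2 + (cmod b)\<^sup>2 = 1"
  shows "Bz \<tau> (su2_act a b f) = su2_act a b (Bz \<tau> f)"
proof
  fix p
  let ?g = "mobius (cnj a) (- b) (- cnj (- b)) (cnj (cnj a))"
  have ab': "(cmod (cnj a))\<^sup>2 + (cmod (- b))\<^sup>2 = 1" using ab by simp
  have "su2_act a b (Bz \<tau> f) p = (\<integral>s. bker \<tau> (?g p) (Some s) * f (Some s) \<partial>iota)"
    by (simp add: su2_act_def Bz_def)
  also have "\<dots> = (\<integral>s. bker \<tau> (?g p) (?g (Some s)) * f (?g (Some s)) \<partial>iota)"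
    by (rule integral_iota_mobius[symmetric, OF _ ab']) (intro cp1_continuous_mult cp1_continuous_bker f)
  also have "\<dots> = Bz \<tau> (su2_act a b f) p"
    unfolding bker_mobius[OF ab'] by (simp add: Bz_def su2_act_def)
  finally show "Bz \<tau> (su2_act a b f) p = su2_act a b (Bz \<tau> f) p" ..
qed

section \<open>Functions on the sphere as a vector space, and linearity of the transform\<close>

interpretation fs: vector_space fscale
  by unfold_locales (auto simp: fscale_def fun_eq_iff algebra_simps)

lemma sum_fun_apply [simp]: "(\<Sum>x\<in>A. f x) p = (\<Sum>x\<in>A. f x p)"
  for f :: "'a \<Rightarrow> 'b \<Rightarrow> complex"
  by (induction A rule: infinite_finite_induct) auto

lemma fscale_apply [simp]: "fscale c f p = c * f p"
  by (simp add: fscale_def)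

lemma cp1_continuous_add' [intro]: "cp1_continuous f \<Longrightarrow> cp1_continuous g \<Longrightarrow> cp1_continuous (f + g)"
  by (simp add: plus_fun_def cp1_continuous_add)

lemma cp1_continuous_fscale [intro]: "cp1_continuous f \<Longrightarrow> cp1_continuous (fscale c f)"
  by (auto simp: fscale_def)

lemma cp1_continuous_zero [simp]: "cp1_continuous 0"
  by (simp add: zero_fun_def cp1_continuous_const)

lemma subspace_cp1_continuous: "fs.subspace {f. cp1_continuous f}"
  by (rule fs.subspaceI) auto

lemma Bz_add:
  assumes "cp1_continuous f" "cp1_continuous g"
  shows "Bz \<tau> (f + g) = Bz \<tau> f + Bz \<tau> g"
proof
  fix p
  have int: "integrable iota (\<lambda>s. bker \<tau> p (Some s) * h (Some s))" if "cp1_continuous h" for h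
    using that by (intro integrable_cp1_continuous[where f="\<lambda>q. bker \<tau> p q * h q"] cp1_continuous_mult cp1_continuous_bker)
  show "Bz \<tau> (f + g) p = (Bz \<tau> f + Bz \<tau> g) p"
    using int[OF assms(1)] int[OF assms(2)] by (simp add: Bz_def distrib_left)
qed

lemma Bz_fscale: "Bz \<tau> (fscale c f) = fscale c (Bz \<tau> f)"
  by (rule ext) (simp add: Bz_def mult.left_commute)

lemma Bz_zero [simp]: "Bz \<tau> 0 = 0"
  by (rule ext) (simp add: Bz_def)

definition sphs :: "nat \<Rightarrow> (complex option \<Rightarrow> complex) set" where
  "sphs \<tau> = (\<lambda>(i, j). sph \<tau> i j) ` ({..\<tau>} \<times> {..\<tau>})"

lemma finite_sphs [simp]: "finite (sphs \<tau>)"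
  by (simp add: sphs_def)

lemma sph_in_sphs: "i \<le> \<tau> \<Longrightarrow> j \<le> \<tau> \<Longrightarrow> sph \<tau> i j \<in> sphs \<tau>"
  by (force simp: sphs_def)

lemma Bz_in_span:
  assumes "cp1_continuous f"
  shows "Bz \<tau> f \<in> fs.span (sphs \<tau>)"
proof -
  have "Bz \<tau> f = (\<Sum>i\<le>\<tau>. \<Sum>j\<le>\<tau>. fscale (of_nat (\<tau> choose i) * of_nat (\<tau> choose j) *
      (\<integral>s. sph \<tau> j i (Some s) * f (Some s) \<partial>iota)) (sph \<tau> i j))"
    by (rule ext) (simp add: Bz_expand[OF assms])
  also have "\<dots> \<in> fs.span (sphs \<tau>)"
    by (intro fs.span_sum fs.span_scale fs.span_base sph_in_sphs) auto
  finally show ?thesis .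
qed

section \<open>The eigenvalue on a highest weight vector\<close>

text \<open>The case split cannot be dropped: for \<tau> < m truncated subtraction would give
  \<open>fact (\<tau> - m) = 1\<close> and a nonzero value.\<close>

definition lam :: "nat \<Rightarrow> nat \<Rightarrow> real" where
  "lam \<tau> m = (if m \<le> \<tau> then (fact \<tau>)\<^sup>2 / (fact (\<tau> - m) * fact (\<tau> + m + 1)) else 0)"

lemma lam_eq_0_iff: "lam \<tau> m = 0 \<longleftrightarrow> \<tau> < m"
  by (simp add: lam_def)

text \<open>The left side is the coefficient of \<open>sph \<tau> (j + m) j\<close> in the transform
  of \<open>hw m\<close>: two binomials from the kernel times a diagonal moment of degree \<tau> +
  m. Its dependence on j is exactly the binomial of \<open>hw_expand\<close>.\<close>

lemma lam_coefficient:
  assumes "j + m \<le> \<tau>"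
  shows "real (\<tau> choose (j + m)) * real (\<tau> choose j) / (real (\<tau> + m + 1) * real ((\<tau> + m) choose (j + m)))
       = lam \<tau> m * real ((\<tau> - m) choose j)"
proof -
  have e: "\<tau> + m - (j + m) = \<tau> - j" "\<tau> - m - j = \<tau> - (j + m)" using assms by auto
  have f: "(fact (\<tau> + m + 1) :: real) = real (\<tau> + m + 1) * fact (\<tau> + m)" by simp
  have 1: "real (\<tau> choose (j + m)) = fact \<tau> / (fact (j + m) * fact (\<tau> - (j + m)))"
    and 2: "real (\<tau> choose j) = fact \<tau> / (fact j * fact (\<tau> - j))"
    and 3: "real ((\<tau> + m) choose (j + m)) = fact (\<tau> + m) / (fact (j + m) * fact (\<tau> - j))"
    and 4: "real ((\<tau> - m) choose j) = fact (\<tau> - m) / (fact j * fact (\<tau> - (j + m)))"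
    using assms by (simp_all add: binomial_fact e add.commute)
  have 5: "lam \<tau> m = (fact \<tau>)\<^sup>2 / (fact (\<tau> - m) * (real (\<tau> + m + 1) * fact (\<tau> + m)))"
    using assms by (simp only: lam_def f) simp
  have gen: "a / (b * c) * (a / (d * e)) / (x * (f / (b * e))) = a\<^sup>2 / (g * (x * f)) * (g / (d * c))"
    if "b \<noteq> 0" "e \<noteq> 0" "g \<noteq> 0" for a b c d e f g x :: real
    using that by (simp add: power2_eq_square)
  show ?thesis
    unfolding 1 2 3 4 5 by (rule gen) simp_all
qed

text \<open>In the coordinates of the round sphere this is a multiple of the \<open>m\<close>-th power of \<open>x + i y\<close>, the highest weight vector.\<close>

definition hw :: "nat \<Rightarrow> complex option \<Rightarrow> complex" where
  "hw m = sph m m 0"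

lemma cp1_continuous_hw [simp, intro]: "cp1_continuous (hw m)"
  by (auto simp: hw_def)

lemma one_plus_norm_square_pos: "1 + (cmod z)\<^sup>2 > 0"
  by (simp add: add_pos_nonneg)

text \<open>Numerator and denominator of \<open>hw m\<close> are multiplied by (1 + |z|^2)^(\<tau> -
  m), expanded binomially in the numerator. This rewrites a vector of degree m in degree
  \<tau>.\<close>

lemma hw_expand:
  assumes "m \<le> \<tau>"
  shows "(\<Sum>j\<le>\<tau> - m. of_nat ((\<tau> - m) choose j) * sph \<tau> (j + m) j (Some z)) = hw m (Some z)"
proof -
  have nz: "complex_of_real (1 + (cmod z)\<^sup>2) \<noteq> 0"
    using one_plus_norm_square_pos[of z] by (metis of_real_eq_0_iff less_irrefl)
  have "(\<Sum>j\<le>\<tau> - m. of_nat ((\<tau> - m) choose j) * sph \<tau> (j + m) j (Some z))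
      = z ^ m * (\<Sum>j\<le>\<tau> - m. of_nat ((\<tau> - m) choose j) * (z * cnj z) ^ j * 1 ^ (\<tau> - m - j)) / complex_of_real (1 + (cmod z)\<^sup>2) ^ \<tau>"
    unfolding sum_distrib_left sum_divide_distrib
    by (intro sum.cong refl) (simp add: sph_Some power_add power_mult_distrib mult_ac)
  also have "(\<Sum>j\<le>\<tau> - m. of_nat ((\<tau> - m) choose j) * (z * cnj z) ^ j * 1 ^ (\<tau> - m - j)) = (z * cnj z + 1) ^ (\<tau> - m)"
    by (simp only: binomial_ring)
  also have "z * cnj z + 1 = complex_of_real (1 + (cmod z)\<^sup>2)"
    by (simp only: of_real_add complex_norm_square) simp
  also have "complex_of_real (1 + (cmod z)\<^sup>2) ^ \<tau> = complex_of_real (1 + (cmod z)\<^sup>2) ^ (\<tau> - m) * complex_of_real (1 + (cmod z)\<^sup>2) ^ m"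
    using assms by (simp flip: power_add)
  finally show ?thesis using nz by (simp add: hw_def sph_Some del: of_real_add)
qed

lemma Bz_hw: "Bz \<tau> (hw m) = fscale (complex_of_real (lam \<tau> m)) (hw m)"
proof (rule cp1_continuous_eqI)
  fix z
  \<comment> \<open>The product is a single monomial of degree \<tau> + m with exponents (j + m, i),
    so off-diagonal vanishing leaves only i = j + m.\<close>
  have "(\<integral>s. sph \<tau> j i (Some s) * hw m (Some s) \<partial>iota) = (if i = j + m then 1 / (of_nat (\<tau> + m + 1) * of_nat ((\<tau> + m) choose (j + m))) else 0)"
    if "i \<le> \<tau>" "j \<le> \<tau>" for i j
  proof -
    have "(\<integral>s. sph \<tau> j i (Some s) * hw m (Some s) \<partial>iota) = moment (\<tau> + m) (j + m) i"
      unfolding hw_def sph_mult_Some moment_def by simp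
    then show ?thesis
      using that moment_off_diagonal[of "j + m" "\<tau> + m" i] moment_diagonal[of "j + m" "\<tau> + m"] by simp
  qed
  then have "Bz \<tau> (hw m) (Some z) = (\<Sum>i\<le>\<tau>. \<Sum>j\<le>\<tau>. of_nat (\<tau> choose i) * of_nat (\<tau> choose j) *
     (if i = j + m then 1 / (of_nat (\<tau> + m + 1) * of_nat ((\<tau> + m) choose (j + m))) else 0) * sph \<tau> i j (Some z))"
    by (simp add: Bz_expand)
  also have "\<dots> = (\<Sum>j\<le>\<tau>. \<Sum>i\<le>\<tau>. (if i = j + m then of_nat (\<tau> choose i) * of_nat (\<tau> choose j) *
     (1 / (of_nat (\<tau> + m + 1) * of_nat ((\<tau> + m) choose (j + m)))) * sph \<tau> i j (Some z) else 0))"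
    by (subst sum.swap) (intro sum.cong refl, simp)
  also have "\<dots> = (\<Sum>j\<le>\<tau>. if j + m \<le> \<tau> then complex_of_real (real (\<tau> choose (j + m)) * real (\<tau> choose j) /
       (real (\<tau> + m + 1) * real ((\<tau> + m) choose (j + m)))) * sph \<tau> (j + m) j (Some z) else 0)"
    by (intro sum.cong refl, subst sum.delta) auto
  also have "\<dots> = (\<Sum>j\<le>\<tau>. if j + m \<le> \<tau> then complex_of_real (lam \<tau> m * real ((\<tau> - m) choose j)) * sph \<tau> (j + m) j (Some z) else 0)"
    by (intro sum.cong refl if_cong) (simp only: lam_coefficient)
  also have "\<dots> = fscale (complex_of_real (lam \<tau> m)) (hw m) (Some z)"
  proof (cases "m \<le> \<tau>")
    case False
    then have "lam \<tau> m = 0" by (simp add: lam_def)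
    then show ?thesis by (simp cong: if_cong)
  next
    case True
    have "(\<Sum>j\<le>\<tau>. if j + m \<le> \<tau> then complex_of_real (lam \<tau> m * real ((\<tau> - m) choose j)) * sph \<tau> (j + m) j (Some z) else 0)
        = (\<Sum>j\<le>\<tau> - m. complex_of_real (lam \<tau> m * real ((\<tau> - m) choose j)) * sph \<tau> (j + m) j (Some z))"
      using True by (intro sum.mono_neutral_cong_right) auto
    also have "\<dots> = complex_of_real (lam \<tau> m) * (\<Sum>j\<le>\<tau> - m. of_nat ((\<tau> - m) choose j) * sph \<tau> (j + m) j (Some z))"
      by (simp add: sum_distrib_left mult.assoc)
    finally show ?thesis by (simp only: hw_expand[OF True] fscale_apply)
  qed
  finally show "Bz \<tau> (hw m) (Some z) = fscale (complex_of_real (lam \<tau> m)) (hw m) (Some z)" .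
qed (auto intro: cp1_continuous_Bz)

subsection \<open>Approximation of the identity\<close>

lemma integral_radial_moment:
  assumes "i \<le> \<tau>"
  shows "(\<integral>s. (cmod s)\<^sup>2 ^ i / (1 + (cmod s)\<^sup>2) ^ \<tau> \<partial>iota) = 1 / (real (\<tau> + 1) * real (\<tau> choose i))"
    and "integrable iota (\<lambda>s. (cmod s)\<^sup>2 ^ i / (1 + (cmod s)\<^sup>2) ^ \<tau>)"
proof -
  have eq: "sph \<tau> i i (Some s) = complex_of_real ((cmod s)\<^sup>2 ^ i / (1 + (cmod s)\<^sup>2) ^ \<tau>)" for s
  proof -
    have "s ^ i * cnj s ^ i = complex_of_real ((cmod s)\<^sup>2) ^ i"
      unfolding complex_norm_square by (simp add: power_mult_distrib)
    then show ?thesis by (simp add: sph_Some)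
  qed
  have int: "integrable iota (\<lambda>s. sph \<tau> i i (Some s))"
    using assms by (intro integrable_cp1_continuous) auto
  show "integrable iota (\<lambda>s. (cmod s)\<^sup>2 ^ i / (1 + (cmod s)\<^sup>2) ^ \<tau>)"
    using int unfolding eq complex_of_real_integrable_eq .
  have "complex_of_real (\<integral>s. (cmod s)\<^sup>2 ^ i / (1 + (cmod s)\<^sup>2) ^ \<tau> \<partial>iota) = moment \<tau> i i"
    unfolding moment_def eq integral_complex_of_real ..
  also have "\<dots> = complex_of_real (1 / (real (\<tau> + 1) * real (\<tau> choose i)))"
    using assms by (simp add: moment_diagonal)
  finally show "(\<integral>s. (cmod s)\<^sup>2 ^ i / (1 + (cmod s)\<^sup>2) ^ \<tau> \<partial>iota) = 1 / (real (\<tau> + 1) * real (\<tau> choose i))"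
    unfolding of_real_eq_iff .
qed

text \<open>At 0 the kernel is 1 / (1 + |s|^2)^\<tau>, of integral 1 / (\<tau> + 1). The oscillation
  of h is dominated by e + C |s|^2 / (1 + |s|^2), whose second term only shifts the moment to degree
  \<tau> + 1; the error is thus at most e + C / (\<tau> + 2).\<close>

lemma Bz_approx_identity_0:
  assumes h: "cp1_continuous h"
  shows "(\<lambda>\<tau>. of_nat (\<tau> + 1) * Bz \<tau> h (Some 0)) \<longlonglongrightarrow> h (Some 0)"
proof -
  obtain M where M: "M > 0" "\<And>z. cmod (h (Some z)) \<le> M"
    using cp1_continuous_bounded[OF h] by blast
  let ?d = "\<lambda>s. h (Some s) - h (Some 0)"
  have bound: "\<exists>C. \<forall>\<tau>. cmod (of_nat (\<tau> + 1) * Bz \<tau> h (Some 0) - h (Some 0)) \<le> e + C / real (\<tau> + 2)"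
    if e: "e > 0" for e
  proof -
    have "isCont (\<lambda>z. h (Some z)) 0"
      using h by (simp add: cp1_continuous_def continuous_on_eq_continuous_at)
    then obtain \<delta> where \<delta>: "\<delta> > 0" "\<And>s. cmod s < \<delta> \<Longrightarrow> cmod (?d s) < e"
      using e unfolding continuous_at_eps_delta by (auto simp: dist_norm)
    \<comment> \<open>Since |s|^2 / (1 + |s|^2) grows with |s|, this C makes the second term at
      least 2 M, the trivial bound, as soon as |s| \<ge> \<delta>.\<close>
    define C where "C = 2 * M * (1 + \<delta>\<^sup>2) / \<delta>\<^sup>2"
    have C: "C > 0" using \<delta>(1) M(1) by (auto simp: C_def intro!: divide_pos_pos mult_pos_pos add_pos_nonneg)
    have pw: "cmod (?d s) \<le> e + C * ((cmod s)\<^sup>2 / (1 + (cmod s)\<^sup>2))" for s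
    proof (cases "cmod s < \<delta>")
      case True
      have "0 \<le> C * ((cmod s)\<^sup>2 / (1 + (cmod s)\<^sup>2))"
        using C one_plus_norm_square_pos[of s] by simp
      then show ?thesis using \<delta>(2)[OF True] by linarith
    next
      case False
      then have "\<delta>\<^sup>2 \<le> (cmod s)\<^sup>2" using \<delta>(1) by (intro power_mono) auto
      then have "\<delta>\<^sup>2 / (1 + \<delta>\<^sup>2) \<le> (cmod s)\<^sup>2 / (1 + (cmod s)\<^sup>2)"
        using one_plus_norm_square_pos[of s] \<delta>(1) by (simp add: field_simps add_pos_nonneg)
      then have "C * (\<delta>\<^sup>2 / (1 + \<delta>\<^sup>2)) \<le> C * ((cmod s)\<^sup>2 / (1 + (cmod s)\<^sup>2))"
        using C by (intro mult_left_mono) auto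
      moreover have "C * (\<delta>\<^sup>2 / (1 + \<delta>\<^sup>2)) = 2 * M"
      proof -
        have "1 + \<delta>\<^sup>2 > 0" by (simp add: add_pos_nonneg)
        then show ?thesis using \<delta>(1) by (simp add: C_def)
      qed
      moreover have "cmod (?d s) \<le> 2 * M"
        using norm_triangle_ineq4[of "h (Some s)" "h (Some 0)"] M(2)[of s] M(2)[of 0] by linarith
      ultimately show ?thesis using e by linarith
    qed
    have "cmod (of_nat (\<tau> + 1) * Bz \<tau> h (Some 0) - h (Some 0)) \<le> e + C / real (\<tau> + 2)" for \<tau>
    proof -
      let ?w = "\<lambda>s. (cmod s)\<^sup>2 ^ 0 / (1 + (cmod s)\<^sup>2) ^ \<tau>"
      let ?w1 = "\<lambda>s. (cmod s)\<^sup>2 ^ 1 / (1 + (cmod s)\<^sup>2) ^ (\<tau> + 1)"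
      note w = integral_radial_moment[of 0 \<tau>] and w1 = integral_radial_moment[of 1 "\<tau> + 1"]
      have bk: "bker \<tau> (Some 0) (Some s) = complex_of_real (?w s)" for s
        by (simp add: bker_def add.commute)
      have int: "integrable iota (\<lambda>s. complex_of_real (?w s) * ?d s)"
        using integrable_cp1_continuous[of "\<lambda>q. bker \<tau> (Some 0) q * (h q - h (Some 0))"]
          cp1_continuous_mult[OF cp1_continuous_bker cp1_continuous_diff[OF h cp1_continuous_const]]
        by (simp only: bk)
      have int2: "integrable iota (\<lambda>s. complex_of_real (?w s) * h (Some 0))"
        using w(2) by (intro integrable_mult_left) (simp only: complex_of_real_integrable_eq)
      have "Bz \<tau> h (Some 0) = (\<integral>s. complex_of_real (?w s) * ?d s + complex_of_real (?w s) * h (Some 0) \<partial>iota)"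
        by (simp only: Bz_def bk distrib_left[symmetric] diff_add_cancel)
      also have "\<dots> = (\<integral>s. complex_of_real (?w s) * ?d s \<partial>iota) + (\<integral>s. complex_of_real (?w s) * h (Some 0) \<partial>iota)"
        by (rule Bochner_Integration.integral_add[OF int int2])
      also have "(\<integral>s. complex_of_real (?w s) * h (Some 0) \<partial>iota) = complex_of_real (1 / real (\<tau> + 1)) * h (Some 0)"
        using w(1) by (simp only: integral_mult_left_zero integral_complex_of_real) simp
      finally have "of_nat (\<tau> + 1) * Bz \<tau> h (Some 0) - h (Some 0)
          = of_nat (\<tau> + 1) * (\<integral>s. complex_of_real (?w s) * ?d s \<partial>iota)"
        by (simp add: distrib_left del: of_nat_Suc of_nat_add)
      also have "cmod \<dots> = real (\<tau> + 1) * cmod (\<integral>s. complex_of_real (?w s) * ?d s \<partial>iota)"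
        by (simp only: norm_mult norm_of_nat)
      also have "\<dots> \<le> real (\<tau> + 1) * (\<integral>s. e * ?w s + C * ?w1 s \<partial>iota)"
      proof (rule mult_left_mono)
        have "cmod (\<integral>s. complex_of_real (?w s) * ?d s \<partial>iota) \<le> (\<integral>s. cmod (complex_of_real (?w s) * ?d s) \<partial>iota)"
          by (rule integral_norm_bound)
        also have "\<dots> \<le> (\<integral>s. e * ?w s + C * ?w1 s \<partial>iota)"
        proof (rule integral_mono)
          show "integrable iota (\<lambda>s. cmod (complex_of_real (?w s) * ?d s))"
            using int by (rule integrable_norm)
          show "integrable iota (\<lambda>s. e * ?w s + C * ?w1 s)"
            using w(2) w1(2) by (intro Bochner_Integration.integrable_add integrable_mult_right) simp_all
          fix s
          have "cmod (complex_of_real (?w s) * ?d s) = ?w s * cmod (?d s)"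
            using one_plus_norm_square_pos[of s] by (simp add: norm_mult norm_divide norm_power del: of_real_add)
          also have "\<dots> \<le> ?w s * (e + C * ((cmod s)\<^sup>2 / (1 + (cmod s)\<^sup>2)))"
            using one_plus_norm_square_pos[of s] by (intro mult_left_mono pw) simp
          also have "\<dots> = e * ?w s + C * ?w1 s"
            by (simp add: algebra_simps)
          finally show "cmod (complex_of_real (?w s) * ?d s) \<le> e * ?w s + C * ?w1 s" .
        qed
        finally show "cmod (\<integral>s. complex_of_real (?w s) * ?d s \<partial>iota) \<le> (\<integral>s. e * ?w s + C * ?w1 s \<partial>iota)" .
      qed simp
      also have "(\<integral>s. e * ?w s + C * ?w1 s \<partial>iota) = e * (1 / real (\<tau> + 1)) + C * (1 / (real (\<tau> + 2) * real (\<tau> + 1)))"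
      proof -
        have I: "(\<integral>s. ?w s \<partial>iota) = 1 / real (\<tau> + 1)" using w(1) by simp
        have I1: "(\<integral>s. ?w1 s \<partial>iota) = 1 / (real (\<tau> + 2) * real (\<tau> + 1))"
          using w1(1) by simp
        have i: "integrable iota ?w" using w(2) by simp
        have i1: "integrable iota ?w1" by (rule w1(2)) simp
        show ?thesis
          unfolding Bochner_Integration.integral_add[OF integrable_mult_right[OF i] integrable_mult_right[OF i1]]
            integral_mult_right_zero I I1 ..
      qed
      also have "real (\<tau> + 1) * \<dots> = e + C / real (\<tau> + 2)"
        by (simp add: distrib_left del: of_nat_Suc of_nat_add)
      finally show ?thesis .
    qed
    then show ?thesis by blast
  qed
  show ?thesis
  proof (rule LIMSEQ_I)
    fix e :: real assume e: "e > 0"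
    obtain C where C: "\<And>\<tau>. cmod (of_nat (\<tau> + 1) * Bz \<tau> h (Some 0) - h (Some 0)) \<le> e / 2 + C / real (\<tau> + 2)"
      using bound[of "e / 2"] e by auto
    have "(\<lambda>\<tau>. e / 2 + C / real (\<tau> + 2)) \<longlonglongrightarrow> e / 2"
      by real_asymp
    then have "eventually (\<lambda>\<tau>. e / 2 + C / real (\<tau> + 2) < e) sequentially"
      by (rule order_tendstoD(2)) (use e in simp)
    then show "\<exists>no. \<forall>\<tau>\<ge>no. cmod (of_nat (\<tau> + 1) * Bz \<tau> h (Some 0) - h (Some 0)) < e"
      unfolding eventually_sequentially using C by (meson order_le_less_trans)
  qed
qed

lemma Bz_approx_identity:
  assumes f: "cp1_continuous f"
  shows "(\<lambda>\<tau>. of_nat (\<tau> + 1) * Bz \<tau> f (Some z)) \<longlonglongrightarrow> f (Some z)"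
proof -
  define r where "r = 1 / sqrt (1 + (cmod z)\<^sup>2)"
  have r: "r > 0" "r\<^sup>2 = 1 / (1 + (cmod z)\<^sup>2)"
    using one_plus_norm_square_pos[of z] by (simp_all add: r_def power_divide)
  \<comment> \<open>The inverse of this element sends 0 to -b/a = z, so equivariance transports the
    limit from 0 to z.\<close>
  let ?a = "complex_of_real r" and ?b = "- (complex_of_real r * z)"
  have ab: "(cmod ?a)\<^sup>2 + (cmod ?b)\<^sup>2 = 1"
  proof -
    have "(cmod ?a)\<^sup>2 + (cmod ?b)\<^sup>2 = r\<^sup>2 * (1 + (cmod z)\<^sup>2)"
      by (simp add: norm_mult power_mult_distrib algebra_simps)
    then show ?thesis using r(2) one_plus_norm_square_pos[of z] by simp
  qed
  have at0: "su2_act ?a ?b g (Some 0) = g (Some z)" for g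
    using r(1) by (simp add: su2_act_def mobius_def)
  show ?thesis
    using Bz_approx_identity_0[OF cp1_continuous_su2_act[OF f ab]]
    unfolding Bz_su2_act[OF f ab] at0 .
qed

section \<open>Pointwise limits in finite-dimensional function spaces\<close>

text \<open>A Lagrange basis: a finite-dimensional space of continuous functions is determined by
  its values at finitely many finite points. Each generator that is not yet interpolated contributes
  one new node.\<close>

lemma finite_span_interpolation:
  assumes "finite B" "\<forall>f\<in>B. cp1_continuous f"
  shows "\<exists>S b. finite S \<and> (\<forall>x\<in>S. b x \<in> fs.span B) \<and> (\<forall>x\<in>S. \<forall>y\<in>S. b x (Some y) = (if x = y then 1 else 0)) \<and>
     (\<forall>f\<in>fs.span B. f = (\<Sum>x\<in>S. fscale (f (Some x)) (b x)))"
  using assms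
proof (induction B rule: finite_induct)
  case empty
  show ?case by (rule exI[of _ "{}"]) (auto simp only: fs.span_empty sum.empty)
next
  case (insert h B)
  have "\<forall>f\<in>B. cp1_continuous f" using insert.prems by simp
  from insert.IH[OF this] obtain S b where S: "finite S" "\<forall>x\<in>S. b x \<in> fs.span B"
    "\<forall>x\<in>S. \<forall>y\<in>S. b x (Some y) = (if x = y then 1 else 0)"
    "\<forall>f\<in>fs.span B. f = (\<Sum>x\<in>S. fscale (f (Some x)) (b x))"
    by blast
  define g where "g = (\<Sum>x\<in>S. fscale (h (Some x)) (b x))"
  have g: "g \<in> fs.span B" unfolding g_def using S by (intro fs.span_sum fs.span_scale) auto
  define h' where "h' = h - g"
  show ?case
  proof (cases "h' = 0")
    case True
    then have "h \<in> fs.span B" using g by (simp add: h'_def)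
    then have eq: "fs.span (insert h B) = fs.span B" by (rule fs.span_redundant)
    show ?thesis unfolding eq using S by blast
  next
    case False
    have span_cont: "cp1_continuous f" if "f \<in> fs.span (insert h B)" for f
      using fs.span_minimal[OF _ subspace_cp1_continuous, of "insert h B"] insert.prems that by auto
    have sub: "fs.span B \<subseteq> fs.span (insert h B)" by (rule fs.span_mono) blast
    have "h \<in> fs.span (insert h B)" by (rule fs.span_base) blast
    then have h'_span: "h' \<in> fs.span (insert h B)"
      unfolding h'_def using g sub by (blast intro: fs.span_diff)
    \<comment> \<open>A nonzero continuous function is nonzero at some finite point, so the new node
      can be taken in C.\<close>
    obtain x0 where x0: "h' (Some x0) \<noteq> 0"
      using False cp1_continuous_eqI[OF span_cont[OF h'_span] cp1_continuous_zero] by auto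
    have h'_S: "h' (Some y) = 0" if "y \<in> S" for y
    proof -
      have "g (Some y) = (\<Sum>x\<in>S. if x = y then h (Some x) else 0)"
        unfolding g_def using S(3) that by (auto intro!: sum.cong)
      then show ?thesis using S(1) that by (simp add: h'_def)
    qed
    have "x0 \<notin> S" using x0 h'_S by auto
    define b0 where "b0 = fscale (1 / h' (Some x0)) h'"
    \<comment> \<open>The old basis functions are corrected to vanish at the new node; since
      \<open>b0\<close> vanishes on \<open>S\<close>, their values at the old nodes do not
      change.\<close>
    define b' where "b' x = (if x = x0 then b0 else b x - fscale (b x (Some x0)) b0)" for x
    have b_span: "b x \<in> fs.span (insert h B)" if "x \<in> S" for x
      using S(2) that sub by blast
    have b0_span: "b0 \<in> fs.span (insert h B)"
      unfolding b0_def by (intro fs.span_scale h'_span)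
    have rep: "f = (\<Sum>x\<in>insert x0 S. fscale (f (Some x)) (b' x))" if f: "f \<in> fs.span (insert h B)" for f
    proof -
      obtain k where "f - fscale k h \<in> fs.span B"
        using f fs.span_breakdown_eq by blast
      then have "f - fscale k h + fscale k g \<in> fs.span B"
        using g by (intro fs.span_add fs.span_scale)
      moreover have "f - fscale k h + fscale k g = f - fscale k h'"
        by (rule ext) (simp add: h'_def algebra_simps)
      ultimately have "f - fscale k h' \<in> fs.span B" by simp
      then have "f - fscale k h' = (\<Sum>x\<in>S. fscale ((f - fscale k h') (Some x)) (b x))"
        using S(4) by blast
      also have "\<dots> = (\<Sum>x\<in>S. fscale (f (Some x)) (b x))"
        by (intro sum.cong refl) (simp add: h'_S)
      finally have eq: "f - fscale k h' = (\<Sum>x\<in>S. fscale (f (Some x)) (b x))" .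
      have fk: "f p = (\<Sum>x\<in>S. f (Some x) * b x p) + k * h' p" for p
      proof -
        have "f p - k * h' p = (\<Sum>x\<in>S. f (Some x) * b x p)"
          using fun_cong[OF eq, of p] by simp
        then show ?thesis by (simp only: diff_eq_eq)
      qed
      show ?thesis
      proof
        fix p
        have "(\<Sum>x\<in>insert x0 S. fscale (f (Some x)) (b' x)) p
          = f (Some x0) * b0 p + (\<Sum>x\<in>S. f (Some x) * (b x p - b x (Some x0) * b0 p))"
          using S(1) \<open>x0 \<notin> S\<close> by (auto simp: b'_def intro!: sum.cong)
        also have "(\<Sum>x\<in>S. f (Some x) * (b x p - b x (Some x0) * b0 p))
          = (\<Sum>x\<in>S. f (Some x) * b x p) - (\<Sum>x\<in>S. f (Some x) * b x (Some x0)) * b0 p"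
          by (simp add: right_diff_distrib sum_subtractf sum_distrib_right mult.assoc)
        also have "(\<Sum>x\<in>S. f (Some x) * b x (Some x0)) = f (Some x0) - k * h' (Some x0)"
          using fk[of "Some x0"] by simp
        also have "f (Some x0) * b0 p + ((\<Sum>x\<in>S. f (Some x) * b x p) - (f (Some x0) - k * h' (Some x0)) * b0 p)
          = (\<Sum>x\<in>S. f (Some x) * b x p) + k * (h' (Some x0) * b0 p)"
          by (simp add: algebra_simps)
        also have "h' (Some x0) * b0 p = h' p" using x0 by (simp add: b0_def)
        finally show "f p = (\<Sum>x\<in>insert x0 S. fscale (f (Some x)) (b' x)) p"
          using fk[of p] by simp
      qed
    qed
    have "b' x \<in> fs.span (insert h B)" if "x \<in> insert x0 S" for x
      using that b_span b0_span by (auto simp: b'_def intro!: fs.span_diff fs.span_scale)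
    moreover have "b' x (Some y) = (if x = y then 1 else 0)" if "x \<in> insert x0 S" "y \<in> insert x0 S" for x y
      using that x0 h'_S S(3) \<open>x0 \<notin> S\<close> by (auto simp: b'_def b0_def)
    ultimately show ?thesis
      using S(1) rep by (intro exI[of _ "insert x0 S"] exI[of _ b']) blast
  qed
qed

text \<open>The interpolation formula expresses every \<open>F n\<close> through its values at
  finitely many points, so it survives a pointwise limit; no norm on the function space is
  involved.\<close>

lemma span_pointwise_closed:
  assumes B: "finite B" "\<And>f. f \<in> B \<Longrightarrow> cp1_continuous f"
    and F: "\<And>n. F n \<in> fs.span B" and lim: "\<And>z. (\<lambda>n. F n (Some z)) \<longlonglongrightarrow> f (Some z)"
    and f: "cp1_continuous f"
  shows "f \<in> fs.span B"
proof -
  obtain S b where S: "finite S" "\<forall>x\<in>S. b x \<in> fs.span B"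
    and rep: "\<forall>f\<in>fs.span B. f = (\<Sum>x\<in>S. fscale (f (Some x)) (b x))"
    using finite_span_interpolation[of B] B by blast
  define g where "g = (\<Sum>x\<in>S. fscale (f (Some x)) (b x))"
  have g: "g \<in> fs.span B" unfolding g_def using S by (intro fs.span_sum fs.span_scale) auto
  have "f = g"
  proof (rule cp1_continuous_eqI[OF f])
    show "cp1_continuous g"
      using fs.span_minimal[OF _ subspace_cp1_continuous, of B] B g by auto
    fix z
    have "F n (Some z) = (\<Sum>x\<in>S. F n (Some x) * b x (Some z))" for n
    proof -
      have "F n (Some z) = (\<Sum>x\<in>S. fscale (F n (Some x)) (b x)) (Some z)"
        using rep F[of n] by metis
      then show ?thesis by simp
    qed
    moreover have "(\<lambda>n. \<Sum>x\<in>S. F n (Some x) * b x (Some z)) \<longlonglongrightarrow> (\<Sum>x\<in>S. f (Some x) * b x (Some z))"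
      by (intro tendsto_intros lim)
    ultimately have "(\<lambda>n. F n (Some z)) \<longlonglongrightarrow> g (Some z)"
      by (simp add: g_def)
    then show "f (Some z) = g (Some z)"
      using lim[of z] LIMSEQ_unique by blast
  qed
  then show ?thesis using g by simp
qed

subsection \<open>Weights and the raising operator\<close>

lemma su2_invariant_subspaceD:
  assumes "su2_invariant_subspace V"
  shows "\<And>f. f \<in> V \<Longrightarrow> cp1_continuous f" "fs.subspace V"
    "\<And>a b f. (cmod a)\<^sup>2 + (cmod b)\<^sup>2 = 1 \<Longrightarrow> f \<in> V \<Longrightarrow> su2_act a b f \<in> V"
  using assms by (auto simp: su2_invariant_subspace_def)

definition comb :: "nat \<Rightarrow> (nat \<times> nat \<Rightarrow> complex) \<Rightarrow> complex option \<Rightarrow> complex" where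
  "comb \<tau> c = (\<Sum>x\<in>{..\<tau>} \<times> {..\<tau>}. fscale (c x) (sph \<tau> (fst x) (snd x)))"

lemma comb_apply: "comb \<tau> c p = (\<Sum>x\<in>{..\<tau>} \<times> {..\<tau>}. c x * sph \<tau> (fst x) (snd x) p)"
  by (simp add: comb_def)

lemma comb_eq_0: "(\<And>x. x \<in> {..\<tau>} \<times> {..\<tau>} \<Longrightarrow> c x = 0) \<Longrightarrow> comb \<tau> c = 0"
  unfolding comb_def by (intro sum.neutral ballI) simp

lemma cp1_continuous_comb: "cp1_continuous (comb \<tau> c)"
  unfolding comb_apply[abs_def] by (intro cp1_continuous_sum cp1_continuous_mult cp1_continuous_const cp1_continuous_sph) auto

lemma span_sphs_comb:
  assumes "f \<in> fs.span (sphs \<tau>)"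
  obtains c where "f = comb \<tau> c"
proof -
  have "fs.span (sphs \<tau>) \<subseteq> range (comb \<tau>)"
  proof (rule fs.span_minimal)
    show "sphs \<tau> \<subseteq> range (comb \<tau>)"
    proof
      fix g assume "g \<in> sphs \<tau>"
      then obtain i j where ij: "i \<le> \<tau>" "j \<le> \<tau>" "g = sph \<tau> i j" by (auto simp: sphs_def)
      have "comb \<tau> (\<lambda>x. if x = (i, j) then 1 else 0) = g"
      proof
        fix p
        have "comb \<tau> (\<lambda>x. if x = (i, j) then 1 else 0) p
            = (\<Sum>x\<in>{..\<tau>} \<times> {..\<tau>}. if x = (i, j) then sph \<tau> (fst x) (snd x) p else 0)"
          unfolding comb_apply by (intro sum.cong) auto
        then show "comb \<tau> (\<lambda>x. if x = (i, j) then 1 else 0) p = g p"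
          using ij by simp
      qed
      then show "g \<in> range (comb \<tau>)" by blast
    qed
    show "fs.subspace (range (comb \<tau>))"
    proof (rule fs.subspaceI)
      show "0 \<in> range (comb \<tau>)" by (rule range_eqI[of _ _ "\<lambda>_. 0"]) (simp add: comb_eq_0)
      fix g h assume "g \<in> range (comb \<tau>)" "h \<in> range (comb \<tau>)"
      then obtain c d where "g = comb \<tau> c" "h = comb \<tau> d" by blast
      then have "g + h = comb \<tau> (\<lambda>x. c x + d x)"
        by (intro ext) (simp add: comb_apply distrib_right sum.distrib)
      then show "g + h \<in> range (comb \<tau>)" by blast
    next
      fix k g assume "g \<in> range (comb \<tau>)"
      then obtain c where "g = comb \<tau> c" by blast
      then have "fscale k g = comb \<tau> (\<lambda>x. k * c x)"
        by (intro ext) (simp add: comb_apply sum_distrib_left mult.assoc)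
      then show "fscale k g \<in> range (comb \<tau>)" by blast
    qed
  qed
  then show ?thesis using assms that by blast
qed

section \<open>Weight decomposition\<close>

lemma sum_cis_roots_of_unity:
  fixes d :: int
  assumes "\<bar>d\<bar> < int N"
  shows "(\<Sum>k<N. cis (2 * pi * real k * real_of_int d / real N)) = (if d = 0 then of_nat N else 0)"
proof -
  have N: "N > 0" using assms by auto
  define w where "w = cis (2 * pi * real_of_int d / real N)"
  have "(\<Sum>k<N. cis (2 * pi * real k * real_of_int d / real N)) = (\<Sum>k<N. w ^ k)"
    by (intro sum.cong refl) (simp add: w_def Complex.DeMoivre mult_ac)
  also have "\<dots> = (if w = 1 then of_nat N else (1 - w ^ N) / (1 - w))"
    by (rule sum_gp_strict)
  also have "w ^ N = 1"
  proof -
    have "w ^ N = cis (2 * pi * real_of_int d)"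
      using N by (simp add: w_def Complex.DeMoivre)
    then show ?thesis by (simp add: cis_multiple_2pi)
  qed
  also have "w = 1 \<longleftrightarrow> d = 0"
  proof
    assume "w = 1"
    then have "cos (2 * pi * real_of_int d / real N) = 1"
      by (simp add: w_def complex_eq_iff)
    then obtain n :: int where "2 * pi * real_of_int d / real N = real_of_int n * 2 * pi"
      using cos_one_2pi_int by auto
    then have "real_of_int d = real_of_int n * real N"
      using N by (simp add: field_simps)
    then have d: "d = n * int N"
      by (metis of_int_eq_iff of_int_mult of_int_of_nat_eq)
    show "d = 0"
    proof (rule ccontr)
      assume "d \<noteq> 0"
      then have "\<bar>n\<bar> \<ge> 1" using d by auto
      then have "\<bar>d\<bar> \<ge> int N" by (simp add: d abs_mult mult_le_cancel_right1)
      then show False using assms by simp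
    qed
  qed (simp add: w_def)
  finally show ?thesis by simp
qed

lemma su2_act_rotation_sph:
  assumes "i \<le> \<tau>" "j \<le> \<tau>"
  shows "su2_act (cis (- t)) 0 (sph \<tau> i j) p = cis (2 * (real i - real j) * t) * sph \<tau> i j p"
proof -
  have "cis t ^ i * cnj (cis t) ^ (\<tau> - i) * cnj (cis t) ^ j * cis t ^ (\<tau> - j)
      = cis (real i * t + real (\<tau> - i) * (- t) + real j * (- t) + real (\<tau> - j) * t)"
    unfolding cis_cnj Complex.DeMoivre cis_mult ..
  also have "real i * t + real (\<tau> - i) * (- t) + real j * (- t) + real (\<tau> - j) * t = 2 * (real i - real j) * t"
    using assms by (simp add: of_nat_diff algebra_simps)
  finally show ?thesis
    using sph_rotation[of "cis t" i \<tau> j p] assms by (simp add: su2_act_def cis_cnj)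
qed

text \<open>Half the torus weight: rotation by the angle t multiplies \<open>sph \<tau> i j\<close>
  by cis (2 (i - j) t).\<close>

definition wt :: "nat \<times> nat \<Rightarrow> int" where
  "wt x = int (fst x) - int (snd x)"

text \<open>A discrete Fourier projection: the component is a finite linear combination of rotated
  copies, hence stays in the invariant subspace without any limit.\<close>

lemma weight_component_mem:
  assumes V: "su2_invariant_subspace V" and c: "comb \<tau> c \<in> V" and n: "\<bar>n\<bar> \<le> int \<tau>"
  shows "comb \<tau> (\<lambda>x. if wt x = n then c x else 0) \<in> V"
proof -
  \<comment> \<open>Two weights differ by at most 2 \<tau>, so this many roots of unity separate
    them.\<close>
  define N where "N = 2 * \<tau> + 1"
  have N: "N > 0" by (simp add: N_def)
  \<comment> \<open>Half of 2 pi k / N, because rotations act with twice the weight.\<close>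
  define \<theta> where "\<theta> k = pi * real k / real N" for k
  define P where "P = (\<Sum>k<N. fscale (cis (- (2 * pi * real k * real_of_int n / real N)) / of_nat N)
     (su2_act (cis (- \<theta> k)) 0 (comb \<tau> c)))"
  have "P \<in> V"
    unfolding P_def
    by (intro fs.subspace_sum fs.subspace_scale su2_invariant_subspaceD(3)[OF V] su2_invariant_subspaceD(2)[OF V] c) simp
  moreover have "P = comb \<tau> (\<lambda>x. if wt x = n then c x else 0)"
  proof
    fix p
    have "P p = (\<Sum>k<N. \<Sum>x\<in>{..\<tau>} \<times> {..\<tau>}. (c x * sph \<tau> (fst x) (snd x) p / of_nat N) * cis (2 * pi * real k * real_of_int (wt x - n) / real N))"
      unfolding P_def sum_fun_apply fscale_apply
    proof (intro sum.cong refl)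
      fix k
      have "su2_act (cis (- \<theta> k)) 0 (comb \<tau> c) p = (\<Sum>x\<in>{..\<tau>} \<times> {..\<tau>}. c x * su2_act (cis (- \<theta> k)) 0 (sph \<tau> (fst x) (snd x)) p)"
        by (simp add: su2_act_def comb_apply)
      also have "\<dots> = (\<Sum>x\<in>{..\<tau>} \<times> {..\<tau>}. c x * (cis (2 * (real (fst x) - real (snd x)) * \<theta> k) * sph \<tau> (fst x) (snd x) p))"
        by (intro sum.cong refl) (auto simp: su2_act_rotation_sph)
      finally have "cis (- (2 * pi * real k * real_of_int n / real N)) / of_nat N * su2_act (cis (- \<theta> k)) 0 (comb \<tau> c) p
         = (\<Sum>x\<in>{..\<tau>} \<times> {..\<tau>}. (c x * sph \<tau> (fst x) (snd x) p / of_nat N) *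
             (cis (- (2 * pi * real k * real_of_int n / real N)) * cis (2 * (real (fst x) - real (snd x)) * \<theta> k)))"
        by (simp add: sum_distrib_left mult_ac)
      also have "\<dots> = (\<Sum>x\<in>{..\<tau>} \<times> {..\<tau>}. (c x * sph \<tau> (fst x) (snd x) p / of_nat N) * cis (2 * pi * real k * real_of_int (wt x - n) / real N))"
      proof (intro sum.cong refl arg_cong2[where f="(*)"])
        fix x
        have "- (2 * pi * real k * real_of_int n / real N) + 2 * (real (fst x) - real (snd x)) * \<theta> k
           = 2 * pi * real k * real_of_int (wt x - n) / real N"
          using N by (simp add: \<theta>_def wt_def field_simps)
        then show "cis (- (2 * pi * real k * real_of_int n / real N)) * cis (2 * (real (fst x) - real (snd x)) * \<theta> k)
          = cis (2 * pi * real k * real_of_int (wt x - n) / real N)"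
          by (simp only: cis_mult)
      qed
      finally show "cis (- (2 * pi * real k * real_of_int n / real N)) / of_nat N * su2_act (cis (- \<theta> k)) 0 (comb \<tau> c) p
        = (\<Sum>x\<in>{..\<tau>} \<times> {..\<tau>}. (c x * sph \<tau> (fst x) (snd x) p / of_nat N) * cis (2 * pi * real k * real_of_int (wt x - n) / real N))" .
    qed
    also have "\<dots> = (\<Sum>x\<in>{..\<tau>} \<times> {..\<tau>}. (c x * sph \<tau> (fst x) (snd x) p / of_nat N) *
        (\<Sum>k<N. cis (2 * pi * real k * real_of_int (wt x - n) / real N)))"
      by (subst sum.swap) (simp only: sum_distrib_left)
    also have "\<dots> = (\<Sum>x\<in>{..\<tau>} \<times> {..\<tau>}. (if wt x = n then c x else 0) * sph \<tau> (fst x) (snd x) p)"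
    proof (intro sum.cong refl)
      fix x assume "x \<in> {..\<tau>} \<times> {..\<tau>}"
      then have "\<bar>wt x - n\<bar> < int N" using n by (auto simp: wt_def N_def)
      from sum_cis_roots_of_unity[OF this]
      show "(c x * sph \<tau> (fst x) (snd x) p / of_nat N) * (\<Sum>k<N. cis (2 * pi * real k * real_of_int (wt x - n) / real N))
         = (if wt x = n then c x else 0) * sph \<tau> (fst x) (snd x) p"
        using N by simp
    qed
    finally show "P p = comb \<tau> (\<lambda>x. if wt x = n then c x else 0) p"
      by (simp only: comb_apply)
  qed
  ultimately show ?thesis by simp
qed

lemma su2_invariant_subspace_zero: "su2_invariant_subspace {0}"
  by (auto simp: su2_invariant_subspace_def su2_act_def fs.subspace_def fun_eq_iff)

text \<open>Linear independence of the monomials. Projection to one weight, applied to the invariant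
  subspace {0}, reduces to pairs with fixed i - j. Such a pair is determined by i + j, so a
  polynomial in real z = r detects each coefficient.\<close>

lemma comb_eq_0_imp:
  assumes c: "comb \<tau> c = 0" and x: "x \<in> {..\<tau>} \<times> {..\<tau>}"
  shows "c x = 0"
proof -
  let ?S = "{y \<in> {..\<tau>} \<times> {..\<tau>}. wt y = wt x}"
  have "comb \<tau> (\<lambda>y. if wt y = wt x then c y else 0) \<in> {0}"
    by (rule weight_component_mem[OF su2_invariant_subspace_zero]) (use c x in \<open>auto simp: wt_def\<close>)
  then have z: "comb \<tau> (\<lambda>y. if wt y = wt x then c y else 0) = 0" by simp
  define cf where "cf k = (\<Sum>y\<in>{y \<in> ?S. fst y + snd y = k}. c y)" for k
  have "(\<Sum>k\<le>2 * \<tau>. cf k * complex_of_real r ^ k) = 0" for r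
  proof -
    have "0 = comb \<tau> (\<lambda>y. if wt y = wt x then c y else 0) (Some (complex_of_real r))"
      by (simp add: z)
    also have "\<dots> = (\<Sum>y\<in>{..\<tau>} \<times> {..\<tau>}. if wt y = wt x then c y * complex_of_real r ^ (fst y + snd y) / complex_of_real ((1 + r\<^sup>2) ^ \<tau>) else 0)"
      unfolding comb_apply by (intro sum.cong refl) (auto simp: sph_Some power_add)
    also have "\<dots> = (\<Sum>y\<in>?S. c y * complex_of_real r ^ (fst y + snd y)) / complex_of_real ((1 + r\<^sup>2) ^ \<tau>)"
      by (subst sum.inter_filter[symmetric]) (auto simp: sum_divide_distrib)
    finally have "(\<Sum>y\<in>?S. c y * complex_of_real r ^ (fst y + snd y)) / complex_of_real ((1 + r\<^sup>2) ^ \<tau>) = 0" ..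
    moreover have "(1 + r\<^sup>2) ^ \<tau> \<noteq> 0"
      using add_pos_nonneg[OF zero_less_one zero_le_power2[of r]] by simp
    ultimately have "(\<Sum>y\<in>?S. c y * complex_of_real r ^ (fst y + snd y)) = 0"
      by (simp only: divide_eq_0_iff of_real_eq_0_iff simp_thms)
    moreover have "(\<Sum>y\<in>?S. c y * complex_of_real r ^ (fst y + snd y))
        = (\<Sum>k\<le>2 * \<tau>. \<Sum>y\<in>{y \<in> ?S. fst y + snd y = k}. c y * complex_of_real r ^ (fst y + snd y))"
      by (rule sum.group[symmetric]) auto
    moreover have "\<dots> = (\<Sum>k\<le>2 * \<tau>. cf k * complex_of_real r ^ k)"
      unfolding cf_def sum_distrib_right by (intro sum.cong refl) auto
    ultimately show ?thesis by simp
  qed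
  then have "range complex_of_real \<subseteq> {z. (\<Sum>k\<le>2 * \<tau>. cf k * z ^ k) = 0}"
    by auto
  moreover have "infinite (range complex_of_real)"
    by (subst finite_image_iff) (auto simp: inj_on_def infinite_UNIV_char_0)
  ultimately have "infinite {z. (\<Sum>k\<le>2 * \<tau>. cf k * z ^ k) = 0}"
    using finite_subset by blast
  then have "cf (fst x + snd x) = 0"
    using x polyfun_finite_roots[of cf "2 * \<tau>"] by (auto simp: mem_Times_iff)
  moreover have "{y \<in> ?S. fst y + snd y = fst x + snd x} = {x}"
    using x by (auto simp: wt_def prod_eq_iff)
  ultimately show ?thesis by (simp add: cf_def)
qed

text \<open>The coefficients of the image under the raising operator of the complexified Lie algebra.\<close>

definition raise :: "nat \<Rightarrow> (nat \<times> nat \<Rightarrow> complex) \<Rightarrow> nat \<times> nat \<Rightarrow> complex" where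
  "raise \<tau> c x = (if fst x = 0 then 0 else of_nat (\<tau> + 1 - fst x) * c (fst x - 1, snd x))
     - (if snd x < \<tau> then of_nat (snd x + 1) * c (fst x, snd x + 1) else 0)"

text \<open>This is -(z^2 d/dz + d/dcnj z) applied to \<open>comb \<tau> c\<close>. In the index
  shifts the boundary terms disappear because the factors \<tau> - i and j vanish at i = \<tau> and
  j = 0.\<close>

lemma comb_raise_Some:
  "comb \<tau> (raise \<tau> c) (Some z) = (\<Sum>x\<in>{..\<tau>} \<times> {..\<tau>}. c x *
     ((of_nat (\<tau> - fst x) * z ^ (fst x + 1) * cnj z ^ snd x - of_nat (snd x) * z ^ fst x * cnj z ^ (snd x - 1)) /
      complex_of_real ((1 + (cmod z)\<^sup>2) ^ \<tau>)))"
proof -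
  let ?D = "complex_of_real ((1 + (cmod z)\<^sup>2) ^ \<tau>)"
  have up: "(\<Sum>i\<le>\<tau>. (if i = 0 then 0 else of_nat (\<tau> + 1 - i) * c (i - 1, j)) * z ^ i)
     = (\<Sum>i\<le>\<tau>. c (i, j) * (of_nat (\<tau> - i) * z ^ (i + 1)))" for j
  proof -
    have "(\<Sum>i\<le>\<tau>. c (i, j) * (of_nat (\<tau> - i) * z ^ (i + 1))) = (\<Sum>i<\<tau>. c (i, j) * (of_nat (\<tau> - i) * z ^ (i + 1)))"
      by (simp add: lessThan_Suc_atMost[symmetric])
    then show ?thesis by (subst sum.atMost_shift) (simp add: mult_ac)
  qed
  have down: "(\<Sum>j\<le>\<tau>. (if j < \<tau> then of_nat (j + 1) * c (i, j + 1) else 0) * cnj z ^ j)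
     = (\<Sum>j\<le>\<tau>. c (i, j) * (of_nat j * cnj z ^ (j - 1)))" for i
  proof -
    have "(\<Sum>j\<le>\<tau>. (if j < \<tau> then of_nat (j + 1) * c (i, j + 1) else 0) * cnj z ^ j)
      = (\<Sum>j<\<tau>. of_nat (j + 1) * c (i, j + 1) * cnj z ^ j)"
      by (simp add: lessThan_Suc_atMost[symmetric])
    then show ?thesis by (subst (2) sum.atMost_shift) (simp add: mult_ac)
  qed
  have "comb \<tau> (raise \<tau> c) (Some z) * ?D = (\<Sum>i\<le>\<tau>. \<Sum>j\<le>\<tau>. raise \<tau> c (i, j) * (z ^ i * cnj z ^ j))"
    using one_plus_norm_square_pos[of z]
    by (simp add: comb_apply sph_Some sum_distrib_right sum.cartesian_product case_prod_beta del: of_real_add of_real_power)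
  also have "\<dots> = (\<Sum>j\<le>\<tau>. (\<Sum>i\<le>\<tau>. (if i = 0 then 0 else of_nat (\<tau> + 1 - i) * c (i - 1, j)) * z ^ i) * cnj z ^ j)
     - (\<Sum>i\<le>\<tau>. (\<Sum>j\<le>\<tau>. (if j < \<tau> then of_nat (j + 1) * c (i, j + 1) else 0) * cnj z ^ j) * z ^ i)"
    unfolding raise_def sum_distrib_right
    by (subst (2) sum.swap) (simp only: fst_conv snd_conv left_diff_distrib sum_subtractf mult.assoc mult.commute[of "z ^ _" "cnj z ^ _"])
  also have "\<dots> = (\<Sum>j\<le>\<tau>. \<Sum>i\<le>\<tau>. c (i, j) * (of_nat (\<tau> - i) * z ^ (i + 1)) * cnj z ^ j)
     - (\<Sum>i\<le>\<tau>. \<Sum>j\<le>\<tau>. c (i, j) * (of_nat j * cnj z ^ (j - 1)) * z ^ i)"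
    unfolding up down sum_distrib_right ..
  also have "\<dots> = (\<Sum>i\<le>\<tau>. \<Sum>j\<le>\<tau>. c (i, j) * (of_nat (\<tau> - i) * z ^ (i + 1) * cnj z ^ j - of_nat j * z ^ i * cnj z ^ (j - 1)))"
    by (subst sum.swap) (simp add: sum_subtractf[symmetric] right_diff_distrib mult_ac)
  finally have "comb \<tau> (raise \<tau> c) (Some z) * ?D = \<dots>" .
  then have "comb \<tau> (raise \<tau> c) (Some z) = (\<Sum>i\<le>\<tau>. \<Sum>j\<le>\<tau>. c (i, j) * (of_nat (\<tau> - i) * z ^ (i + 1) * cnj z ^ j - of_nat j * z ^ i * cnj z ^ (j - 1))) / ?D"
    using one_plus_norm_square_pos[of z] by (simp add: eq_divide_eq del: of_real_add of_real_power)
  then show ?thesis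
    by (simp only: sum_divide_distrib sum.cartesian_product case_prod_beta times_divide_eq_right prod.collapse)
qed

lemma su2_act_sph_Some:
  assumes "i \<le> \<tau>" "j \<le> \<tau>" and ab: "(cmod a)\<^sup>2 + (cmod b)\<^sup>2 = 1"
  shows "su2_act a b (sph \<tau> i j) (Some z) = (cnj a * z - b) ^ i * (cnj b * z + a) ^ (\<tau> - i) *
     cnj ((cnj a * z - b) ^ j * (cnj b * z + a) ^ (\<tau> - j)) / complex_of_real ((1 + (cmod z)\<^sup>2) ^ \<tau>)"
proof -
  have ab': "(cmod (cnj a))\<^sup>2 + (cmod (- b))\<^sup>2 = 1" using ab by simp
  have "su2_act a b (sph \<tau> i j) (pt z 1) = sph \<tau> i j (pt (cnj a * z + - b * 1) (- cnj (- b) * z + cnj (cnj a) * 1))"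
    unfolding su2_act_def by (subst mobius_pt) auto
  also have "\<dots> = (cnj a * z + - b * 1) ^ i * (- cnj (- b) * z + cnj (cnj a) * 1) ^ (\<tau> - i) *
      cnj ((cnj a * z + - b * 1) ^ j * (- cnj (- b) * z + cnj (cnj a) * 1) ^ (\<tau> - j)) /
      complex_of_real (((cmod z)\<^sup>2 + (cmod 1)\<^sup>2) ^ \<tau>)"
    using su2_nonzero[OF ab', of z 1] assms
    by (subst sph_pt) (auto simp only: su2_norm[OF ab'] zero_neq_one[symmetric] simp_thms)
  finally show ?thesis by (simp add: add.commute)
qed

text \<open>For real \<open>t\<close> this is the numerator of the translate of a monomial by the one-parameter subgroup
  with direction \<open>e\<close>; the conjugates are written out so that it is holomorphic in \<open>t\<close>.\<close>

definition flow :: "nat \<Rightarrow> nat \<Rightarrow> nat \<Rightarrow> complex \<Rightarrow> complex \<Rightarrow> complex \<Rightarrow> complex" where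
  "flow \<tau> i j e z t = (cos t * z - e * sin t) ^ i * (cnj e * sin t * z + cos t) ^ (\<tau> - i) *
     ((cos t * cnj z - cnj e * sin t) ^ j * (e * sin t * cnj z + cos t) ^ (\<tau> - j))"

lemma flow_0: "flow \<tau> i j e z 0 = z ^ i * cnj z ^ j"
  by (simp add: flow_def)

lemma flow_deriv:
  "(flow \<tau> i j e z has_field_derivative
     (- e * of_nat i * z ^ (i - 1) * cnj z ^ j + of_nat (\<tau> - i) * cnj e * z ^ (i + 1) * cnj z ^ j
      - cnj e * of_nat j * z ^ i * cnj z ^ (j - 1) + of_nat (\<tau> - j) * e * z ^ i * cnj z ^ (j + 1))) (at 0)"
  unfolding flow_def[abs_def]
  by (auto intro!: derivative_eq_intros simp: algebra_simps)

lemma su2_act_flow: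
  assumes "i \<le> \<tau>" "j \<le> \<tau>" "cmod e = 1"
  shows "su2_act (complex_of_real (cos t)) (e * complex_of_real (sin t)) (sph \<tau> i j) (Some z)
       = flow \<tau> i j e z (complex_of_real t) / complex_of_real ((1 + (cmod z)\<^sup>2) ^ \<tau>)"
proof -
  have ab: "(cmod (complex_of_real (cos t)))\<^sup>2 + (cmod (e * complex_of_real (sin t)))\<^sup>2 = 1"
    using assms(3) by (simp add: norm_mult)
  show ?thesis
    by (subst su2_act_sph_Some[OF assms(1,2) ab])
       (simp add: flow_def cos_of_real sin_of_real mult_ac)
qed

text \<open>Difference quotients along one-parameter subgroups lie in V. Their limit is the image
  under the raising operator, and it stays in V because V is finite-dimensional and hence closed
  under pointwise limits to continuous functions.\<close>

lemma raise_mem: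
  assumes V: "su2_invariant_subspace V" and fin: "V \<subseteq> fs.span (sphs \<tau>)" and c: "comb \<tau> c \<in> V"
  shows "comb \<tau> (raise \<tau> c) \<in> V"
proof -
  note VD = su2_invariant_subspaceD[OF V]
  obtain B where B: "B \<subseteq> V" "fs.independent B" "V \<subseteq> fs.span B"
    by (rule fs.basis_exists[of V])
  have finB: "finite B"
    using fs.independent_span_bound[OF finite_sphs B(2)] B(1) fin by blast
  have spanB: "fs.span B = V"
    using fs.span_minimal[OF B(1) VD(2)] B(3) by blast
  define t where "t n = 1 / real (Suc n)" for n
  have t0: "t n \<noteq> 0" for n by (simp add: t_def)
  let ?f = "comb \<tau> c"
  let ?g = "\<lambda>e n. su2_act (complex_of_real (cos (t n))) (e * complex_of_real (sin (t n))) ?f"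
  \<comment> \<open>Terms of the derivative that contain \<open>e\<close> get the factor 1 + \<i>
    \<i> = 0 and cancel; those with \<open>cnj e\<close> get 1 - \<i> \<i> = 2, which the
    denominator removes.\<close>
  define F where "F n = fscale (1 / (2 * complex_of_real (t n))) ((?g 1 n - ?f) + fscale \<i> (?g \<i> n - ?f))" for n
  have FV: "F n \<in> V" for n
    unfolding F_def by (intro fs.subspace_scale fs.subspace_add fs.subspace_diff VD(2,3) c) (simp_all add: norm_mult)
  have lim: "(\<lambda>n. F n (Some z)) \<longlonglongrightarrow> comb \<tau> (raise \<tau> c) (Some z)" for z
  proof -
    let ?D = "complex_of_real ((1 + (cmod z)\<^sup>2) ^ \<tau>)"
    define q where "q e x n = (flow \<tau> (fst x) (snd x) e z (complex_of_real (t n)) - flow \<tau> (fst x) (snd x) e z 0) / complex_of_real (t n)" for e x n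
    have g: "?g e n (Some z) - ?f (Some z) = complex_of_real (t n) * (\<Sum>x\<in>{..\<tau>} \<times> {..\<tau>}. c x * (q e x n / ?D))" if "cmod e = 1" for e n
    proof -
      have "?g e n (Some z) = (\<Sum>x\<in>{..\<tau>} \<times> {..\<tau>}. c x * su2_act (complex_of_real (cos (t n))) (e * complex_of_real (sin (t n))) (sph \<tau> (fst x) (snd x)) (Some z))"
        by (simp add: su2_act_def comb_apply)
      also have "\<dots> = (\<Sum>x\<in>{..\<tau>} \<times> {..\<tau>}. c x * (flow \<tau> (fst x) (snd x) e z (complex_of_real (t n)) / ?D))"
        using that by (intro sum.cong refl) (simp only: su2_act_flow mem_Times_iff atMost_iff)
      finally have "?g e n (Some z) - ?f (Some z) = (\<Sum>x\<in>{..\<tau>} \<times> {..\<tau>}. c x * (flow \<tau> (fst x) (snd x) e z (complex_of_real (t n)) / ?D) - c x * (flow \<tau> (fst x) (snd x) e z 0 / ?D))"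
        by (simp only: comb_apply sph_Some flow_0 sum_subtractf)
      also have "\<dots> = complex_of_real (t n) * (\<Sum>x\<in>{..\<tau>} \<times> {..\<tau>}. c x * (q e x n / ?D))"
        unfolding sum_distrib_left q_def using t0
        by (intro sum.cong refl) (simp add: right_diff_distrib diff_divide_distrib)
      finally show ?thesis .
    qed
    have "F n (Some z) = (\<Sum>x\<in>{..\<tau>} \<times> {..\<tau>}. c x * ((q 1 x n + \<i> * q \<i> x n) / 2 / ?D))" for n
    proof -
      have "F n (Some z) = 1 / (2 * complex_of_real (t n)) * ((?g 1 n (Some z) - ?f (Some z)) + \<i> * (?g \<i> n (Some z) - ?f (Some z)))"
        by (simp add: F_def)
      also have "\<dots> = 1 / (2 * complex_of_real (t n)) * (complex_of_real (t n) *
          ((\<Sum>x\<in>{..\<tau>} \<times> {..\<tau>}. c x * (q 1 x n / ?D)) + \<i> * (\<Sum>x\<in>{..\<tau>} \<times> {..\<tau>}. c x * (q \<i> x n / ?D))))"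
        by (subst (1 2) g) (simp_all only: norm_one norm_ii distrib_left mult.left_commute)
      also have "\<dots> = ((\<Sum>x\<in>{..\<tau>} \<times> {..\<tau>}. c x * (q 1 x n / ?D)) + \<i> * (\<Sum>x\<in>{..\<tau>} \<times> {..\<tau>}. c x * (q \<i> x n / ?D))) / 2"
        using t0 by simp
      also have "\<dots> = (\<Sum>x\<in>{..\<tau>} \<times> {..\<tau>}. c x * ((q 1 x n + \<i> * q \<i> x n) / 2 / ?D))"
        unfolding sum_distrib_left sum.distrib[symmetric] sum_divide_distrib
        by (intro sum.cong refl) (simp add: add_divide_distrib distrib_left mult_ac)
      finally show ?thesis .
    qed
    moreover have "(\<lambda>n. \<Sum>x\<in>{..\<tau>} \<times> {..\<tau>}. c x * ((q 1 x n + \<i> * q \<i> x n) / 2 / ?D)) \<longlonglongrightarrow> comb \<tau> (raise \<tau> c) (Some z)"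
      unfolding comb_raise_Some
    proof (intro tendsto_sum tendsto_mult tendsto_const)
      fix x :: "nat \<times> nat"
      let ?i = "fst x" and ?j = "snd x"
      have ql: "q e x \<longlonglongrightarrow> - e * of_nat ?i * z ^ (?i - 1) * cnj z ^ ?j + of_nat (\<tau> - ?i) * cnj e * z ^ (?i + 1) * cnj z ^ ?j
         - cnj e * of_nat ?j * z ^ ?i * cnj z ^ (?j - 1) + of_nat (\<tau> - ?j) * e * z ^ ?i * cnj z ^ (?j + 1)" for e
      proof -
        have "filterlim (\<lambda>n. complex_of_real (t n)) (at 0) sequentially"
          unfolding filterlim_at
        proof
          have "t \<longlonglongrightarrow> 0" unfolding t_def by (rule LIMSEQ_Suc[OF lim_1_over_n])
          then show "(\<lambda>n. complex_of_real (t n)) \<longlonglongrightarrow> 0"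
            using tendsto_of_real[of t 0] by simp
        qed (simp add: t0)
        from filterlim_compose[OF flow_deriv[of \<tau> ?i ?j e z, unfolded DERIV_def] this]
        show ?thesis by (simp add: q_def[abs_def])
      qed
      have "(\<lambda>n. (q 1 x n + \<i> * q \<i> x n) / 2 / ?D) \<longlonglongrightarrow>
         ((- 1 * of_nat ?i * z ^ (?i - 1) * cnj z ^ ?j + of_nat (\<tau> - ?i) * cnj 1 * z ^ (?i + 1) * cnj z ^ ?j
         - cnj 1 * of_nat ?j * z ^ ?i * cnj z ^ (?j - 1) + of_nat (\<tau> - ?j) * 1 * z ^ ?i * cnj z ^ (?j + 1)) +
         \<i> * (- \<i> * of_nat ?i * z ^ (?i - 1) * cnj z ^ ?j + of_nat (\<tau> - ?i) * cnj \<i> * z ^ (?i + 1) * cnj z ^ ?j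
         - cnj \<i> * of_nat ?j * z ^ ?i * cnj z ^ (?j - 1) + of_nat (\<tau> - ?j) * \<i> * z ^ ?i * cnj z ^ (?j + 1))) / 2 / ?D"
        using one_plus_norm_square_pos[of z] by (intro tendsto_intros ql) (simp_all del: of_real_add of_real_power)
      also have "\<i> * (- \<i> * of_nat ?i * z ^ (?i - 1) * cnj z ^ ?j + of_nat (\<tau> - ?i) * cnj \<i> * z ^ (?i + 1) * cnj z ^ ?j
         - cnj \<i> * of_nat ?j * z ^ ?i * cnj z ^ (?j - 1) + of_nat (\<tau> - ?j) * \<i> * z ^ ?i * cnj z ^ (?j + 1))
         = of_nat ?i * z ^ (?i - 1) * cnj z ^ ?j + of_nat (\<tau> - ?i) * z ^ (?i + 1) * cnj z ^ ?j
         - of_nat ?j * z ^ ?i * cnj z ^ (?j - 1) - of_nat (\<tau> - ?j) * z ^ ?i * cnj z ^ (?j + 1)"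
        by (simp add: algebra_simps)
      finally show "(\<lambda>n. (q 1 x n + \<i> * q \<i> x n) / 2 / ?D) \<longlonglongrightarrow>
         (of_nat (\<tau> - ?i) * z ^ (?i + 1) * cnj z ^ ?j - of_nat ?j * z ^ ?i * cnj z ^ (?j - 1)) / ?D"
        by (rule back_subst[where P="\<lambda>l. _ \<longlonglongrightarrow> l"]) (rule arg_cong[where f="\<lambda>u. u / ?D"], simp add: field_simps)
    qed
    ultimately show ?thesis by simp
  qed
  have "comb \<tau> (raise \<tau> c) \<in> fs.span B"
    by (rule span_pointwise_closed[OF finB _ _ lim cp1_continuous_comb]) (use B(1) VD(1) FV spanB in blast)+
  then show ?thesis by (simp only: spanB)
qed

subsection \<open>Highest weight vectors\<close>

text \<open>On a single weight, vanishing under \<open>raise\<close> is a two-term recursion along a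
  diagonal. For n < 0 it starts from zero and kills everything; for n \<ge> 0 it leaves one free
  constant and produces the binomials of \<open>hw_expand\<close>.\<close>

lemma raise_zero_imp_hw:
  assumes supp: "\<And>x. x \<in> {..\<tau>} \<times> {..\<tau>} \<Longrightarrow> c x \<noteq> 0 \<Longrightarrow> wt x = n"
    and zero: "\<And>x. x \<in> {..\<tau>} \<times> {..\<tau>} \<Longrightarrow> raise \<tau> c x = 0"
    and ne: "comb \<tau> c \<noteq> 0"
  obtains m k where "k \<noteq> 0" "comb \<tau> c = fscale k (hw m)"
proof (cases "n < 0")
  case True
  define m where "m = nat (- n)"
  have m: "m > 0" "n = - int m" using True by (simp_all add: m_def)
  have c0: "c (i, i + m) = 0" if "i + m \<le> \<tau>" for i
    using that
  proof (induction i)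
    case 0
    \<comment> \<open>With first index 0 the first summand of \<open>raise\<close> is absent, so the
      equation reads m c(0, m) = 0.\<close>
    then have "raise \<tau> c (0, m - 1) = 0" by (intro zero) auto
    moreover have "m - 1 < \<tau>" "m - 1 + 1 = m" using 0 m(1) by simp_all
    ultimately have "of_nat m * c (0, m) = 0" by (simp only: raise_def fst_conv snd_conv) simp
    then show ?case using m(1) by simp
  next
    case (Suc i)
    then have "of_nat (i + m + 1) * c (Suc i, i + m + 1) = 0"
      using zero[of "(Suc i, i + m)"] by (simp add: raise_def)
    then show ?case by (simp only: mult_eq_0_iff of_nat_eq_0_iff) simp
  qed
  have "comb \<tau> c = 0"
  proof (rule comb_eq_0)
    fix x assume x: "x \<in> {..\<tau>} \<times> {..\<tau>}"
    show "c x = 0"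
    proof (rule ccontr)
      assume "c x \<noteq> 0"
      then have "wt x = n" using supp x by blast
      then have "x = (fst x, fst x + m)" "fst x + m \<le> \<tau>"
        using x m(2) by (auto simp: wt_def prod_eq_iff)
      then show False using c0 \<open>c x \<noteq> 0\<close> by metis
    qed
  qed
  then show ?thesis using ne by blast
next
  case False
  define m where "m = nat n"
  have m: "n = int m" using False by (simp add: m_def)
  \<comment> \<open>The recursion is (j + 1) c(j + 1 + m, j + 1) = (\<tau> - m - j) c(j + m, j), the
    one satisfied by the binomials of \<tau> - m.\<close>
  have cj: "c (j + m, j) = of_nat ((\<tau> - m) choose j) * c (m, 0)" if "j + m \<le> \<tau>" for j
    using that
  proof (induction j)
    case (Suc j)
    have "raise \<tau> c (Suc j + m, j) = of_nat (\<tau> - m - j) * c (j + m, j) - of_nat (j + 1) * c (Suc j + m, Suc j)"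
    proof -
      have "\<tau> + 1 - (Suc j + m) = \<tau> - m - j" "j < \<tau>" using Suc.prems by simp_all
      then show ?thesis by (simp only: raise_def fst_conv snd_conv) simp
    qed
    moreover have "raise \<tau> c (Suc j + m, j) = 0"
      using Suc.prems by (intro zero) auto
    ultimately have "of_nat (j + 1) * c (Suc j + m, Suc j) = of_nat (\<tau> - m - j) * (of_nat ((\<tau> - m) choose j) * c (m, 0))"
      using Suc by simp
    also have "\<dots> = of_nat ((\<tau> - m - j) * ((\<tau> - m) choose j)) * c (m, 0)" by simp
    also have "(\<tau> - m - j) * ((\<tau> - m) choose j) = Suc j * ((\<tau> - m) choose Suc j)"
      by (simp only: binomial_absorption binomial_absorb_comp)
    finally have "of_nat (Suc j) * c (Suc j + m, Suc j) = of_nat (Suc j) * (of_nat ((\<tau> - m) choose Suc j) * c (m, 0))"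
      by (simp only: of_nat_mult mult.assoc Suc_eq_plus1)
    then show ?case by (simp del: of_nat_Suc)
  qed simp
  have Sq: "x = (snd x + m, snd x) \<and> snd x + m \<le> \<tau>" if "x \<in> {..\<tau>} \<times> {..\<tau>}" "c x \<noteq> 0" for x
    using that supp[OF that] m by (auto simp: wt_def prod_eq_iff)
  have m\<tau>: "m \<le> \<tau>"
  proof (rule ccontr)
    assume "\<not> m \<le> \<tau>"
    then have "comb \<tau> c = 0" using Sq by (intro comb_eq_0) fastforce
    then show False using ne by blast
  qed
  have eq: "comb \<tau> c = fscale (c (m, 0)) (hw m)"
  proof (rule cp1_continuous_eqI[OF cp1_continuous_comb])
    show "cp1_continuous (fscale (c (m, 0)) (hw m))" by auto
    fix z
    have "comb \<tau> c (Some z) = (\<Sum>x\<in>(\<lambda>j. (j + m, j)) ` {..\<tau> - m}. c x * sph \<tau> (fst x) (snd x) (Some z))"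
      unfolding comb_apply
    proof (rule sum.mono_neutral_right)
      show "\<forall>x\<in>{..\<tau>} \<times> {..\<tau>} - (\<lambda>j. (j + m, j)) ` {..\<tau> - m}. c x * sph \<tau> (fst x) (snd x) (Some z) = 0"
      proof
        fix x assume x: "x \<in> {..\<tau>} \<times> {..\<tau>} - (\<lambda>j. (j + m, j)) ` {..\<tau> - m}"
        have "c x = 0"
        proof (rule ccontr)
          assume "c x \<noteq> 0"
          then have "x = (snd x + m, snd x)" "snd x \<in> {..\<tau> - m}" using Sq[of x] x by auto
          then have "x \<in> (\<lambda>j. (j + m, j)) ` {..\<tau> - m}" by (rule image_eqI)
          then show False using x by blast
        qed
        then show "c x * sph \<tau> (fst x) (snd x) (Some z) = 0" by simp
      qed
    qed (use m\<tau> in auto)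
    also have "\<dots> = (\<Sum>j\<le>\<tau> - m. c (j + m, j) * sph \<tau> (j + m) j (Some z))"
      by (subst sum.reindex) (auto simp: inj_on_def)
    also have "\<dots> = c (m, 0) * (\<Sum>j\<le>\<tau> - m. of_nat ((\<tau> - m) choose j) * sph \<tau> (j + m) j (Some z))"
      unfolding sum_distrib_left using m\<tau> by (intro sum.cong refl) (simp add: cj)
    finally show "comb \<tau> c (Some z) = fscale (c (m, 0)) (hw m) (Some z)"
      by (simp add: hw_expand[OF m\<tau>])
  qed
  have "c (m, 0) \<noteq> 0"
  proof
    assume "c (m, 0) = 0"
    then have "comb \<tau> c = 0" unfolding eq by (simp only: fs.scale_zero_left)
    then show False using ne by blast
  qed
  then show ?thesis using eq that by blast
qed

text \<open>Among the finitely many weights of nonzero weight vectors in V the largest is taken.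
  Raising would increase it by one, so it annihilates the vector.\<close>

lemma invariant_subspace_contains_hw:
  assumes V: "su2_invariant_subspace V" and fin: "V \<subseteq> fs.span (sphs \<tau>)" and ne: "V \<noteq> {0}"
  obtains m where "hw m \<in> V"
proof -
  define A where "A = {n. \<exists>c. comb \<tau> c \<in> V \<and> comb \<tau> c \<noteq> 0 \<and> (\<forall>x\<in>{..\<tau>} \<times> {..\<tau>}. c x \<noteq> 0 \<longrightarrow> wt x = n)}"
  have exx: "\<exists>x\<in>{..\<tau>} \<times> {..\<tau>}. c x \<noteq> 0" if "comb \<tau> c \<noteq> 0" for c
  proof (rule ccontr)
    assume "\<not> ?thesis"
    then have "comb \<tau> c = 0" by (intro comb_eq_0) blast
    then show False using that by contradiction
  qed
  have wt_bound: "\<bar>wt x\<bar> \<le> int \<tau>" if "x \<in> {..\<tau>} \<times> {..\<tau>}" for x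
    using that by (auto simp: wt_def)
  have "A \<subseteq> {- int \<tau>..int \<tau>}"
  proof
    fix n assume "n \<in> A"
    then obtain c where "comb \<tau> c \<noteq> 0" "\<forall>x\<in>{..\<tau>} \<times> {..\<tau>}. c x \<noteq> 0 \<longrightarrow> wt x = n"
      unfolding A_def by blast
    then obtain x where "x \<in> {..\<tau>} \<times> {..\<tau>}" "wt x = n" using exx[of c] by blast
    then show "n \<in> {- int \<tau>..int \<tau>}" using wt_bound[of x] by auto
  qed
  then have finA: "finite A" by (rule finite_subset) simp
  have "0 \<in> V" by (rule fs.subspace_0[OF su2_invariant_subspaceD(2)[OF V]])
  then obtain f where f: "f \<in> V" "f \<noteq> 0" using ne by blast
  obtain c where c: "f = comb \<tau> c" by (rule span_sphs_comb[OF subsetD[OF fin f(1)]])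
  obtain x where x: "x \<in> {..\<tau>} \<times> {..\<tau>}" "c x \<noteq> 0" using exx[of c] f(2) c by blast
  let ?c = "\<lambda>y. if wt y = wt x then c y else 0"
  have "comb \<tau> ?c \<in> V"
    by (rule weight_component_mem[OF V]) (use c f(1) wt_bound x(1) in auto)
  moreover have "comb \<tau> ?c \<noteq> 0"
    using comb_eq_0_imp[of \<tau> ?c x] x by auto
  ultimately have "wt x \<in> A" unfolding A_def by (intro CollectI exI[of _ ?c]) auto
  then have neA: "A \<noteq> {}" by blast
  define n where "n = Max A"
  have "n \<in> A" unfolding n_def using finA neA by (rule Max_in)
  then obtain d where d: "comb \<tau> d \<in> V" "comb \<tau> d \<noteq> 0" "\<And>x. x \<in> {..\<tau>} \<times> {..\<tau>} \<Longrightarrow> d x \<noteq> 0 \<Longrightarrow> wt x = n"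
    unfolding A_def by blast
  have wt_raise: "wt x = n + 1" if x: "x \<in> {..\<tau>} \<times> {..\<tau>}" and r: "raise \<tau> d x \<noteq> 0" for x
  proof -
    have "(fst x \<noteq> 0 \<and> d (fst x - 1, snd x) \<noteq> 0) \<or> (snd x < \<tau> \<and> d (fst x, snd x + 1) \<noteq> 0)"
      using r by (auto simp: raise_def split: if_splits)
    then show ?thesis
    proof (elim disjE conjE)
      assume h: "fst x \<noteq> 0" "d (fst x - 1, snd x) \<noteq> 0"
      have "(fst x - 1, snd x) \<in> {..\<tau>} \<times> {..\<tau>}" using x by auto
      then have "wt (fst x - 1, snd x) = n" using h(2) by (rule d(3))
      then show ?thesis using h(1) by (simp add: wt_def of_nat_diff)
    next
      assume h: "snd x < \<tau>" "d (fst x, snd x + 1) \<noteq> 0"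
      have "(fst x, snd x + 1) \<in> {..\<tau>} \<times> {..\<tau>}" using x h(1) by auto
      then have "wt (fst x, snd x + 1) = n" using h(2) by (rule d(3))
      then show ?thesis by (simp add: wt_def)
    qed
  qed
  have "comb \<tau> (raise \<tau> d) = 0"
  proof (rule ccontr)
    assume "comb \<tau> (raise \<tau> d) \<noteq> 0"
    then have "n + 1 \<in> A"
      unfolding A_def using raise_mem[OF V fin d(1)] wt_raise by blast
    then have "n + 1 \<le> n" unfolding n_def using finA by (rule Max_ge[rotated])
    then show False by simp
  qed
  then have rz: "raise \<tau> d x = 0" if "x \<in> {..\<tau>} \<times> {..\<tau>}" for x
    using that by (rule comb_eq_0_imp)
  obtain m k where mk: "k \<noteq> 0" "comb \<tau> d = fscale k (hw m)"
    using d(3) rz d(2) by (rule raise_zero_imp_hw)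
  have "fscale (1 / k) (comb \<tau> d) \<in> V"
    by (rule fs.subspace_scale[OF su2_invariant_subspaceD(2)[OF V] d(1)])
  moreover have "fscale (1 / k) (comb \<tau> d) = hw m"
    unfolding mk(2) fs.scale_scale using mk(1) by (simp only: divide_self_if times_divide_eq_left mult_1_left fs.scale_one if_False)
  ultimately show ?thesis using that by metis
qed

subsection \<open>The irreducible spaces\<close>

lemma Bz_sum:
  assumes "\<And>b. b \<in> B \<Longrightarrow> cp1_continuous b"
  shows "Bz \<tau> (\<Sum>b\<in>B. fscale (g b) b) = (\<Sum>b\<in>B. fscale (g b) (Bz \<tau> b))"
  using assms
proof (induction B rule: infinite_finite_induct)
  case (insert b B)
  have "cp1_continuous (\<Sum>b\<in>B. fscale (g b) b)"
    using fs.subspace_sum[OF subspace_cp1_continuous, of B "\<lambda>b. fscale (g b) b"] insert.prems by auto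
  then have "Bz \<tau> (fscale (g b) b + (\<Sum>b\<in>B. fscale (g b) b)) = Bz \<tau> (fscale (g b) b) + Bz \<tau> (\<Sum>b\<in>B. fscale (g b) b)"
    using insert.prems by (intro Bz_add cp1_continuous_fscale) auto
  also have "Bz \<tau> (\<Sum>b\<in>B. fscale (g b) b) = (\<Sum>b\<in>B. fscale (g b) (Bz \<tau> b))"
    using insert.IH insert.prems by blast
  finally show ?case
    unfolding sum.insert[OF insert.hyps] Bz_fscale .
qed (simp_all only: sum.infinite sum.empty Bz_zero not_False_eq_True)

lemma su2_act_linear:
  "su2_act a b (f + g) = su2_act a b f + su2_act a b g" "su2_act a b (fscale c f) = fscale c (su2_act a b f)"
  "su2_act a b 0 = 0"
  by (simp_all add: su2_act_def fun_eq_iff)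

text \<open>The tool for Schur-type arguments: \<open>W = {0}\<close> gives the kernel of the
  transform on V, \<open>W = irr j\<close> the part of V that it maps into
  \<open>irr j\<close>.\<close>

lemma su2_invariant_subspace_Bz_vimage:
  assumes V: "su2_invariant_subspace V" and W: "su2_invariant_subspace W"
  shows "su2_invariant_subspace {f \<in> V. Bz \<tau> f \<in> W}"
proof -
  note VD = su2_invariant_subspaceD[OF V] and WD = su2_invariant_subspaceD[OF W]
  have "fs.subspace {f \<in> V. Bz \<tau> f \<in> W}"
  proof (rule fs.subspaceI)
    show "0 \<in> {f \<in> V. Bz \<tau> f \<in> W}"
      using fs.subspace_0[OF VD(2)] fs.subspace_0[OF WD(2)] by (simp only: mem_Collect_eq Bz_zero simp_thms)
  next
    fix f g assume "f \<in> {f \<in> V. Bz \<tau> f \<in> W}" "g \<in> {f \<in> V. Bz \<tau> f \<in> W}"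
    then show "f + g \<in> {f \<in> V. Bz \<tau> f \<in> W}"
      using fs.subspace_add[OF VD(2), of f g] fs.subspace_add[OF WD(2), of "Bz \<tau> f" "Bz \<tau> g"] Bz_add[of f g \<tau>] VD(1)
      by (simp only: mem_Collect_eq simp_thms)
  next
    fix c f assume "f \<in> {f \<in> V. Bz \<tau> f \<in> W}"
    then show "fscale c f \<in> {f \<in> V. Bz \<tau> f \<in> W}"
      using fs.subspace_scale[OF VD(2), of f c] fs.subspace_scale[OF WD(2), of "Bz \<tau> f" c]
      by (simp only: mem_Collect_eq Bz_fscale simp_thms)
  qed
  moreover have "su2_act a b f \<in> {f \<in> V. Bz \<tau> f \<in> W}"
    if "(cmod a)\<^sup>2 + (cmod b)\<^sup>2 = 1" "f \<in> {f \<in> V. Bz \<tau> f \<in> W}" for a b f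
    using that VD(1,3) WD(3) by (simp only: mem_Collect_eq Bz_su2_act simp_thms)
  ultimately show ?thesis
    using VD(1) unfolding su2_invariant_subspace_def by blast
qed

lemma su2_invariant_subspace_Bz_image:
  assumes V: "su2_invariant_subspace V"
  shows "su2_invariant_subspace (Bz \<tau> ` V)"
proof -
  note VD = su2_invariant_subspaceD[OF V]
  have "fs.subspace (Bz \<tau> ` V)"
  proof (rule fs.subspaceI)
    show "0 \<in> Bz \<tau> ` V"
      using Bz_zero[of \<tau>] fs.subspace_0[OF VD(2)] by (metis image_eqI)
  next
    fix f g assume "f \<in> Bz \<tau> ` V" "g \<in> Bz \<tau> ` V"
    then obtain f' g' where "f = Bz \<tau> f'" "g = Bz \<tau> g'" "f' \<in> V" "g' \<in> V" by blast
    then show "f + g \<in> Bz \<tau> ` V"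
      using Bz_add[of f' g' \<tau>] VD(1) fs.subspace_add[OF VD(2), of f' g'] by (metis image_eqI)
  next
    fix c f assume "f \<in> Bz \<tau> ` V"
    then obtain f' where f': "f = Bz \<tau> f'" "f' \<in> V" by blast
    show "fscale c f \<in> Bz \<tau> ` V"
      unfolding f'(1) Bz_fscale[symmetric] by (intro imageI fs.subspace_scale[OF VD(2)] f'(2))
  qed
  moreover have "su2_act a b f \<in> Bz \<tau> ` V" if ab: "(cmod a)\<^sup>2 + (cmod b)\<^sup>2 = 1" and "f \<in> Bz \<tau> ` V" for a b f
  proof -
    obtain f' where f': "f = Bz \<tau> f'" "f' \<in> V" using \<open>f \<in> Bz \<tau> ` V\<close> by blast
    show ?thesis
      unfolding f'(1) Bz_su2_act[OF VD(1)[OF f'(2)] ab, symmetric] by (intro imageI VD(3) ab f'(2))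
  qed
  ultimately show ?thesis
    using VD(1) cp1_continuous_Bz unfolding su2_invariant_subspace_def by blast
qed

lemma su2_invariant_subspace_continuous: "su2_invariant_subspace {f. cp1_continuous f}"
  unfolding su2_invariant_subspace_def using subspace_cp1_continuous cp1_continuous_su2_act by blast

section \<open>The invariant subspace generated by a highest weight vector\<close>

definition irr :: "nat \<Rightarrow> (complex option \<Rightarrow> complex) set" where
  "irr m = \<Inter> {V. su2_invariant_subspace V \<and> hw m \<in> V}"

lemma hw_in_irr: "hw m \<in> irr m"
  by (simp add: irr_def)

lemma irr_least: "su2_invariant_subspace V \<Longrightarrow> hw m \<in> V \<Longrightarrow> irr m \<subseteq> V"
  by (auto simp: irr_def)

lemma su2_invariant_subspace_irr: "su2_invariant_subspace (irr m)"
proof -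
  have "fs.subspace (irr m)"
    unfolding irr_def by (rule fs.subspace_Inter) (auto dest: su2_invariant_subspaceD(2))
  moreover have "irr m \<subseteq> {f. cp1_continuous f}"
    by (rule irr_least[OF su2_invariant_subspace_continuous]) auto
  moreover have "su2_act a b f \<in> irr m" if "(cmod a)\<^sup>2 + (cmod b)\<^sup>2 = 1" "f \<in> irr m" for a b f
    using that su2_invariant_subspaceD(3) unfolding irr_def by blast
  ultimately show ?thesis unfolding su2_invariant_subspace_def by blast
qed

lemma hw_nonzero: "hw m \<noteq> 0"
proof
  assume "hw m = 0"
  then have "hw m (Some 1) = 0" by simp
  then show False by (simp add: hw_def sph_Some)
qed

lemma irr_nonzero: "irr m \<noteq> {0}"
  using hw_in_irr hw_nonzero by blast

text \<open>The continuous eigenfunctions for this eigenvalue form an invariant subspace containing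
  \<open>hw m\<close>.\<close>

lemma Bz_irr:
  assumes "f \<in> irr m"
  shows "Bz \<tau> f = fscale (complex_of_real (lam \<tau> m)) f"
proof -
  let ?W = "{f. cp1_continuous f \<and> Bz \<tau> f = fscale (complex_of_real (lam \<tau> m)) f}"
  have "fs.subspace ?W"
  proof (rule fs.subspaceI)
    show "0 \<in> ?W" by (simp only: mem_Collect_eq Bz_zero fs.scale_zero_right cp1_continuous_zero simp_thms)
  next
    fix f g assume "f \<in> ?W" "g \<in> ?W"
    then show "f + g \<in> ?W"
      by (simp only: mem_Collect_eq cp1_continuous_add' Bz_add fs.scale_right_distrib simp_thms)
  next
    fix c f assume "f \<in> ?W"
    then show "fscale c f \<in> ?W"
      by (simp only: mem_Collect_eq cp1_continuous_fscale Bz_fscale fs.scale_left_commute simp_thms)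
  qed
  moreover have "su2_act a b f \<in> ?W" if "(cmod a)\<^sup>2 + (cmod b)\<^sup>2 = 1" "f \<in> ?W" for a b f
    using that by (simp only: mem_Collect_eq cp1_continuous_su2_act Bz_su2_act su2_act_linear simp_thms)
  ultimately have "su2_invariant_subspace ?W"
    unfolding su2_invariant_subspace_def by blast
  then have "irr m \<subseteq> ?W"
    by (rule irr_least) (simp only: mem_Collect_eq cp1_continuous_hw Bz_hw simp_thms)
  then show ?thesis using assms by blast
qed

text \<open>Since \<open>lam m m\<close> is nonzero, every element is a multiple of its own
  transform and hence a polynomial of degree m.\<close>

lemma irr_subset_span: "irr m \<subseteq> fs.span (sphs m)"
proof
  fix f assume f: "f \<in> irr m"
  have l: "complex_of_real (lam m m) \<noteq> 0" by (simp add: lam_eq_0_iff)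
  have "f = fscale (1 / complex_of_real (lam m m)) (Bz m f)"
    unfolding Bz_irr[OF f] fs.scale_scale using l by (simp only: divide_self_if times_divide_eq_left mult_1_left fs.scale_one if_False)
  moreover have "\<dots> \<in> fs.span (sphs m)"
    using f su2_invariant_subspaceD(1)[OF su2_invariant_subspace_irr] by (intro fs.span_scale Bz_in_span) blast
  ultimately show "f \<in> fs.span (sphs m)" by metis
qed

text \<open>The eigenvalues for all \<tau> would coincide, but their zero sets \<tau> < j and \<tau>
  < m determine j and m.\<close>

lemma irr_contains_hw_imp_eq:
  assumes "hw j \<in> irr m"
  shows "j = m"
proof -
  have "hw j (Some 1) \<noteq> 0" by (simp add: hw_def sph_Some)
  moreover have "fscale (complex_of_real (lam \<tau> j)) (hw j) (Some 1) = fscale (complex_of_real (lam \<tau> m)) (hw j) (Some 1)" for \<tau>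
    using Bz_irr[OF assms, of \<tau>] Bz_hw[of \<tau> j] by metis
  ultimately have "lam \<tau> j = lam \<tau> m" for \<tau> by simp
  then have "\<tau> < j \<longleftrightarrow> \<tau> < m" for \<tau> by (metis lam_eq_0_iff)
  then show ?thesis by (meson linorder_neqE_nat less_irrefl)
qed

lemma su2_irreducible_irr: "su2_irreducible (irr m)"
  unfolding su2_irreducible_def
proof (intro conjI allI impI su2_invariant_subspace_irr irr_nonzero)
  fix W assume W: "su2_invariant_subspace W \<and> W \<subseteq> irr m"
  show "W = {0} \<or> W = irr m"
  proof (cases "W = {0}")
    case False
    obtain j where j: "hw j \<in> W"
      using invariant_subspace_contains_hw[of W m] W False irr_subset_span[of m] by blast
    then have "j = m" using W irr_contains_hw_imp_eq by blast
    then show ?thesis using irr_least[of W m] W j by blast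
  qed blast
qed

section \<open>Injectivity of the transform in its own degree\<close>

text \<open>Positivity: the inner product of f with its transform is a sum of |I i j|^2 with
  positive binomial weights. If it is 0, then f is orthogonal to all monomials of degree \<tau>,
  hence to itself.\<close>

lemma Bz_injective_on_span:
  assumes f: "f \<in> fs.span (sphs \<tau>)" and zero: "Bz \<tau> f = 0"
  shows "f = 0"
proof -
  obtain c where c: "f = comb \<tau> c" by (rule span_sphs_comb[OF f])
  have cont: "cp1_continuous f" unfolding c by (rule cp1_continuous_comb)
  define I where "I i j = (\<integral>s. sph \<tau> j i (Some s) * f (Some s) \<partial>iota)" for i j
  have cnjI: "(\<integral>s. cnj (f (Some s)) * sph \<tau> i j (Some s) \<partial>iota) = cnj (I i j)" for i j
  proof -
    have "(\<integral>s. cnj (f (Some s)) * sph \<tau> i j (Some s) \<partial>iota) = (\<integral>s. cnj (sph \<tau> j i (Some s) * f (Some s)) \<partial>iota)"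
      by (simp only: complex_cnj_mult cnj_sph mult.commute)
    then show ?thesis by (simp only: I_def Bochner_Integration.integral_cnj)
  qed
  have "0 = (\<integral>s. cnj (f (Some s)) * Bz \<tau> f (Some s) \<partial>iota)"
    by (simp add: zero)
  also have "\<dots> = (\<integral>s. (\<Sum>i\<le>\<tau>. \<Sum>j\<le>\<tau>. (of_nat (\<tau> choose i) * of_nat (\<tau> choose j) * I i j) * (cnj (f (Some s)) * sph \<tau> i j (Some s))) \<partial>iota)"
    unfolding Bz_expand[OF cont] I_def[symmetric] by (simp add: sum_distrib_left mult_ac)
  also have "\<dots> = (\<Sum>i\<le>\<tau>. \<Sum>j\<le>\<tau>. (of_nat (\<tau> choose i) * of_nat (\<tau> choose j) * I i j) * cnj (I i j))"
    unfolding cnjI[symmetric]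
    by (rule integral_iota_sum2[where g="\<lambda>i j p. cnj (f p) * sph \<tau> i j p"])
       (intro cp1_continuous_mult cp1_continuous_cnj cont cp1_continuous_sph, auto)
  also have "\<dots> = complex_of_real (\<Sum>i\<le>\<tau>. \<Sum>j\<le>\<tau>. real (\<tau> choose i) * real (\<tau> choose j) * (cmod (I i j))\<^sup>2)"
    unfolding of_real_sum by (intro sum.cong refl) (simp only: of_real_mult complex_norm_square of_real_of_nat_eq mult.assoc)
  finally have "complex_of_real (\<Sum>i\<le>\<tau>. \<Sum>j\<le>\<tau>. real (\<tau> choose i) * real (\<tau> choose j) * (cmod (I i j))\<^sup>2) = 0"
    by (rule sym)
  then have "(\<Sum>i\<le>\<tau>. \<Sum>j\<le>\<tau>. real (\<tau> choose i) * real (\<tau> choose j) * (cmod (I i j))\<^sup>2) = 0"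
    by (simp only: of_real_eq_0_iff)
  then have 0: "\<forall>i\<in>{..\<tau>}. (\<Sum>j\<le>\<tau>. real (\<tau> choose i) * real (\<tau> choose j) * (cmod (I i j))\<^sup>2) = 0"
    by (subst (asm) sum_nonneg_eq_0_iff) (auto intro!: sum_nonneg)
  have I0: "I i j = 0" if "i \<le> \<tau>" "j \<le> \<tau>" for i j
  proof -
    have "(\<Sum>j\<le>\<tau>. real (\<tau> choose i) * real (\<tau> choose j) * (cmod (I i j))\<^sup>2) = 0"
      using 0 that by blast
    then have "\<forall>j\<in>{..\<tau>}. real (\<tau> choose i) * real (\<tau> choose j) * (cmod (I i j))\<^sup>2 = 0"
      by (subst (asm) sum_nonneg_eq_0_iff) auto
    then have "real (\<tau> choose i) * real (\<tau> choose j) * (cmod (I i j))\<^sup>2 = 0"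
      using that by blast
    then show ?thesis using that by simp
  qed
  have "(\<integral>s. cnj (f (Some s)) * f (Some s) \<partial>iota) = (\<integral>s. (\<Sum>i\<le>\<tau>. \<Sum>j\<le>\<tau>. cnj (c (i, j)) * (sph \<tau> j i (Some s) * f (Some s))) \<partial>iota)"
  proof -
    have "cnj (f p) = (\<Sum>i\<le>\<tau>. \<Sum>j\<le>\<tau>. cnj (c (i, j)) * sph \<tau> j i p)" for p
      unfolding c comb_apply by (simp add: sum.cartesian_product case_prod_beta cnj_sph)
    then show ?thesis by (simp only: sum_distrib_right mult.assoc)
  qed
  also have "\<dots> = (\<Sum>i\<le>\<tau>. \<Sum>j\<le>\<tau>. cnj (c (i, j)) * I i j)"
    unfolding I_def
    by (rule integral_iota_sum2[where g="\<lambda>i j p. sph \<tau> j i p * f p"])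
       (intro cp1_continuous_mult cont cp1_continuous_sph, auto)
  also have "\<dots> = 0" by (intro sum.neutral ballI) (simp add: I0)
  finally have "(\<integral>s. complex_of_real ((cmod (f (Some s)))\<^sup>2) \<partial>iota) = 0"
    by (simp only: complex_norm_square mult.commute)
  then have "(\<integral>s. (cmod (f (Some s)))\<^sup>2 \<partial>iota) = 0"
    by (simp only: integral_complex_of_real of_real_eq_0_iff)
  moreover have "integrable iota (\<lambda>s. (cmod (f (Some s)))\<^sup>2)"
  proof -
    have "integrable iota (\<lambda>s. f (Some s) * cnj (f (Some s)))"
      by (rule integrable_cp1_continuous[where f="\<lambda>p. f p * cnj (f p)"]) (intro cp1_continuous_mult cp1_continuous_cnj cont)
    then show ?thesis
      unfolding complex_norm_square[symmetric] complex_of_real_integrable_eq .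
  qed
  ultimately have "AE s in iota. (cmod (f (Some s)))\<^sup>2 = 0"
    by (subst (asm) integral_nonneg_eq_0_iff_AE) auto
  then have ae: "AE s in iota. f (Some s) = 0" by simp
  \<comment> \<open>From almost everywhere to everywhere: all transforms of f vanish, while
    (\<sigma> + 1) times the transform tends to f at each point.\<close>
  have Bz0: "Bz \<sigma> f p = 0" for \<sigma> p
    unfolding Bz_def by (rule integral_eq_zero_AE) (use ae in \<open>eventually_elim, simp\<close>)
  have "f (Some z) = 0" for z
    using Bz_approx_identity[OF cont, of z] unfolding Bz0 by (simp add: LIMSEQ_const_iff)
  then show ?thesis by (intro cp1_continuous_eqI[OF cont cp1_continuous_zero]) simp
qed

section \<open>The dimension of the generated space\<close>

lemma finite_dim_basis:
  assumes "fs.subspace V" "V \<subseteq> fs.span S" "finite S"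
  obtains B where "finite B" "B \<subseteq> V" "fs.independent B" "fs.span B = V" "card B = fs.dim V"
proof -
  obtain B where B: "B \<subseteq> V" "fs.independent B" "V \<subseteq> fs.span B" "card B = fs.dim V"
    by (rule fs.basis_exists[of V])
  have "finite B"
    using fs.independent_span_bound[OF assms(3) B(2)] B(1) assms(2) by blast
  moreover have "fs.span B = V"
    using fs.span_minimal[OF B(1) assms(1)] B(3) by blast
  ultimately show ?thesis using that B by blast
qed

lemma independent_union:
  assumes "finite B" "fs.independent B" "fs.independent A" "fs.span B \<inter> fs.span A \<subseteq> {0}"
  shows "fs.independent (B \<union> A)"
  using assms
proof (induction B rule: finite_induct)
  case (insert b B)
  have indB: "fs.independent B" and nb: "b \<notin> fs.span B"
    using insert.prems(1) insert.hyps(2) fs.independent_insert by metis+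
  have sub: "fs.span B \<subseteq> fs.span (insert b B)" by (rule fs.span_mono) blast
  then have "fs.span B \<inter> fs.span A \<subseteq> {0}" using insert.prems(3) by blast
  then have ind: "fs.independent (B \<union> A)" using insert.IH indB insert.prems(2) by blast
  have "b \<notin> fs.span (B \<union> A)"
  proof
    assume "b \<in> fs.span (B \<union> A)"
    then obtain u v where uv: "b = u + v" "u \<in> fs.span B" "v \<in> fs.span A"
      unfolding fs.span_Un by blast
    have "b \<in> fs.span (insert b B)" by (rule fs.span_base) blast
    then have "b - u \<in> fs.span (insert b B)" using uv(2) sub by (blast intro: fs.span_diff)
    moreover have "b - u = v" unfolding uv(1) by (rule add_diff_cancel_left')
    ultimately have "v = 0" using uv(3) insert.prems(3) by blast
    then have "b = u" unfolding uv(1) by (simp only: add_0_right)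
    then show False using nb uv(2) by blast
  qed
  then show ?case using ind fs.independent_insertI by (metis Un_insert_left)
qed (simp only: Un_empty_left not_False_eq_True)

text \<open>W embeds into the quotient of span (S \<union> C) by span S, which is generated by C. In
  terms of bases, one of W and one of span S stay independent together, by trivial
  intersection.\<close>

lemma dim_le_card_complement:
  assumes W: "fs.subspace W" "W \<inter> fs.span S \<subseteq> {0}" "W \<subseteq> fs.span (S \<union> C)" "finite S" "finite C"
  shows "fs.dim W \<le> card C"
proof -
  obtain A where A: "A \<subseteq> S" "fs.independent A" "S \<subseteq> fs.span A"
    by (rule fs.basis_exists[of S])
  have finA: "finite A" using A(1) W(4) by (rule finite_subset)
  have spA: "fs.span A \<subseteq> fs.span S" using A(1) by (rule fs.span_mono)
  obtain B where B: "finite B" "B \<subseteq> W" "fs.independent B" "fs.span B = W" "card B = fs.dim W"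
    by (rule finite_dim_basis[OF W(1,3) finite_UnI[OF W(4,5)]])
  have ind: "fs.independent (B \<union> A)"
    using independent_union[OF B(1,3) A(2)] W(2) spA B(4) by blast
  have "S \<union> C \<subseteq> fs.span (A \<union> C)"
    using A(3) fs.span_mono[of A "A \<union> C"] fs.span_superset[of "A \<union> C"] by blast
  then have sub: "fs.span (S \<union> C) \<subseteq> fs.span (A \<union> C)"
    by (rule fs.span_minimal[OF _ fs.subspace_span])
  have "B \<union> A \<subseteq> fs.span (A \<union> C)"
    using B(2) W(3) sub fs.span_superset[of "A \<union> C"] by blast
  then have "card (B \<union> A) \<le> card (A \<union> C)"
    using fs.independent_span_bound[OF _ ind] finA W(5) by blast
  moreover have "card (A \<union> C) \<le> card A + card C" by (rule card_Un_le)
  moreover have "B \<inter> A = {}"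
  proof (rule ccontr)
    assume "B \<inter> A \<noteq> {}"
    then obtain x where x: "x \<in> B" "x \<in> A" by blast
    then have "x = 0" using W(2) B(2) fs.span_superset[of A] spA by blast
    then show False using x(1) B(3) fs.dependent_zero by blast
  qed
  then have "card (B \<union> A) = card B + card A"
    using B(1) finA by (simp only: card_Un_disjoint)
  ultimately show ?thesis using B(5) by linarith
qed

lemma sph_lower_degree:
  assumes "i \<le> m" "j \<le> m"
  shows "sph m i j = sph (Suc m) i j + sph (Suc m) (Suc i) (Suc j)"
proof (rule cp1_continuous_eqI)
  fix z
  have "complex_of_real (1 + (cmod z)\<^sup>2) \<noteq> 0"
    using one_plus_norm_square_pos[of z] by (metis of_real_eq_0_iff less_irrefl)
  moreover have "complex_of_real (1 + (cmod z)\<^sup>2) = 1 + z * cnj z"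
    by (simp only: of_real_add complex_norm_square of_real_1)
  moreover have "z ^ i * cnj z ^ j + z ^ Suc i * cnj z ^ Suc j = z ^ i * cnj z ^ j * (1 + z * cnj z)"
    by (simp add: algebra_simps)
  ultimately show "sph m i j (Some z) = (sph (Suc m) i j + sph (Suc m) (Suc i) (Suc j)) (Some z)"
    by (simp only: plus_fun_apply sph_Some of_real_power add_divide_distrib[symmetric]) simp
qed (use assms in \<open>auto intro!: cp1_continuous_add'\<close>)

text \<open>\<open>C m\<close> consists of the 2m + 1 index pairs with an exponent equal to m. Every
  other monomial of the higher degree is a lower-degree monomial minus the one with both exponents
  raised, whence the descending induction on i.\<close>

lemma sphs_Suc_span:
  defines "C \<equiv> \<lambda>m. (\<lambda>j. sph m m j) ` {..m} \<union> (\<lambda>i. sph m i m) ` {..<m}"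
  shows "sphs (Suc m) \<subseteq> fs.span (sphs m \<union> C (Suc m))"
proof -
  let ?S = "fs.span (sphs m \<union> C (Suc m))"
  have C: "sph (Suc m) i j \<in> ?S" if "i \<le> Suc m" "j \<le> Suc m" "i = Suc m \<or> j = Suc m" for i j
    by (rule fs.span_base) (use that in \<open>auto simp: C_def less_Suc_eq_le le_Suc_eq\<close>)
  have "\<forall>j\<le>Suc m. sph (Suc m) i j \<in> ?S" if "i \<le> Suc m" for i
    using that
  proof (induction rule: inc_induct)
    case base
    then show ?case using C by blast
  next
    case (step i)
    show ?case
    proof (intro allI impI)
      fix j assume j: "j \<le> Suc m"
      show "sph (Suc m) i j \<in> ?S"
      proof (cases "j = Suc m")
        case True then show ?thesis using C[of i j] step.hyps by simp
      next
        case False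
        then have ij: "i \<le> m" "j \<le> m" using j step.hyps by auto
        have "sph m i j \<in> ?S" by (rule fs.span_base) (use sph_in_sphs[OF ij] in blast)
        moreover have "sph (Suc m) (Suc i) (Suc j) \<in> ?S" using step.IH Suc_le_mono[of j m] ij(2) by blast
        ultimately have "sph m i j - sph (Suc m) (Suc i) (Suc j) \<in> ?S" by (rule fs.span_diff)
        then show ?thesis unfolding sph_lower_degree[OF ij] by (simp only: add_diff_cancel_right')
      qed
    qed
  qed
  then show ?thesis by (auto simp: sphs_def)
qed

text \<open>The space lies in degree m and meets degree m - 1 trivially: there
  \<open>Bz (m - 1)\<close> is injective, while on \<open>irr m\<close> it is 0. Only the 2m + 1
  added monomials count.\<close>

lemma dim_irr_le: "fs.dim (irr m) \<le> 2 * m + 1"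
proof (cases m)
  case 0
  have "irr m \<inter> fs.span {} \<subseteq> {0}" by (simp only: fs.span_empty) blast
  moreover have "irr m \<subseteq> fs.span ({} \<union> sphs m)" using irr_subset_span[of m] by (simp only: Un_empty_left)
  ultimately have "fs.dim (irr m) \<le> card (sphs m)"
    by (intro dim_le_card_complement[where S="{}"] su2_invariant_subspaceD(2)[OF su2_invariant_subspace_irr]) auto
  also have "\<dots> \<le> card ({..m} \<times> {..m})" unfolding sphs_def by (rule card_image_le) simp
  finally show ?thesis using 0 by simp
next
  case (Suc n)
  let ?C = "(\<lambda>j. sph m m j) ` {..m} \<union> (\<lambda>i. sph m i m) ` {..<m}"
  have "fs.dim (irr m) \<le> card ?C"
  proof (rule dim_le_card_complement[where S="sphs n"])
    show "fs.subspace (irr m)" by (rule su2_invariant_subspaceD(2)[OF su2_invariant_subspace_irr])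
    show "irr m \<inter> fs.span (sphs n) \<subseteq> {0}"
    proof
      fix f assume f: "f \<in> irr m \<inter> fs.span (sphs n)"
      have "lam n m = 0" using Suc by (simp add: lam_eq_0_iff)
      then have "Bz n f = 0" using Bz_irr[of f m n] f by (simp only: IntD1 of_real_0 fs.scale_zero_left)
      then show "f \<in> {0}" using Bz_injective_on_span[of f n] f by blast
    qed
    show "irr m \<subseteq> fs.span (sphs n \<union> ?C)"
      using irr_subset_span[of m] fs.span_minimal[OF sphs_Suc_span fs.subspace_span, of n] Suc by blast
  qed auto
  also have "\<dots> \<le> card ((\<lambda>j. sph m m j) ` {..m}) + card ((\<lambda>i. sph m i m) ` {..<m})" by (rule card_Un_le)
  also have "\<dots> \<le> card {..m} + card {..<m}" by (intro add_mono card_image_le) auto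
  finally show ?thesis by simp
qed

text \<open>The translate of \<open>hw m\<close> by the element with a = b = 1 / sqrt 2 is (z - 1)^m
  (cnj z + 1)^m / (1 + |z|^2)^m up to the factor 2^m. What matters is that all its coefficients are
  nonzero, so every weight occurs.\<close>

lemma binomial_comb_in_irr: "comb m (\<lambda>x. of_nat (m choose fst x) * (-1) ^ (m - fst x) * of_nat (m choose snd x)) \<in> irr m"
proof -
  define r where "r = complex_of_real (1 / sqrt 2)"
  have r2: "r * r = 1 / 2"
    unfolding r_def by (simp flip: of_real_mult)
  have ab: "(cmod r)\<^sup>2 + (cmod r)\<^sup>2 = 1" by (simp add: r_def norm_divide power_divide)
  have cr: "cnj r = r" by (simp add: r_def)
  let ?c = "\<lambda>x. of_nat (m choose fst x) * (-1) ^ (m - fst x) * of_nat (m choose snd x) :: complex"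
  have "comb m ?c = fscale (2 ^ m) (su2_act r r (hw m))"
  proof (rule cp1_continuous_eqI[OF cp1_continuous_comb])
    show "cp1_continuous (fscale (2 ^ m) (su2_act r r (hw m)))"
      by (intro cp1_continuous_fscale cp1_continuous_su2_act cp1_continuous_hw ab)
    fix z
    let ?D = "complex_of_real ((1 + (cmod z)\<^sup>2) ^ m)"
    have "su2_act r r (hw m) (Some z) = (r * z - r) ^ m * cnj ((r * z + r) ^ m) / ?D"
      unfolding hw_def by (subst su2_act_sph_Some[OF _ _ ab]) (simp_all add: cr)
    also have "(r * z - r) ^ m * cnj ((r * z + r) ^ m) = ((r * r) * ((z + - 1) * (cnj z + 1))) ^ m"
      by (simp add: cr algebra_simps flip: power_mult_distrib)
    finally have "2 ^ m * su2_act r r (hw m) (Some z) = (z + - 1) ^ m * (cnj z + 1) ^ m / ?D"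
      unfolding r2 by (simp add: power_mult_distrib power_divide)
    also have "\<dots> = (\<Sum>i\<le>m. \<Sum>j\<le>m. (of_nat (m choose i) * z ^ i * (- 1) ^ (m - i)) * (of_nat (m choose j) * cnj z ^ j * 1 ^ (m - j)) / ?D)"
      unfolding binomial_ring sum_product sum_divide_distrib ..
    also have "\<dots> = comb m ?c (Some z)"
      unfolding comb_apply sum.cartesian_product
      by (intro sum.cong refl) (auto simp: sph_Some)
    finally show "comb m ?c (Some z) = fscale (2 ^ m) (su2_act r r (hw m)) (Some z)" by simp
  qed
  moreover have "fscale (2 ^ m) (su2_act r r (hw m)) \<in> irr m"
    by (intro fs.subspace_scale su2_invariant_subspaceD(2,3)[OF su2_invariant_subspace_irr] hw_in_irr ab)
  ultimately show ?thesis by (simp only:)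
qed

lemma dim_irr_ge: "2 * m + 1 \<le> fs.dim (irr m)"
proof -
  define c :: "nat \<times> nat \<Rightarrow> complex" where "c = (\<lambda>x. of_nat (m choose fst x) * (-1) ^ (m - fst x) * of_nat (m choose snd x))"
  have c: "comb m c \<in> irr m" unfolding c_def by (rule binomial_comb_in_irr)
  have c0: "c x \<noteq> 0" if "x \<in> {..m} \<times> {..m}" for x using that by (auto simp: c_def)
  define u where "u n = comb m (\<lambda>x. if wt x = n then c x else 0)" for n
  let ?N = "{- int m..int m}"
  have u: "u n \<in> irr m" if "n \<in> ?N" for n
    unfolding u_def by (rule weight_component_mem[OF su2_invariant_subspace_irr c]) (use that in auto)
  have lin: "g n = 0" if g: "(\<Sum>n\<in>?N. fscale (g n) (u n)) = 0" and n: "n \<in> ?N" for g n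
  proof -
    have "comb m (\<lambda>x. g (wt x) * c x) = (\<Sum>n\<in>?N. fscale (g n) (u n))"
    proof
      fix p
      have "(\<Sum>n\<in>?N. fscale (g n) (u n)) p = (\<Sum>n\<in>?N. \<Sum>x\<in>{..m} \<times> {..m}. if wt x = n then g n * c x * sph m (fst x) (snd x) p else 0)"
        unfolding sum_fun_apply fscale_apply u_def comb_apply sum_distrib_left
        by (intro sum.cong refl) auto
      also have "\<dots> = (\<Sum>x\<in>{..m} \<times> {..m}. \<Sum>n\<in>?N. if wt x = n then g n * c x * sph m (fst x) (snd x) p else 0)"
        by (rule sum.swap)
      also have "\<dots> = (\<Sum>x\<in>{..m} \<times> {..m}. g (wt x) * c x * sph m (fst x) (snd x) p)"
        by (intro sum.cong refl, subst sum.delta') (auto simp: wt_def)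
      finally show "comb m (\<lambda>x. g (wt x) * c x) p = (\<Sum>n\<in>?N. fscale (g n) (u n)) p"
        by (simp only: comb_apply)
    qed
    then have z: "comb m (\<lambda>x. g (wt x) * c x) = 0" using g by (simp only:)
    \<comment> \<open>One index pair of weight n suffices to read off g n, since its coefficient in
      c is nonzero.\<close>
    define x where "x = (if n \<ge> 0 then (nat n, 0) else (0, nat (- n)))"
    have x: "x \<in> {..m} \<times> {..m}" "wt x = n" using n by (auto simp: x_def wt_def)
    have "g (wt x) * c x = 0" by (rule comb_eq_0_imp[OF z x(1)])
    then show ?thesis using c0[OF x(1)] x(2) by simp
  qed
  \<comment> \<open>Independence is a property of the set of vectors, so the components must be
    shown distinct before counting; a coincidence would be the relation u n - u n' = 0.\<close>
  have inj: "inj_on u ?N"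
  proof (rule inj_onI, rule ccontr)
    fix n n' assume h: "n \<in> ?N" "n' \<in> ?N" "u n = u n'" "n \<noteq> n'"
    let ?g = "\<lambda>k. if k = n then 1 else if k = n' then -1 else 0 :: complex"
    have "(\<Sum>k\<in>?N. fscale (?g k) (u k)) = (\<Sum>k\<in>{n, n'}. fscale (?g k) (u k))"
      by (rule sum.mono_neutral_right) (use h in \<open>auto simp del: fscale_apply\<close>)
    also have "\<dots> = fscale 1 (u n) + fscale (- 1) (u n')" using h(4) by (simp del: fscale_apply)
    also have "\<dots> = 0" unfolding h(3) fs.scale_left_distrib[symmetric] by (simp only: right_minus fs.scale_zero_left)
    finally have "?g n = 0" using h(1) by (rule lin)
    then show False by simp
  qed
  have "fs.independent (u ` ?N)"
  proof (rule fs.independent_if_scalars_zero)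
    fix f x assume f: "(\<Sum>x\<in>u ` ?N. fscale (f x) x) = 0" and x: "x \<in> u ` ?N"
    then obtain n where n: "n \<in> ?N" "x = u n" by blast
    have "(\<Sum>n\<in>?N. fscale (f (u n)) (u n)) = 0"
      using f unfolding sum.reindex[OF inj] o_def .
    then show "f x = 0" using lin[of "\<lambda>n. f (u n)", OF _ n(1)] n(2) by blast
  qed simp
  moreover obtain B where B: "finite B" "B \<subseteq> irr m" "fs.independent B" "fs.span B = irr m" "card B = fs.dim (irr m)"
    by (rule finite_dim_basis[OF su2_invariant_subspaceD(2)[OF su2_invariant_subspace_irr] irr_subset_span finite_sphs])
  moreover have "u ` ?N \<subseteq> fs.span B" unfolding B(4) using u by blast
  ultimately have "card (u ` ?N) \<le> fs.dim (irr m)"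
    using fs.independent_span_bound[OF B(1), of "u ` ?N"] B(5) by auto
  then show ?thesis by (simp add: card_image[OF inj])
qed

lemma dim_irr: "fs.dim (irr m) = 2 * m + 1"
  using dim_irr_le dim_irr_ge by (rule antisym)

subsection \<open>Uniqueness and the eigenvalues\<close>

lemma dim_Bz_image:
  assumes V: "su2_invariant_subspace V" and B: "finite B" "B \<subseteq> V" "fs.independent B" "fs.span B = V"
    and inj: "\<And>f. f \<in> V \<Longrightarrow> Bz \<tau> f = 0 \<Longrightarrow> f = 0"
  shows "fs.dim (Bz \<tau> ` V) = card B"
proof -
  note VD = su2_invariant_subspaceD[OF V]
  have cont: "cp1_continuous b" if "b \<in> B" for b using that B(2) VD(1) by blast
  have inj_on: "inj_on (Bz \<tau>) V"
  proof (rule inj_onI)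
    fix f g assume fg: "f \<in> V" "g \<in> V" "Bz \<tau> f = Bz \<tau> g"
    have d: "f - g \<in> V" by (rule fs.subspace_diff[OF VD(2) fg(1,2)])
    have "Bz \<tau> (f - g + g) = Bz \<tau> (f - g) + Bz \<tau> g"
      by (rule Bz_add[OF VD(1)[OF d] VD(1)[OF fg(2)]])
    then have "Bz \<tau> (f - g) = 0"
      unfolding diff_add_cancel fg(3) by (metis add_cancel_left_left)
    then have "f - g = 0" by (rule inj[OF d])
    then show "f = g" by (simp only: right_minus_eq)
  qed
  then have inj_B: "inj_on (Bz \<tau>) B" using B(2) by (rule inj_on_subset)
  have ind: "fs.independent (Bz \<tau> ` B)"
  proof (rule fs.independent_if_scalars_zero)
    fix h x assume h: "(\<Sum>x\<in>Bz \<tau> ` B. fscale (h x) x) = 0" and x: "x \<in> Bz \<tau> ` B"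
    obtain b where b: "b \<in> B" "x = Bz \<tau> b" using x by blast
    have "(\<Sum>b\<in>B. fscale (h (Bz \<tau> b)) (Bz \<tau> b)) = 0"
      using h unfolding sum.reindex[OF inj_B] o_def .
    then have "Bz \<tau> (\<Sum>b\<in>B. fscale (h (Bz \<tau> b)) b) = 0"
      by (subst Bz_sum[OF cont])
    moreover have "(\<Sum>b\<in>B. fscale (h (Bz \<tau> b)) b) \<in> V"
      using B(2) by (intro fs.subspace_sum fs.subspace_scale VD(2)) blast
    ultimately have "(\<Sum>b\<in>B. fscale (h (Bz \<tau> b)) b) = 0" using inj by blast
    then have "h (Bz \<tau> b) = 0"
      using fs.independentD[OF B(3,1) order_refl, of "\<lambda>b. h (Bz \<tau> b)"] b(1) by blast
    then show "h x = 0" unfolding b(2) .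
  qed (use B(1) in simp)
  have "Bz \<tau> ` V \<subseteq> fs.span (Bz \<tau> ` B)"
  proof
    fix y assume "y \<in> Bz \<tau> ` V"
    then obtain f where f: "f \<in> fs.span B" "y = Bz \<tau> f" using B(4) by blast
    then obtain h where "f = (\<Sum>b\<in>B. fscale (h b) b)"
      unfolding fs.span_finite[OF B(1)] by blast
    then have "y = (\<Sum>b\<in>B. fscale (h b) (Bz \<tau> b))"
      using f(2) Bz_sum[OF cont, of B \<tau> h] by (simp only:)
    also have "\<dots> \<in> fs.span (Bz \<tau> ` B)"
      by (intro fs.span_sum fs.span_scale fs.span_base imageI)
    finally show "y \<in> fs.span (Bz \<tau> ` B)" .
  qed
  moreover have "Bz \<tau> ` B \<subseteq> Bz \<tau> ` V" using B(2) by blast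
  ultimately have "fs.dim (Bz \<tau> ` V) = card (Bz \<tau> ` B)"
    using ind by (intro fs.basis_card_eq_dim[symmetric])
  then show ?thesis using card_image[OF inj_B] by simp
qed

lemma irreducible_eq_irr:
  assumes irred: "su2_irreducible V" and dim: "fs.dim V = 2 * m + 1"
  shows "V = irr m"
proof -
  have V: "su2_invariant_subspace V" "V \<noteq> {0}"
    and min: "\<And>W. su2_invariant_subspace W \<Longrightarrow> W \<subseteq> V \<Longrightarrow> W = {0} \<or> W = V"
    using irred unfolding su2_irreducible_def by blast+
  note VD = su2_invariant_subspaceD[OF V(1)] and irrD = su2_invariant_subspaceD[OF su2_invariant_subspace_irr]
  obtain B where B: "B \<subseteq> V" "fs.independent B" "V \<subseteq> fs.span B" "card B = fs.dim V"
    by (rule fs.basis_exists[of V])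
  \<comment> \<open>\<open>card\<close> is 0 on infinite sets, so the positive value 2 m + 1 forces
    the basis to be finite.\<close>
  have finB: "finite B" using B(4) dim by (intro card_ge_0_finite) simp
  have spanB: "fs.span B = V" using fs.span_minimal[OF B(1) VD(2)] B(3) by blast
  have Bz_mem: "Bz \<tau> f \<in> irr m" if f: "f \<in> V" for \<tau> f
  proof (cases "\<forall>f\<in>V. Bz \<tau> f = 0")
    case True
    then show ?thesis using f fs.subspace_0[OF irrD(2)] by (simp only:)
  next
    case False
    \<comment> \<open>The kernel on V is invariant and not all of V, hence trivial by
      irreducibility.\<close>
    let ?K = "{f \<in> V. Bz \<tau> f \<in> {0}}"
    have "su2_invariant_subspace ?K"
      by (rule su2_invariant_subspace_Bz_vimage[OF V(1) su2_invariant_subspace_zero])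
    then have "?K = {0} \<or> ?K = V" by (rule min) blast
    moreover have "?K \<noteq> V" using False by blast
    ultimately have K: "?K = {0}" by blast
    then have inj: "f = 0" if "f \<in> V" "Bz \<tau> f = 0" for f using that by blast
    have "Bz \<tau> ` V \<subseteq> fs.span (sphs \<tau>)" using Bz_in_span VD(1) by blast
    moreover have "Bz \<tau> ` V \<noteq> {0}" using False by blast
    ultimately obtain j where j: "hw j \<in> Bz \<tau> ` V"
      by (rule invariant_subspace_contains_hw[OF su2_invariant_subspace_Bz_image[OF V(1)]])
    have sub: "irr j \<subseteq> Bz \<tau> ` V"
      by (rule irr_least[OF su2_invariant_subspace_Bz_image[OF V(1)] j])
    \<comment> \<open>This part of V contains a preimage of \<open>hw j\<close>, so it is all of V
      and the image is exactly \<open>irr j\<close>. Injectivity then compares dimensions and gives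
      j = m.\<close>
    let ?Q = "{f \<in> V. Bz \<tau> f \<in> irr j}"
    have "su2_invariant_subspace ?Q"
      by (rule su2_invariant_subspace_Bz_vimage[OF V(1) su2_invariant_subspace_irr])
    then have "?Q = {0} \<or> ?Q = V" by (rule min) blast
    moreover have "?Q \<noteq> {0}"
    proof
      assume Q: "?Q = {0}"
      obtain h where h: "h \<in> V" "hw j = Bz \<tau> h" using j by blast
      then have "h \<in> ?Q" using hw_in_irr[of j] by (simp only: mem_Collect_eq simp_thms)
      then have "h = 0" using Q by blast
      then have "hw j = 0" unfolding h(2) by (simp only: Bz_zero)
      then show False using hw_nonzero by contradiction
    qed
    ultimately have Q: "?Q = V" by blast
    then have eq: "Bz \<tau> ` V = irr j" using sub by blast
    have "fs.dim (Bz \<tau> ` V) = card B"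
      using inj by (rule dim_Bz_image[OF V(1) finB B(1,2) spanB])
    then have "fs.dim (irr j) = card B" unfolding eq .
    then have "j = m" using dim_irr[of j] B(4) dim by simp
    then show ?thesis using Q f by blast
  qed
  obtain C where C: "finite C" "C \<subseteq> irr m" "fs.independent C" "fs.span C = irr m" "card C = fs.dim (irr m)"
    by (rule finite_dim_basis[OF irrD(2) irr_subset_span finite_sphs])
  have "V \<subseteq> irr m"
  proof
    fix f assume f: "f \<in> V"
    have "f \<in> fs.span C"
    proof (rule span_pointwise_closed[OF C(1)])
      show "cp1_continuous g" if "g \<in> C" for g using that C(2) irrD(1) by blast
      show "fscale (of_nat (\<tau> + 1)) (Bz \<tau> f) \<in> fs.span C" for \<tau>
        unfolding C(4) by (intro fs.subspace_scale irrD(2) Bz_mem f)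
      show "(\<lambda>\<tau>. fscale (of_nat (\<tau> + 1)) (Bz \<tau> f) (Some z)) \<longlonglongrightarrow> f (Some z)" for z
        using Bz_approx_identity[OF VD(1)[OF f], of z] by (simp only: fscale_apply)
      show "cp1_continuous f" by (rule VD(1)[OF f])
    qed
    then show "f \<in> irr m" unfolding C(4) .
  qed
  then show ?thesis
    using su2_irreducible_irr[of m] V unfolding su2_irreducible_def by blast
qed

lemma Htilde_eq_irr: "Htilde m = irr m"
  unfolding Htilde_def
  by (rule the_equality) (use su2_irreducible_irr dim_irr irreducible_eq_irr in blast)+

section \<open>From eigenvalues to the hypergeometric series\<close>

lemma pochhammer_minus_nat:
  assumes "l \<le> n"
  shows "pochhammer (- real n) l = (- 1) ^ l * fact n / fact (n - l)"
  using assms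
proof (induction l)
  case (Suc l)
  then have "n - l = Suc (n - Suc l)" by simp
  then have "fact (n - l) = real (n - l) * fact (n - Suc l)" by (metis fact_Suc)
  moreover have "- real n + real l = - real (n - l)" "real (n - l) \<noteq> 0"
    using Suc.prems by (simp_all add: of_nat_diff)
  ultimately show ?case
    using Suc by (simp add: pochhammer_Suc del: of_nat_diff)
qed simp

text \<open>Pochhammer symbols of negative integers are signed quotients of factorials. Three signs
  (-1)^l above and two below leave one, which turns (-1)^k into (-1)^(k - l); the denominators are
  nonzero because l \<le> \<mu>.\<close>

lemma lam_hypergeometric_term:
  assumes "l \<le> k" "k \<le> \<mu>" "m \<le> \<mu>"
  shows "(-1) ^ (k - l) * real (k choose l) * lam (\<mu> - l) m
       = (-1) ^ k * (fact \<mu>)\<^sup>2 / (fact (\<mu> - m) * fact (\<mu> + m + 1)) *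
         (pochhammer (- real k) l * pochhammer (- real m - real \<mu> - 1) l * pochhammer (real m - real \<mu>) l /
          (pochhammer (- real \<mu>) l * pochhammer (- real \<mu>) l * fact l))"
proof -
  have e: "- real m - real \<mu> - 1 = - real (\<mu> + m + 1)" "real m - real \<mu> = - real (\<mu> - m)"
    using assms by (simp_all add: of_nat_diff)
  show ?thesis
  proof (cases "m \<le> \<mu> - l")
    case True
    have sign: "(-1 :: real) ^ (k - l) = (-1) ^ k * (-1) ^ l"
    proof -
      have "(-1 :: real) ^ k = (-1) ^ (k - l) * (-1) ^ l" using assms(1) by (simp flip: power_add)
      then show ?thesis by (simp add: mult.assoc flip: power_mult_distrib)
    qed
    have s2: "(-1 :: real) ^ l * (-1) ^ l = 1" by (simp flip: power_mult_distrib)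
    have p: "pochhammer (- real k) l = (-1) ^ l * fact k / fact (k - l)"
      "pochhammer (- real (\<mu> + m + 1)) l = (-1) ^ l * fact (\<mu> + m + 1) / fact (\<mu> + m + 1 - l)"
      "pochhammer (- real (\<mu> - m)) l = (-1) ^ l * fact (\<mu> - m) / fact (\<mu> - m - l)"
      "pochhammer (- real \<mu>) l = (-1) ^ l * fact \<mu> / fact (\<mu> - l)"
      by (rule pochhammer_minus_nat, use assms True in simp)+
    have b: "real (k choose l) = fact k / (fact l * fact (k - l))"
      using assms(1) by (rule binomial_fact)
    have l: "lam (\<mu> - l) m = (fact (\<mu> - l))\<^sup>2 / (fact (\<mu> - m - l) * fact (\<mu> + m + 1 - l))"
    proof -
      have "\<mu> - l - m = \<mu> - m - l" "\<mu> - l + m + 1 = \<mu> + m + 1 - l" using assms by simp_all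
      then show ?thesis unfolding lam_def using True by (simp only: if_True)
    qed
    have gen: "(u * s) * (K / (L * K')) * (M'\<^sup>2 / (P' * Q')) = u * M\<^sup>2 / (P * Q) *
        ((s * K / K') * (s * Q / Q') * (s * P / P') / ((s * M / M') * (s * M / M') * L))"
      if "s * s = 1" "M \<noteq> 0" "P \<noteq> 0" "Q \<noteq> 0" "M' \<noteq> 0" for u s K L K' M M' P P' Q Q' :: real
    proof -
      have "s \<noteq> 0" using that(1) by auto
      then show ?thesis using that by (simp add: field_simps power2_eq_square)
    qed
    show ?thesis
      unfolding e p b l sign by (rule gen[OF s2]) simp_all
  \<comment> \<open>For l > \<mu> - m both sides are 0: the Pochhammer symbol of m - \<mu> runs
    through 0 exactly when the eigenvalue vanishes.\<close>
  next
    case False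
    then have "pochhammer (- real (\<mu> - m)) l = 0"
      using assms by (intro pochhammer_of_nat_eq_0_lemma) simp
    moreover have "lam (\<mu> - l) m = 0" using False by (simp add: lam_def)
    ultimately show ?thesis unfolding e by simp
  qed
qed

theorem mainTheorem11:
  fixes \<mu> k m :: nat
  assumes "k \<le> \<mu>"
  shows "(m \<le> \<mu> \<longrightarrow> (\<forall>f\<in>Htilde m. \<forall>z. E_op \<mu> k f z =
            complex_of_real ((-1) ^ k * real (\<mu> choose k) * (fact \<mu>)\<^sup>2 *
              hyp3F2_term k (- real m - real \<mu> - 1) (real m - real \<mu>) (- real \<mu>) (- real \<mu>) /
              (fact (\<mu> - m) * fact (\<mu> + m + 1))) * f (Some z)))
       \<and> (\<mu> < m \<longrightarrow> (\<forall>f\<in>Htilde m. \<forall>z. E_op \<mu> k f z = 0))"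
proof -
  have E: "E_op \<mu> k f z = complex_of_real (real (\<mu> choose k) * (\<Sum>l\<le>k. (-1) ^ (k - l) * real (k choose l) * lam (\<mu> - l) m)) * f (Some z)"
    if f: "f \<in> Htilde m" for f z
  proof -
    have "berezin \<tau> f z = complex_of_real (lam \<tau> m) * f (Some z)" for \<tau>
      using Bz_irr[of f m \<tau>] f by (simp add: berezin_eq_Bz Htilde_eq_irr)
    then show ?thesis
      by (simp add: E_op_def sum_distrib_right mult.assoc)
  qed
  have hyp: "real (\<mu> choose k) * (\<Sum>l\<le>k. (-1) ^ (k - l) * real (k choose l) * lam (\<mu> - l) m)
     = (-1) ^ k * real (\<mu> choose k) * (fact \<mu>)\<^sup>2 *
         hyp3F2_term k (- real m - real \<mu> - 1) (real m - real \<mu>) (- real \<mu>) (- real \<mu>) /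
         (fact (\<mu> - m) * fact (\<mu> + m + 1))" if "m \<le> \<mu>"
  proof -
    have "(\<Sum>l\<le>k. (-1) ^ (k - l) * real (k choose l) * lam (\<mu> - l) m)
       = (-1) ^ k * (fact \<mu>)\<^sup>2 / (fact (\<mu> - m) * fact (\<mu> + m + 1)) *
         hyp3F2_term k (- real m - real \<mu> - 1) (real m - real \<mu>) (- real \<mu>) (- real \<mu>)"
      unfolding hyp3F2_term_def sum_distrib_left
      by (intro sum.cong refl lam_hypergeometric_term) (use that assms in auto)
    then show ?thesis by simp
  qed
  \<comment> \<open>All degrees \<mu> - l are below m, so every summand is 0 separately, without
    cancellation.\<close>
  have zero: "lam (\<mu> - l) m = 0" if "\<mu> < m" for l
    using that by (simp add: lam_def)
  show ?thesis
    by (intro conjI impI ballI allI) (simp_all only: E hyp, simp add: zero)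
qed

end
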